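(* Let $E$ be an arbitrary directed graph and $K$ a field. Consider the Leavitt path algebra $L_K(E)$ as a $\mathbb{Z}$-graded ring with the grading determined by the function $w:E^1\to\mathbb{Z}$, $w(e)=1$ for all $e\in E^1$. Then the monoid $\mathcal{V}^{\mathrm{gr}}(L_K(E))$ is cancellative, that is, $x+z=y+z$ implies $x=y$.
   Context: A directed graph $E=(E^0,E^1,r,s)$ has sets $E^0$ of vertices, $E^1$ of edges and range/source maps $r,s:E^1\to E^0$. A vertex $v$ is regular if $s^{-1}(v)$ is finite and nonempty. The Leavitt path algebra $L_K(E)$ is the $K$-algebra generated by $\{v\}_{v\in E^0}\cup\{e,e^*\}_{e\in E^1}$ subject to: $uv=\delta_{u,v}v$; $s(e)e=er(e)=e$; $r(e)e^*=e^*=e^*s(e)$; $e^*f=\delta_{e,f}r(e)$; and $v=\sum_{e\in s^{-1}(v)}ee^*$ for every regular vertex $v$. It is $\mathbb{Z}$-graded with $\deg v=0$, $\deg e=w(e)=1$, $\deg e^*=-1$, and it has graded local units (finite sums of distinct vertices). For a graded ring $A$ with graded local units, $\mathcal{V}^{\mathrm{gr}}(A)$ is the abelian monoid, under direct sum, of graded-isomorphism classes of finitely generated projective objects in the category of graded left $A$-modules $M$ with $AM=M$ (morphisms preserve the grading). *)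

theory Defs
  imports
    "HOL-Library.Poly_Mapping"
    "Graph_Theory.Digraph"
    "HOL-Algebra.Algebra"
begin

section \<open>Graded rings without unit and their unital graded modules\<close>

text \<open>
  Rings here need not have an identity. They are carried by the HOL-Algebra record \<open>ring\<close>, whose
  \<open>one\<close> field is ignored, just as the \<open>one\<close> and \<open>mult\<close> fields of a module record are.
  Gradings are by the integers and part of the record.
\<close>

record 'a gring = "'a ring" +
  rgrade :: "int \<Rightarrow> 'a set"

record ('a, 'b) gmodule = "('a, 'b) module" +
  grade :: "int \<Rightarrow> 'b set"

text \<open>\<open>M\<close> is, as an abelian group, the internal direct sum of the family \<open>C\<close>.\<close>

definition internal_direct_sum :: "('b, 'm) ring_scheme \<Rightarrow> (int \<Rightarrow> 'b set) \<Rightarrow> bool" where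
  "internal_direct_sum M C \<longleftrightarrow>
     (\<forall>n. additive_subgroup (C n) M) \<and>
     (\<forall>x \<in> carrier M. \<exists>!c. (\<forall>n. c n \<in> C n) \<and> finite {n. c n \<noteq> \<zero>\<^bsub>M\<^esub>} \<and>
        x = finsum M c {n. c n \<noteq> \<zero>\<^bsub>M\<^esub>})"

locale graded_module = abelian_group M
  for A :: "'a gring" and M :: "('a, 'b) gmodule" (structure) +
  assumes smult_closed: "\<lbrakk>a \<in> carrier A; x \<in> carrier M\<rbrakk> \<Longrightarrow> a \<odot> x \<in> carrier M"
    and smult_l_distr: "\<lbrakk>a \<in> carrier A; b \<in> carrier A; x \<in> carrier M\<rbrakk> \<Longrightarrow>
      (a \<oplus>\<^bsub>A\<^esub> b) \<odot> x = a \<odot> x \<oplus> b \<odot> x"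
    and smult_r_distr: "\<lbrakk>a \<in> carrier A; x \<in> carrier M; y \<in> carrier M\<rbrakk> \<Longrightarrow>
      a \<odot> (x \<oplus> y) = a \<odot> x \<oplus> a \<odot> y"
    and smult_assoc: "\<lbrakk>a \<in> carrier A; b \<in> carrier A; x \<in> carrier M\<rbrakk> \<Longrightarrow>
      (a \<otimes>\<^bsub>A\<^esub> b) \<odot> x = a \<odot> (b \<odot> x)"
    and grading: "internal_direct_sum M (grade M)"
    and smult_grade: "\<lbrakk>a \<in> rgrade A m; x \<in> grade M n\<rbrakk> \<Longrightarrow> a \<odot> x \<in> grade M (m + n)"

text \<open>The condition \<open>AM = M\<close>, where \<open>AM\<close> consists of the finite sums of products \<open>ax\<close>.\<close>

locale unital_graded_module = graded_module +
  assumes unital: "generate (add_monoid M) {a \<odot> x | a x. a \<in> carrier A \<and> x \<in> carrier M} = carrier M"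

definition gmod_hom :: "'a gring \<Rightarrow> ('a, 'b) gmodule \<Rightarrow> ('a, 'c) gmodule \<Rightarrow> ('b \<Rightarrow> 'c) set" where
  "gmod_hom A M N = {f. f \<in> carrier M \<rightarrow> carrier N \<and>
     (\<forall>x \<in> carrier M. \<forall>y \<in> carrier M. f (x \<oplus>\<^bsub>M\<^esub> y) = f x \<oplus>\<^bsub>N\<^esub> f y) \<and>
     (\<forall>a \<in> carrier A. \<forall>x \<in> carrier M. f (a \<odot>\<^bsub>M\<^esub> x) = a \<odot>\<^bsub>N\<^esub> f x) \<and>
     (\<forall>n. f ` grade M n \<subseteq> grade N n)}"

definition gmod_isomorphic :: "'a gring \<Rightarrow> ('a, 'b) gmodule \<Rightarrow> ('a, 'c) gmodule \<Rightarrow> bool" where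
  "gmod_isomorphic A M N \<longleftrightarrow> (\<exists>f \<in> gmod_hom A M N. bij_betw f (carrier M) (carrier N))"

definition gmod_sum :: "('a, 'b) gmodule \<Rightarrow> ('a, 'c) gmodule \<Rightarrow> ('a, 'b \<times> 'c) gmodule" where
  "gmod_sum M N =
     \<lparr>carrier = carrier M \<times> carrier N, monoid.mult = undefined, one = undefined,
      ring.zero = (\<zero>\<^bsub>M\<^esub>, \<zero>\<^bsub>N\<^esub>), add = (\<lambda>(x, y) (x', y'). (x \<oplus>\<^bsub>M\<^esub> x', y \<oplus>\<^bsub>N\<^esub> y')),
      smult = (\<lambda>a (x, y). (a \<odot>\<^bsub>M\<^esub> x, a \<odot>\<^bsub>N\<^esub> y)), grade = (\<lambda>n. grade M n \<times> grade N n)\<rparr>"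

definition fin_gen_gmod :: "'a gring \<Rightarrow> ('a, 'b) gmodule \<Rightarrow> bool" where
  "fin_gen_gmod A M \<longleftrightarrow>
     (\<exists>S. finite S \<and> S \<subseteq> carrier M \<and> (\<forall>H. submodule H A M \<and> S \<subseteq> H \<longrightarrow> H = carrier M))"

text \<open>
  Projectivity in the category of unital graded modules: lifting of graded homomorphisms along
  graded epimorphisms. The test modules live on the same type \<open>'b\<close> as \<open>P\<close>; the next
  section explains why this is no restriction where the notion is used.
\<close>

definition projective_gmod :: "'a gring \<Rightarrow> ('a, 'b) gmodule \<Rightarrow> bool" where
  "projective_gmod A P \<longleftrightarrow>
     (\<forall>(M :: ('a, 'b) gmodule) (N :: ('a, 'b) gmodule) g f.
        unital_graded_module A M \<and> unital_graded_module A N \<and>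
        g \<in> gmod_hom A M N \<and> g ` carrier M = carrier N \<and> f \<in> gmod_hom A P N \<longrightarrow>
        (\<exists>h \<in> gmod_hom A P M. \<forall>x \<in> carrier P. g (h x) = f x))"


section \<open>The graded V-monoid\<close>

text \<open>
  HOL has no class of all modules, so modules are taken on the type \<open>nat \<Rightarrow> 'a\<close>, where \<open>'a\<close> is the
  type of ring elements. For a graded ring \<open>A\<close> with graded local units this type is large enough:
  every finitely generated unital graded module is an image of some \<open>F = Ae\<^sub>1(d\<^sub>1) \<oplus> \<dots> \<oplus> Ae\<^sub>k(d\<^sub>k)\<close>
  with \<open>e\<^sub>i\<close> homogeneous idempotents, and \<open>F\<close> is contained in \<open>A\<^sup>k\<close>. Hence every finitely generated
  projective has an isomorphic copy on \<open>nat \<Rightarrow> 'a\<close>, and a module on \<open>nat \<Rightarrow> 'a\<close> that is projective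
  with respect to test modules on \<open>nat \<Rightarrow> 'a\<close> is a summand of such an \<open>F\<close>, so is projective with
  respect to all of them.
\<close>

definition fg_proj_gmods :: "'a gring \<Rightarrow> ('a, nat \<Rightarrow> 'a) gmodule set" where
  "fg_proj_gmods A = {P. unital_graded_module A P \<and> fin_gen_gmod A P \<and> projective_gmod A P}"

definition gmod_iso_rel ::
    "'a gring \<Rightarrow> (('a, nat \<Rightarrow> 'a) gmodule \<times> ('a, nat \<Rightarrow> 'a) gmodule) set" where
  "gmod_iso_rel A =
     {(P, Q). P \<in> fg_proj_gmods A \<and> Q \<in> fg_proj_gmods A \<and> gmod_isomorphic A P Q}"

text \<open>
  The monoid operation, induced by direct sum, is written multiplicatively as always for
  HOL-Algebra monoids. The product of two classes collects all modules on \<open>nat \<Rightarrow> 'a\<close> isomorphic to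
  a direct sum (which itself lives on a product type) of representatives.
\<close>

definition gr_V :: "'a gring \<Rightarrow> ('a, nat \<Rightarrow> 'a) gmodule set monoid" where
  "gr_V A =
     \<lparr>carrier = fg_proj_gmods A // gmod_iso_rel A,
      monoid.mult = (\<lambda>x y. {M \<in> fg_proj_gmods A. \<exists>P \<in> x. \<exists>Q \<in> y. gmod_isomorphic A M (gmod_sum P Q)}),
      one = {M \<in> fg_proj_gmods A. carrier M = {\<zero>\<^bsub>M\<^esub>}}\<rparr>"


section \<open>Leavitt path algebras\<close>

text \<open>
  The polynomial mapping type over a monoid is its monoid algebra (with convolution product), so
  over words it is the free associative algebra.
\<close>

datatype 'g fmon = Word (letters: "'g list")

instantiation fmon :: (type) monoid_add
begin
definition zero_fmon_def: "0 = Word []"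
definition plus_fmon_def: "u + v = Word (letters u @ letters v)"
instance
  by standard (simp_all add: zero_fmon_def plus_fmon_def)
end

datatype ('v, 'e) lpa_gen = Vertex 'v | Edge 'e | Ghost 'e

type_synonym ('v, 'e, 'k) lpa_free = "('v, 'e) lpa_gen fmon \<Rightarrow>\<^sub>0 'k"

definition gen :: "('v, 'e) lpa_gen \<Rightarrow> ('v, 'e, 'k::field) lpa_free" where
  "gen x = Poly_Mapping.single (Word [x]) 1"

definition lpa_gens :: "('v, 'e) pre_digraph \<Rightarrow> ('v, 'e) lpa_gen set" where
  "lpa_gens E = Vertex ` verts E \<union> Edge ` arcs E \<union> Ghost ` arcs E"

definition free_ring :: "('v, 'e) pre_digraph \<Rightarrow> ('v, 'e, 'k::field) lpa_free ring" where
  "free_ring E =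
     \<lparr>carrier = {p. \<forall>w \<in> Poly_Mapping.keys p. set (letters w) \<subseteq> lpa_gens E},
      monoid.mult = (*), one = 1, ring.zero = 0, add = (+)\<rparr>"

definition regular_vertex :: "('v, 'e) pre_digraph \<Rightarrow> 'v \<Rightarrow> bool" where
  "regular_vertex E v \<longleftrightarrow> v \<in> verts E \<and> finite (out_arcs E v) \<and> out_arcs E v \<noteq> {}"

definition lpa_relators :: "('v, 'e) pre_digraph \<Rightarrow> ('v, 'e, 'k::field) lpa_free set" where
  "lpa_relators E =
     {gen (Vertex u) * gen (Vertex v) - (if u = v then gen (Vertex v) else 0) | u v.
        u \<in> verts E \<and> v \<in> verts E} \<union>
     {gen (Vertex (tail E e)) * gen (Edge e) - gen (Edge e) | e. e \<in> arcs E} \<union>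
     {gen (Edge e) * gen (Vertex (head E e)) - gen (Edge e) | e. e \<in> arcs E} \<union>
     {gen (Vertex (head E e)) * gen (Ghost e) - gen (Ghost e) | e. e \<in> arcs E} \<union>
     {gen (Ghost e) * gen (Vertex (tail E e)) - gen (Ghost e) | e. e \<in> arcs E} \<union>
     {gen (Ghost e) * gen (Edge f) - (if e = f then gen (Vertex (head E e)) else 0) | e f.
        e \<in> arcs E \<and> f \<in> arcs E} \<union>
     {gen (Vertex v) - (\<Sum>e \<in> out_arcs E v. gen (Edge e) * gen (Ghost e)) | v.
        regular_vertex E v}"

definition lpa_ideal :: "('v, 'e) pre_digraph \<Rightarrow> ('v, 'e, 'k::field) lpa_free set" where
  "lpa_ideal E = Idl\<^bsub>free_ring E\<^esub> (lpa_relators E)"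

text \<open>The degree of a word when the edge \<open>e\<close> is given degree \<open>w e\<close>.\<close>

fun gen_degree :: "('e \<Rightarrow> int) \<Rightarrow> ('v, 'e) lpa_gen \<Rightarrow> int" where
  "gen_degree w (Vertex v) = 0"
| "gen_degree w (Edge e) = w e"
| "gen_degree w (Ghost e) = - w e"

definition word_degree :: "('e \<Rightarrow> int) \<Rightarrow> ('v, 'e) lpa_gen fmon \<Rightarrow> int" where
  "word_degree w u = sum_list (map (gen_degree w) (letters u))"

text \<open>
  The algebra is presented without unit: only classes of elements with zero constant term (the
  coefficient at the empty word \<open>0\<close>) belong to it. All relators have zero constant term, so this is
  the free non-unital algebra modulo the ideal generated by the relators. If \<open>verts E\<close> is finite, the
  sum of the vertices is an identity element.
\<close>

definition free_augmentation :: "('v, 'e) pre_digraph \<Rightarrow> ('v, 'e, 'k::field) lpa_free set" where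
  "free_augmentation E = {p \<in> carrier (free_ring E). Poly_Mapping.lookup p 0 = 0}"

definition leavitt_path_algebra ::
    "'k::field itself \<Rightarrow> ('v, 'e) pre_digraph \<Rightarrow> ('e \<Rightarrow> int) \<Rightarrow> ('v, 'e, 'k) lpa_free set gring" where
  "leavitt_path_algebra K E w =
     \<lparr>carrier = {lpa_ideal E +>\<^bsub>free_ring E\<^esub> p | p. p \<in> free_augmentation E},
      monoid.mult = monoid.mult (free_ring E Quot lpa_ideal E),
      one = one (free_ring E Quot lpa_ideal E),
      ring.zero = ring.zero (free_ring E Quot lpa_ideal E),
      add = add (free_ring E Quot lpa_ideal E),
      rgrade = (\<lambda>n. {lpa_ideal E +>\<^bsub>free_ring E\<^esub> p | p.
        p \<in> free_augmentation E \<and> (\<forall>u \<in> Poly_Mapping.keys p. word_degree w u = n)})\<rparr>"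

end

theory Submission
  imports Defs "HOL-Library.Sublist" "Graph_Theory.Arc_Walk"
begin

text \<open>
  By Evans' argument a module cancels from direct sums as soon as its endomorphism ring has stable
  range one. A finitely generated projective graded module is a retract of a module of the form
  \<open>F = \<Oplus>\<^sub>i A e(d\<^sub>i)\<close>, where \<open>e\<close> is a finite sum of vertices, and stable range one passes to
  retracts. A graded endomorphism of \<open>F\<close> is a matrix whose entries are combinations of
  monomials \<open>p q\<^sup>*\<close> with prescribed difference of lengths. Finitely many of them lie in the span of a
  finite set of monomials closed under products, because the product of \<open>p q\<^sup>*\<close> and \<open>r s\<^sup>*\<close> is zero or
  again a monomial in which, up to the shifts \<open>d\<^sub>i\<close>, no path is longer than the given ones.
  So all computations take place in a finite-dimensional algebra, namely a subalgebra of the algebra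
  of a polycyclic monoid, and finite-dimensional algebras have stable range one.
\<close>

section \<open>Stable range one for finite-dimensional algebras\<close>

text \<open>In \<open>L_K(E)\<close> itself the monomials \<open>p q\<^sup>*\<close> are in general
  linearly dependent, already by \<open>v = \<Sum> e e\<^sup>*\<close>. The computation is therefore
  done upstairs, in a monoid algebra where they are basis vectors, and pushed down by a homomorphism
  onto the endomorphism ring: a unit and its inverse go to a unit and its inverse, whatever the
  kernel is. Two features of this algebra shape the proof. Its absorbing element
  \<open>PZero\<close> is a basis vector and not zero, and the idempotent that becomes the identity
  map is not the identity of the algebra, so stable range one is needed for corners too. Finiteness
  comes from the grading. An entry at position \<open>(i, j)\<close> has degree
  \<open>d\<^sub>i - d\<^sub>j\<close>, so the lengths of its two paths agree after correction by
  the shifts, and a product that does not vanish inherits this common value from one factor. Without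
  this balance the powers of a loop would already give infinitely many monomials. Stable range one
  itself is a maximality argument: among the elements \<open>d + e y\<close>, one with the largest
  invertible block in its Fitting decomposition has no nilpotent block left.\<close>

locale findim_subalgebra = vector_space scale
  for scale :: "'k::field \<Rightarrow> 'r::ring_1 \<Rightarrow> 'r" +
  fixes B S :: "'r set"
  assumes scale_mult_right: "x * scale k y = scale k (x * y)"
    and scale_mult_left: "scale k x * y = scale k (x * y)"
    and subspace_B: "subspace B"
    and one_B: "1 \<in> B"
    and mult_B: "\<lbrakk>x \<in> B; y \<in> B\<rbrakk> \<Longrightarrow> x * y \<in> B"
    and finite_S: "finite S"
    and B_span: "B \<subseteq> span S"
begin

section \<open>Dimension counting and Drazin inverses in the subalgebra\<close>

lemma add_B: "\<lbrakk>x \<in> B; y \<in> B\<rbrakk> \<Longrightarrow> x + y \<in> B"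
  and diff_B: "\<lbrakk>x \<in> B; y \<in> B\<rbrakk> \<Longrightarrow> x - y \<in> B"
  using subspace_B by (auto intro: subspace_add subspace_diff)

lemma power_B: "x \<in> B \<Longrightarrow> x ^ n \<in> B"
  by (induction n) (auto intro: one_B mult_B)

lemmas B_closed = one_B mult_B add_B diff_B power_B

lemma dim_bound: "V \<subseteq> B \<Longrightarrow> dim V \<le> card S"
  using B_span finite_S dim_le_card by (metis subset_trans)

text \<open>The ambient space may be infinite-dimensional, so a basis of \<open>V\<close> is
  extended inside \<open>W\<close>, where independent sets are finite because \<open>B\<close> lies
  in the span of the finite set \<open>S\<close>.\<close>

lemma dim_strict_mono:
  assumes "subspace V" "V \<subset> W" "W \<subseteq> B"
  shows "dim V < dim W"
proof -
  obtain I where I: "I \<subseteq> V" "independent I" "V \<subseteq> span I" "card I = dim V"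
    using basis_exists by blast
  obtain x where x: "x \<in> W" "x \<notin> V" using assms by blast
  have fin: "finite J" if "independent J" "J \<subseteq> W" for J
    using independent_span_bound[OF finite_S that(1)] that(2) assms(3) B_span by (meson order_trans)
  have "x \<notin> span I"
    using x(2) span_minimal[OF I(1) assms(1)] by (meson subsetD)
  then have ind: "independent (insert x I)"
    using I(2) independent_insertI by blast
  obtain J where J: "J \<subseteq> W" "insert x I \<subseteq> J" "independent J" "W \<subseteq> span J"
    using maximal_independent_subset_extend[OF _ ind, of W] x(1) I(1) assms(2)
    by (metis insert_subset order_trans psubset_imp_subset)
  have "x \<notin> I" using x I(1) by blast
  have "finite J" using fin J by blast
  have "card I < card (insert x I)"
    using \<open>x \<notin> I\<close> finite_subset[OF _ \<open>finite J\<close>, of I] J(2) by simp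
  also have "\<dots> \<le> card J" using J(2) \<open>finite J\<close> by (simp add: card_mono)
  also have "\<dots> = dim W" using J basis_card_eq_dim by blast
  finally show ?thesis using I(4) by simp
qed

text \<open>The subspaces spanned by the powers of \<open>t\<close> from the \<open>i\<close>-th on
  form a descending chain of bounded dimension, so the chain stops. The element \<open>q\<close>
  found there is a polynomial in \<open>t\<close> and hence commutes with \<open>t\<close>.\<close>

lemma power_eq_power_Suc_mult:
  assumes t: "t \<in> B"
  obtains n q where "q \<in> B" "t * q = q * t" "t ^ n = t ^ Suc n * q"
proof -
  define V where "V i = span (range (\<lambda>j. t ^ (i + j)))" for i :: nat
  have sub: "V i \<subseteq> B" for i
    unfolding V_def by (rule span_minimal) (auto intro: power_B t subspace_B)
  have mono: "V (Suc i) \<subseteq> V i" for i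
    unfolding V_def
    by (rule span_mono) (auto simp: image_iff intro!: exI[of _ "Suc _"])
  have "\<exists>i. V (Suc i) = V i"
  proof (rule ccontr)
    assume "\<nexists>i. V (Suc i) = V i"
    then have "dim (V (Suc i)) < dim (V i)" for i
      using mono sub by (intro dim_strict_mono) (auto simp: V_def)
    then have "dim (V i) + i \<le> dim (V 0)" for i
    proof (induction i)
      case (Suc i)
      then show ?case by (smt (verit) add_Suc_right le_less_trans less_eq_Suc_le nat_add_left_cancel_less not_less add.commute)
    qed simp
    from this[of "Suc (dim (V 0))"] show False by simp
  qed
  then obtain i where i: "V (Suc i) = V i" by blast
  have "t ^ (i + 0) \<in> V i" unfolding V_def by (rule span_base) blast
  then have "t ^ i \<in> V (Suc i)" using i by simp
  moreover have "\<exists>q\<in>B. t * q = q * t \<and> x = t ^ Suc i * q" if "x \<in> V (Suc i)" for x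
    using that unfolding V_def
  proof (induction rule: span_induct_alt)
    case base
    show ?case by (rule bexI[of _ 0]) (auto intro: subspace_0 subspace_B)
  next
    case (step c x y)
    then obtain j q where q: "x = t ^ (Suc i + j)" "q \<in> B" "t * q = q * t" "y = t ^ Suc i * q"
      by blast
    show ?case
    proof (intro bexI conjI)
      show "scale c (t ^ j) + q \<in> B"
        using q t by (auto intro!: add_B power_B subspace_scale subspace_B)
      show "t * (scale c (t ^ j) + q) = (scale c (t ^ j) + q) * t"
        using q(3) by (simp add: distrib_left distrib_right scale_mult_left scale_mult_right power_commutes)
      show "scale c x + y = t ^ Suc i * (scale c (t ^ j) + q)"
        using q by (simp add: distrib_left scale_mult_right power_add mult.assoc)
    qed
  qed
  ultimately show ?thesis using that by blast
qed

text \<open>The Drazin inverse: \<open>t * a\<close> is the idempotent of the Fitting decomposition of \<open>t\<close>.\<close>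

lemma drazin_inverse:
  assumes t: "t \<in> B"
  obtains n a where "a \<in> B" "t * a = a * t" "a * t * a = a" "t ^ n * (1 - t * a) = 0"
proof -
  obtain n q where q: "q \<in> B" "t * q = q * t" "t ^ n = t ^ Suc n * q"
    using power_eq_power_Suc_mult[OF t] .
  have comm: "t ^ i * q ^ j = q ^ j * t ^ i" for i j
    by (metis q(2) power_commuting_commutes)
  have step: "t ^ n = t ^ (n + k) * q ^ k" for k
  proof (induction k)
    case (Suc k)
    have "t ^ n = t ^ k * t ^ n * q ^ k" 
      by (subst Suc) (simp add: power_add[symmetric] add.commute)
    also have "\<dots> = t ^ k * (t ^ Suc n * q) * q ^ k" using q(3) by simp
    also have "\<dots> = (t ^ k * t ^ Suc n) * (q * q ^ k)" by (simp only: mult.assoc)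
    finally show ?case by (simp only: power_add[symmetric] power_Suc[symmetric] add_Suc_right add.commute)
  qed simp
  \<comment> \<open>\<open>t ^ n * q ^ n\<close> is the Fitting idempotent of \<open>t\<close>, and
    the one remaining factor \<open>q\<close> inverts \<open>t\<close> on it.\<close>
  define a where "a = t ^ n * q ^ Suc n"
  have aB: "a \<in> B" unfolding a_def by (intro mult_B power_B q t)
  have ta: "t * a = a * t"
    unfolding a_def using comm[of 1 "Suc n"] by (metis mult.assoc power_commutes power_one_right)
  have ta': "t * a = t ^ Suc n * q ^ Suc n" by (simp add: a_def mult.assoc)
  have key: "t ^ n * (t * a) = t ^ n"
  proof -
    have "t ^ n * (t * a) = t ^ (n + Suc n) * q ^ Suc n"
      unfolding ta' by (simp only: power_add mult.assoc)
    then show ?thesis using step[of "Suc n"] by simp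
  qed
  have "a * (t * a) = q ^ Suc n * t ^ n * (t * a)" by (simp only: a_def comm)
  also have "\<dots> = a" using key by (simp only: mult.assoc a_def comm)
  finally have "a * t * a = a" by (simp add: mult.assoc)
  then show ?thesis using that[of a n] aB ta key by (simp add: right_diff_distrib)
qed

section \<open>Enlarging the invertible block; stable range one\<close>

lemma subspace_mult_image:
  assumes "x \<in> B"
  shows "subspace ((*) x ` B)"
proof (rule subspaceI)
  show "0 \<in> (*) x ` B" using imageI[OF subspace_0[OF subspace_B], of "(*) x"] by simp
next
  fix y z assume "y \<in> (*) x ` B" "z \<in> (*) x ` B"
  then obtain b c where "b \<in> B" "c \<in> B" "y = x * b" "z = x * c" by blast
  then show "y + z \<in> (*) x ` B" using imageI[OF add_B, of b c "(*) x"] by (simp add: distrib_left)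
next
  fix k y assume "y \<in> (*) x ` B"
  then obtain b where "b \<in> B" "y = x * b" by blast
  then show "scale k y \<in> (*) x ` B"
    using imageI[OF subspace_scale[OF subspace_B], of b "(*) x" k] by (simp add: scale_mult_right)
qed

text \<open>
  Given \<open>t x + e w = 1\<close> with \<open>t\<close> not invertible, adding an element of \<open>e B\<close> to \<open>t\<close> enlarges the
  right ideal generated by its Drazin idempotent: on the nilpotent part \<open>g B\<close> of \<open>t\<close>, the element
  \<open>g e w g\<close> cannot be nilpotent, and its own Drazin idempotent \<open>h\<close> can be made a new invertible block.
\<close>

lemma enlarge_drazin_idempotent:
  assumes B: "t \<in> B" "a \<in> B" "x \<in> B" "e \<in> B" "w \<in> B"
    and D: "t * a = a * t" "a * t * a = a" "t ^ n * (1 - t * a) = 0"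
    and one: "t * x + e * w = 1" and ne: "t * a \<noteq> 1"
  obtains y t' a' n' where "y \<in> B" "t' = t + e * y" "a' \<in> B" "t' * a' = a' * t'" "a' * t' * a' = a'"
    "t' ^ n' * (1 - t' * a') = 0" "(*) (t * a) ` B \<subset> (*) (t' * a') ` B"
proof -
  define f where "f = t * a"
  define g where "g = 1 - f"
  have fB: "f \<in> B" and gB: "g \<in> B" using B by (auto simp: f_def g_def intro: B_closed)
  have ff: "f * f = f" unfolding f_def using D by (metis mult.assoc)
  have gg: "g * g = g" and fg: "f * g = 0" and gf: "g * f = 0"
    using ff by (auto simp: g_def algebra_simps)
  have ft: "f * t = t * f" unfolding f_def using D(1) by (metis mult.assoc)
  have gt: "g * t = t * g" using ft by (simp add: g_def algebra_simps)
  have g0: "g \<noteq> 0" using ne by (simp add: g_def f_def)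
  have tng: "t ^ n * g = 0" using D(3) by (simp add: g_def f_def)
  \<comment> \<open>The compression of \<open>e * w\<close> to the nilpotent block. By the relation
    \<open>t * x + e * w = 1\<close> it differs from \<open>g\<close> only by
    \<open>t * (g * x * g)\<close>.\<close>
  define e1 where "e1 = g * e * w * g"
  have e1B: "e1 \<in> B" unfolding e1_def by (intro mult_B gB B)
  have ge1: "g * e1 = e1" and e1g: "e1 * g = e1"
    using gg by (metis e1_def mult.assoc)+
  have gtxg: "g - e1 = t * (g * x * g)"
  proof -
    have "g * (t * x + e * w) * g = g" using one gg by simp
    then have "g = g * t * x * g + e1" by (simp add: algebra_simps e1_def)
    then have "g - e1 = g * t * x * g" by (metis add_diff_cancel_right')
    also have "\<dots> = t * g * x * g" by (simp only: gt)
    finally show ?thesis by (simp only: mult.assoc)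
  qed
  obtain m a1 where a1: "a1 \<in> B" "e1 * a1 = a1 * e1" "a1 * e1 * a1 = a1" "e1 ^ m * (1 - e1 * a1) = 0"
    using drazin_inverse[OF e1B] .
  define h where "h = e1 * a1"
  have hB: "h \<in> B" unfolding h_def by (intro mult_B e1B a1)
  have hh: "h * h = h" unfolding h_def using a1 by (metis mult.assoc)
  have gh: "g * h = h" unfolding h_def using ge1 by (simp add: mult.assoc[symmetric])
  have hg: "h * g = h" unfolding h_def a1(2) using e1g by (simp add: mult.assoc)
  have hf: "h * f = 0" using hg gf by (metis mult.assoc mult_zero_right)
  have h0: "h \<noteq> 0"
  proof
    assume "h = 0"
    then have e1m: "e1 ^ m = 0" using a1(4) by (simp add: h_def)
    \<comment> \<open>Take the last power \<open>t ^ l'\<close> with \<open>t ^ l' * g\<close>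
      nonzero. It annihilates \<open>g - e1 = t * (g * x * g)\<close>, so right multiplication by
      \<open>e1\<close> fixes \<open>t ^ l' * g\<close>. A nilpotent \<open>e1\<close> would then
      make this element zero.\<close>
    define l where "l = (LEAST l. t ^ l * g = 0)"
    have l: "t ^ l * g = 0" unfolding l_def using tng by (rule LeastI)
    have "l \<noteq> 0" using l g0 by (intro notI) simp
    then obtain l' where l': "l = Suc l'" by (cases l) auto
    have "t ^ l' * g \<noteq> 0" using not_less_Least[of l' "\<lambda>l. t ^ l * g = 0"] l' l_def by auto
    moreover have "t ^ l' * g = t ^ l' * e1"
    proof -
      have "t ^ l' * (g - e1) = t ^ Suc l' * (g * x * g)"
        unfolding gtxg by (simp only: power_Suc2 mult.assoc)
      also have "\<dots> = 0" using l l' by (simp add: mult.assoc[symmetric])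
      finally show ?thesis by (simp add: right_diff_distrib)
    qed
    then have "t ^ l' * g = t ^ l' * g * e1 ^ k" for k
    proof (induction k)
      case (Suc k)
      have "t ^ l' * g = t ^ l' * e1 * e1 ^ k" using Suc by simp
      then show ?case using ge1 by (metis mult.assoc power_Suc)
    qed simp
    from this[of m] have "t ^ l' * g = 0" using e1m by simp
    ultimately show False by blast
  qed
  \<comment> \<open>The factors are arranged to give \<open>g * (e * y) = h * (1 - t) * g\<close>.
    Then \<open>h * t' = h\<close>, which is the new invertible block, while
    \<open>y * f = 0\<close> leaves the old one untouched.\<close>
  define y where "y = w * g * a1 * h * (1 - t) * g"
  define t' where "t' = t + e * y"
  have yB: "y \<in> B" unfolding y_def using B gB a1(1) hB by (intro B_closed)
  have t'B: "t' \<in> B" unfolding t'_def using B yB by (intro B_closed)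
  have t'f: "t' * f = t * f" unfolding t'_def y_def using gf by (simp add: algebra_simps mult.assoc)
  have gey: "g * (e * y) = h * (1 - t) * g"
  proof -
    have "g * (e * y) = (g * e * w * g) * a1 * h * (1 - t) * g" by (simp add: y_def mult.assoc)
    also have "\<dots> = h * h * (1 - t) * g" unfolding e1_def[symmetric] h_def[symmetric] by (simp add: mult.assoc)
    finally show ?thesis using hh by simp
  qed
  have ht': "h * t' = h"
  proof -
    have "h * (e * y) = h * g * (e * y)" using hg by simp
    also have "\<dots> = h * (h * (1 - t) * g)" using gey by (simp add: mult.assoc)
    also have "\<dots> = h * (1 - t) * g" using hh by (simp add: mult.assoc[symmetric])
    also have "\<dots> = h * g - h * (t * g)" by (simp add: algebra_simps)
    also have "\<dots> = h - h * t" using hg gt by (simp add: mult.assoc[symmetric]) (metis hg mult.assoc gt)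
    finally show ?thesis by (simp add: t'_def distrib_left)
  qed
  then have ht'n: "h * t' ^ k = h" for k by (induction k) (auto simp: mult.assoc[symmetric])
  obtain n' a' where a': "a' \<in> B" "t' * a' = a' * t'" "a' * t' * a' = a'" "t' ^ n' * (1 - t' * a') = 0"
    using drazin_inverse[OF t'B] .
  define f' where "f' = t' * a'"
  have f'B: "f' \<in> B" unfolding f'_def by (intro mult_B t'B a')
  \<comment> \<open>\<open>h\<close> absorbs every power of \<open>t'\<close>, in particular the one
    that annihilates \<open>1 - f'\<close>.\<close>
  have hf': "h * f' = h"
  proof -
    have "h * t' ^ n' * (1 - f') = 0" using a'(4) by (simp add: f'_def mult.assoc)
    then show ?thesis using ht'n by (simp add: right_diff_distrib)
  qed
  have tf: "t' ^ k * f = t ^ k * f" for k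
  proof (induction k)
    case (Suc k)
    have "t' ^ Suc k * f = t' * (t ^ k * f)" using Suc by (simp add: mult.assoc)
    also have "t ^ k * f = f * t ^ k" using power_commuting_commutes[of t f k] ft by metis
    also have "t' * (f * t ^ k) = t * (f * t ^ k)" using t'f by (simp add: mult.assoc[symmetric])
    also have "f * t ^ k = t ^ k * f" using power_commuting_commutes[of t f k] ft by metis
    finally show ?case by (simp add: mult.assoc)
  qed simp
  have fpow: "f = t ^ k * f * a ^ k" for k
  proof (induction k)
    case (Suc k)
    have "f = f * f" using ff by simp
    also have "\<dots> = t ^ k * f * a ^ k * f" using Suc by simp
    also have "a ^ k * f = f * a ^ k"
      using power_commuting_commutes[of a f k] D by (metis f_def mult.assoc)
    then have "t ^ k * f * a ^ k * f = t ^ k * f * (t * a) * a ^ k" by (metis mult.assoc ff f_def)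
    also have "\<dots> = t ^ k * t * f * (a * a ^ k)" using ft by (metis mult.assoc)
    finally show ?case by (simp add: power_commutes)
  qed simp
  \<comment> \<open>\<open>t\<close> and \<open>t'\<close> agree on the old invertible block, so
    \<open>f\<close> lies in the range of \<open>t' ^ n'\<close>, and there \<open>f'\<close> acts
    as the identity.\<close>
  have f'f: "f' * f = f"
  proof -
    have c: "f' * t' ^ n' = t' ^ n' * f'"
      using power_commuting_commutes[of t' f' n'] a'(2) by (metis f'_def mult.assoc)
    have "f' * f = f' * (t' ^ n' * f * a ^ n')" using fpow tf by metis
    also have "\<dots> = (t' ^ n' * f') * f * a ^ n'" using c by (simp add: mult.assoc[symmetric])
    also have "t' ^ n' * f' = t' ^ n'" using a'(4) by (simp add: f'_def right_diff_distrib)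
    finally show ?thesis using fpow tf by metis
  qed
  have sub: "(*) f ` B \<subseteq> (*) f' ` B"
  proof
    fix z assume "z \<in> (*) f ` B"
    then obtain b where "b \<in> B" "z = f * b" by blast
    then have "z = f' * (f * b)" using f'f by (simp add: mult.assoc[symmetric])
    then show "z \<in> (*) f' ` B" using \<open>b \<in> B\<close> fB mult_B by blast
  qed
  \<comment> \<open>If the two right ideals were equal, \<open>f'\<close> would have the form
    \<open>f * b\<close>; but \<open>h\<close> annihilates \<open>f\<close> and absorbs
    \<open>f'\<close>.\<close>
  moreover have "(*) f ` B \<noteq> (*) f' ` B"
  proof
    assume "(*) f ` B = (*) f' ` B"
    then obtain b where b: "f' * 1 = f * b" using one_B by (metis (no_types, lifting) imageE imageI)
    have "h = h * (f * b)" using hf' b by simp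
    also have "\<dots> = 0" using hf by (simp add: mult.assoc[symmetric])
    finally show False using h0 by simp
  qed
  ultimately show ?thesis
    using that[of y t' a' n'] yB a' by (auto simp: t'_def f'_def f_def)
qed

text \<open>Among the elements \<open>d + e * y\<close> with \<open>e = 1 - d * d'\<close>, choose
  one whose Drazin idempotent generates a right ideal of the largest dimension. If it were not
  invertible, the preceding lemma would enlarge this ideal.\<close>

theorem stable_range_one:
  assumes d: "d \<in> B" and d': "d' \<in> B"
  obtains y u where "y \<in> B" "u \<in> B" "(d + (1 - d * d') * y) * u = 1" "u * (d + (1 - d * d') * y) = 1"
proof -
  define e where "e = 1 - d * d'"
  have eB: "e \<in> B" unfolding e_def by (intro B_closed d d')
  define good where "good y a n \<longleftrightarrow> y \<in> B \<and> a \<in> B \<and> (d + e * y) * a = a * (d + e * y) \<and>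
    a * (d + e * y) * a = a \<and> (d + e * y) ^ n * (1 - (d + e * y) * a) = 0" for y a n
  define P where "P k \<longleftrightarrow> (\<exists>y a n. good y a n \<and> k = dim ((*) ((d + e * y) * a) ` B))" for k
  have "\<exists>a n. good 0 a n"
    using drazin_inverse[OF d] subspace_0[OF subspace_B] unfolding good_def by (metis add.right_neutral mult_zero_right)
  then obtain k0 where "P k0" unfolding P_def by blast
  moreover have bound: "\<forall>k. P k \<longrightarrow> k \<le> card S"
  proof (intro allI impI)
    fix k assume "P k"
    then obtain y a n where *: "good y a n" "k = dim ((*) ((d + e * y) * a) ` B)"
      unfolding P_def by blast
    then show "k \<le> card S"
      using d eB unfolding good_def by (auto intro!: dim_bound mult_B add_B)
  qed
  ultimately obtain k where k: "P k" "\<And>k'. P k' \<Longrightarrow> k' \<le> k"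
    using ex_has_greatest_nat[of P k0 "\<lambda>x. x"] by (metis Nat.le_trans le_refl Greatest_le_nat GreatestI_nat)
  then obtain y a n where g: "good y a n" and kd: "k = dim ((*) ((d + e * y) * a) ` B)"
    unfolding P_def by blast
  define t where "t = d + e * y"
  have B: "y \<in> B" "a \<in> B" "t \<in> B" using g d eB by (auto simp: good_def t_def intro: B_closed)
  have "t * a = 1"
  proof (rule ccontr)
    assume ne: "t * a \<noteq> 1"
    \<comment> \<open>The relation \<open>d * d' + e = 1\<close> survives the passage from
      \<open>d\<close> to \<open>t\<close>: what \<open>e * y * d'\<close> adds to the first term is
      taken off the cofactor of \<open>e\<close>.\<close>
    have one: "t * d' + e * (1 - y * d') = 1"
      by (simp add: t_def e_def algebra_simps)
    obtain y' t' a' n' where *: "y' \<in> B" "t' = t + e * y'" "a' \<in> B" "t' * a' = a' * t'"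
      "a' * t' * a' = a'" "t' ^ n' * (1 - t' * a') = 0" "(*) (t * a) ` B \<subset> (*) (t' * a') ` B"
      by (rule enlarge_drazin_idempotent[of t a d' e "1 - y * d'" n])
        (use g ne one B d' eB in \<open>auto simp: good_def t_def[symmetric] intro: B_closed\<close>)
    have t'_eq: "t' = d + e * (y + y')" by (simp add: * t_def algebra_simps)
    have "good (y + y') a' n'"
      unfolding good_def t'_eq[symmetric] using * B by (auto intro: add_B)
    then have "P (dim ((*) (t' * a') ` B))" unfolding P_def t'_eq by blast
    moreover have "t' \<in> B" using * B eB by (auto intro: B_closed)
    then have "dim ((*) (t * a) ` B) < dim ((*) (t' * a') ` B)"
      using * B by (intro dim_strict_mono subspace_mult_image) (auto intro: mult_B)
    ultimately show False using k(2) kd by (fastforce simp: t_def)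
  qed
  moreover have "a * t = 1" using calculation g by (simp add: good_def t_def)
  ultimately show ?thesis using that[of y a] B by (simp add: t_def e_def)
qed

text \<open>Adding the complement \<open>c = 1 - e\<close> to \<open>d\<close> and \<open>d'\<close>
  turns the problem in the corner \<open>e B e\<close> into one in \<open>B\<close> with the same
  defect \<open>e - d * d'\<close>. The solution \<open>t\<close> satisfies
  \<open>c * t = c\<close>, so it is block triangular, and compressing its inverse inverts its
  compression.\<close>

corollary stable_range_one_corner:
  assumes B: "e \<in> B" "d \<in> B" "d' \<in> B"
    and e: "e * e = e" "e * d = d" "d * e = d" "e * d' = d'" "d' * e = d'"
  obtains y u where "y \<in> B" "u \<in> B" "(d + (e - d * d') * (e * y * e)) * (e * u * e) = e"
    "(e * u * e) * (d + (e - d * d') * (e * y * e)) = e"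
proof -
  define c where "c = 1 - e"
  have c: "c * e = 0" "e * c = 0" "c * c = c" "c * d = 0" "d * c = 0" "c * d' = 0" "d' * c = 0"
    using e by (auto simp: c_def algebra_simps)
  have "c \<in> B" unfolding c_def by (intro B_closed B)
  then have "d + c \<in> B" "d' + c \<in> B" using B by (auto intro: B_closed)
  then obtain y u where yu: "y \<in> B" "u \<in> B" "(d + c + (1 - (d + c) * (d' + c)) * y) * u = 1"
    "u * (d + c + (1 - (d + c) * (d' + c)) * y) = 1"
    using stable_range_one by blast
  define t where "t = d + c + (1 - (d + c) * (d' + c)) * y"
  have tu: "t * u = 1" "u * t = 1" using yu by (simp_all add: t_def)
  have dd: "1 - (d + c) * (d' + c) = e - d * d'"
    using c by (simp add: algebra_simps) (simp add: c_def)
  have ct: "c * t = c"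
    unfolding t_def dd using c by (simp add: algebra_simps) (metis c(4) mult.assoc mult_zero_left)
  have cu: "c * u = c" using ct tu by (metis mult.assoc mult.right_neutral)
  have ete: "e * t * e = d + (e - d * d') * (e * y * e)"
  proof -
    have "e * t = d + (e - d * d') * y"
      unfolding t_def dd using c e by (simp add: distrib_left mult.assoc[symmetric] right_diff_distrib)
    then have "e * t * e = d + (e - d * d') * y * e" using e by (simp add: distrib_right)
    moreover have "(e - d * d') * e = e - d * d'" using e by (simp add: left_diff_distrib mult.assoc)
    ultimately show ?thesis by (metis mult.assoc)
  qed
  have "t * e * u * e = e"
  proof -
    have "t * e * u * e = t * u * e - t * (c * u) * e" by (simp add: c_def algebra_simps)
    also have "\<dots> = e" using tu cu c by (simp add: mult.assoc)
    finally show ?thesis .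
  qed
  moreover have "u * e * t * e = e"
  proof -
    have "u * e * t * e = u * t * e - u * (c * t) * e" by (simp add: c_def algebra_simps)
    also have "\<dots> = e" using tu ct c by (simp add: mult.assoc)
    finally show ?thesis .
  qed
  ultimately have "e * t * e * (e * u * e) = e" "(e * u * e) * (e * t * e) = e"
    using e(1) by (metis mult.assoc)+
  then show ?thesis using that[of y u] yu ete by simp
qed

end

section \<open>The polycyclic monoid and its algebra\<close>

text \<open>
  \<open>PPair p q\<close> is the partial bijection \<open>q @ x \<mapsto> p @ x\<close> of lists, and the monoid operation is
  composition of partial functions.
\<close>

datatype 'l polycyclic = PZero | PPair "'l list" "'l list"

fun pact :: "'l polycyclic \<Rightarrow> 'l list \<Rightarrow> 'l list option" where
  "pact PZero x = None"
| "pact (PPair p q) x = (if prefix q x then Some (p @ drop (length q) x) else None)"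

text \<open>Composition is written as addition because the convolution product of polynomial
  mappings adds exponents. The neutral element \<open>0\<close> is the identity function, whereas
  \<open>PZero\<close> is the empty one and absorbs everything.\<close>

instantiation polycyclic :: (type) monoid_add
begin

definition zero_polycyclic_def: "0 = PPair [] []"

fun plus_polycyclic :: "'a polycyclic \<Rightarrow> 'a polycyclic \<Rightarrow> 'a polycyclic" where
  "plus_polycyclic (PPair p q) (PPair r s) =
     (if prefix q r then PPair (p @ drop (length q) r) s
      else if prefix r q then PPair p (s @ drop (length r) q) else PZero)"
| "plus_polycyclic _ _ = PZero"

text \<open>Associativity is inherited from composition of partial functions, in place of a
  comparison of prefixes among three pairs.\<close>

lemma pact_plus: "pact (a + b) x = Option.bind (pact b x) (pact a)"
proof (cases "\<exists>p q r s. a = PPair p q \<and> b = PPair r s")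
  case True
  then obtain p q r s where ab: "a = PPair p q" "b = PPair r s" by blast
  show ?thesis
  proof (cases "prefix s x")
    case True
    then obtain y where x: "x = s @ y" by (auto simp: prefix_def)
    have cmp: "prefix q r \<or> prefix r q" if "prefix q (r @ y)"
      using that by (metis prefix_same_cases prefixI)
    show ?thesis
      using cmp by (auto simp: ab x prefix_def split: if_splits)
  next
    case False
    then show ?thesis by (auto simp: ab prefix_def)
  qed
next
  case False
  then show ?thesis by (cases a; cases b) auto
qed

text \<open>The shortest list on which \<open>PPair p q\<close> is defined is \<open>q\<close>, and
  its value there is \<open>p\<close>; so the function determines both lists.\<close>

lemma pact_inject: "pact a = pact b \<Longrightarrow> a = b"
proof (cases a; cases b)
  fix p q r s assume ab: "pact a = pact b" "a = PPair p q" "b = PPair r s"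
  have *: "pact a q = Some p" "pact b s = Some r" using ab(2,3) by auto
  then have "pact b q \<noteq> None" "pact a s \<noteq> None" using ab(1) by auto
  then have "prefix s q" "prefix q s" using ab(2,3) by (auto split: if_splits)
  then have "s = q" by (simp add: prefix_order.eq_iff)
  then show "a = b" using * ab by (metis option.inject)
next
  fix p q assume ab: "pact a = pact b" "a = PPair p q" "b = PZero"
  then have "pact b q = Some p" by (metis append_Nil2 pact.simps(2) prefix_order.refl drop_all le_refl)
  with ab(2,3) show "a = b" by simp
next
  fix p q assume ab: "pact a = pact b" "b = PPair p q" "a = PZero"
  then have "pact a q = Some p" by (metis append_Nil2 pact.simps(2) prefix_order.refl drop_all le_refl)
  with ab(2,3) show "a = b" by simp
qed auto

instance
proof
  fix a b c :: "'a polycyclic"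
  show "a + b + c = a + (b + c)"
    by (rule pact_inject) (auto simp: pact_plus fun_eq_iff split: bind_splits)
  show "0 + a = a" "a + 0 = a"
    by (cases a; simp add: zero_polycyclic_def)+
qed

end

lemma PZero_plus [simp]: "PZero + x = PZero" "x + PZero = PZero"
  by (cases x; simp)+

section \<open>Monoid algebras: linear extension, with scalars as
  \<open>Poly_Mapping.single 0 c\<close>\<close>

definition lin :: "('m \<Rightarrow> ('n::monoid_add \<Rightarrow>\<^sub>0 'k::comm_ring_1)) \<Rightarrow> ('m \<Rightarrow>\<^sub>0 'k) \<Rightarrow> ('n \<Rightarrow>\<^sub>0 'k)" where
  "lin h b = (\<Sum>x\<in>Poly_Mapping.keys b. Poly_Mapping.single 0 (Poly_Mapping.lookup b x) * h x)"

lemma lin_superset: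
  assumes "finite Q" "Poly_Mapping.keys b \<subseteq> Q"
  shows "lin h b = (\<Sum>x\<in>Q. Poly_Mapping.single 0 (Poly_Mapping.lookup b x) * h x)"
  unfolding lin_def using assms by (intro sum.mono_neutral_left) (auto simp: in_keys_iff)

lemma lin_zero [simp]: "lin h 0 = 0"
  by (simp add: lin_def)

lemma lin_add: "lin h (a + b) = lin h a + lin h b"
proof -
  let ?Q = "Poly_Mapping.keys a \<union> Poly_Mapping.keys b"
  have "Poly_Mapping.keys (a + b) \<subseteq> ?Q" by (rule Poly_Mapping.keys_add)
  then show ?thesis
    by (simp add: lin_superset[of ?Q] lookup_add single_add distrib_right sum.distrib)
qed

lemma lin_uminus: "lin h (- a) = - lin h a"
  using lin_add[of h a "- a"] by (simp add: eq_neg_iff_add_eq_0 add.commute)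

lemma lin_diff: "lin h (a - b) = lin h a - lin h b"
  using lin_add[of h a "- b"] by (simp add: lin_uminus)

lemma lin_sum: "lin h (\<Sum>i\<in>S. f i) = (\<Sum>i\<in>S. lin h (f i))"
  by (induction S rule: infinite_finite_induct) (auto simp: lin_add)

lemma lin_single: "lin h (Poly_Mapping.single x c) = Poly_Mapping.single 0 c * h x"
  using lin_superset[of "{x}" "Poly_Mapping.single x c" h] by (cases "c = 0") simp_all

lemma poly_mapping_sum_single:
  "b = (\<Sum>x\<in>Poly_Mapping.keys b. Poly_Mapping.single x (Poly_Mapping.lookup b x))"
proof (rule poly_mapping_eqI)
  fix z
  show "Poly_Mapping.lookup b z =
    Poly_Mapping.lookup (\<Sum>x\<in>Poly_Mapping.keys b. Poly_Mapping.single x (Poly_Mapping.lookup b x)) z"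
    by (cases "z \<in> Poly_Mapping.keys b") (auto simp: lookup_sum lookup_single when_def in_keys_iff)
qed

lemma lin_scale: "lin h (Poly_Mapping.single 0 c * d) = Poly_Mapping.single 0 c * lin h d"
proof -
  have "Poly_Mapping.single 0 c * d =
      (\<Sum>x\<in>Poly_Mapping.keys d. Poly_Mapping.single x (c * Poly_Mapping.lookup d x))"
    by (subst (1) poly_mapping_sum_single[of d]) (simp add: sum_distrib_left mult_single)
  then have "lin h (Poly_Mapping.single 0 c * d) =
      (\<Sum>x\<in>Poly_Mapping.keys d. Poly_Mapping.single 0 (c * Poly_Mapping.lookup d x) * h x)"
    by (simp only: lin_sum lin_single)
  also have "\<dots> = Poly_Mapping.single 0 c * lin h d"
    by (simp add: lin_def sum_distrib_left mult.assoc[symmetric] mult_single)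
  finally show ?thesis .
qed

lemma poly_mapping_mult_sum:
  fixes a b :: "'m::monoid_add \<Rightarrow>\<^sub>0 'k::comm_ring_1"
  shows "a * b = (\<Sum>x\<in>Poly_Mapping.keys a. \<Sum>y\<in>Poly_Mapping.keys b.
    Poly_Mapping.single (x + y) (Poly_Mapping.lookup a x * Poly_Mapping.lookup b y))"
  by (subst (1) poly_mapping_sum_single[of a], subst (1) poly_mapping_sum_single[of b])
    (simp add: sum_product mult_single)

lemma single_0_central:
  fixes a :: "'m::monoid_add \<Rightarrow>\<^sub>0 'k::comm_ring_1"
  shows "a * Poly_Mapping.single 0 c = Poly_Mapping.single 0 c * a"
  by (subst (1 2) poly_mapping_sum_single[of a])
    (simp add: sum_distrib_left sum_distrib_right mult_single mult.commute)

lemma keys_mult_closed: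
  fixes a b :: "'m::monoid_add \<Rightarrow>\<^sub>0 'k::comm_ring_1"
  assumes "Poly_Mapping.keys a \<subseteq> Q" "Poly_Mapping.keys b \<subseteq> Y" "\<And>x y. \<lbrakk>x \<in> Q; y \<in> Y\<rbrakk> \<Longrightarrow> x + y \<in> Z"
  shows "Poly_Mapping.keys (a * b) \<subseteq> Z"
  using keys_mult[of a b] assms by blast

lemma vector_space_poly_mapping:
  "vector_space (\<lambda>c a. Poly_Mapping.single 0 c * (a :: 'm::monoid_add \<Rightarrow>\<^sub>0 'k::field))"
  by unfold_locales
    (auto simp: distrib_left distrib_right single_add mult.assoc[symmetric] mult_single)

lemma keys_sum_subset:
  "(\<And>x. x \<in> S \<Longrightarrow> Poly_Mapping.keys (f x) \<subseteq> Q) \<Longrightarrow> Poly_Mapping.keys (\<Sum>x\<in>S. f x) \<subseteq> Q"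
  by (induction S rule: infinite_finite_induct) (auto dest: subsetD[OF Poly_Mapping.keys_add])

lemma keys_minus_subset:
  fixes a b :: "'m \<Rightarrow>\<^sub>0 'k::ab_group_add"
  shows "\<lbrakk>Poly_Mapping.keys a \<subseteq> Q; Poly_Mapping.keys b \<subseteq> Q\<rbrakk> \<Longrightarrow> Poly_Mapping.keys (a - b) \<subseteq> Q"
  using Poly_Mapping.keys_diff[of a b] by (meson Un_least subset_trans)

text \<open>Here combinatorics becomes linear algebra: closure of \<open>Q\<close> under the monoid
  operation makes the vectors supported in \<open>Q\<close> a subalgebra, and finiteness of
  \<open>Q\<close> bounds its dimension.\<close>

lemma findim_subalgebra_keys:
  fixes Q :: "'m::monoid_add set"
  assumes Q: "finite Q" "0 \<in> Q" "\<And>x y. \<lbrakk>x \<in> Q; y \<in> Q\<rbrakk> \<Longrightarrow> x + y \<in> Q"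
  shows "findim_subalgebra (\<lambda>c a. Poly_Mapping.single 0 c * (a :: 'm \<Rightarrow>\<^sub>0 'k::field))
    {b. Poly_Mapping.keys b \<subseteq> Q} ((\<lambda>x. Poly_Mapping.single x 1) ` Q)"
proof -
  interpret V: vector_space "\<lambda>c a. Poly_Mapping.single 0 c * (a :: 'm \<Rightarrow>\<^sub>0 'k)"
    by (rule vector_space_poly_mapping)
  let ?B = "{b :: 'm \<Rightarrow>\<^sub>0 'k. Poly_Mapping.keys b \<subseteq> Q}"
  show ?thesis
  proof unfold_locales
    fix x y :: "'m \<Rightarrow>\<^sub>0 'k" and k
    show "x * (Poly_Mapping.single 0 k * y) = Poly_Mapping.single 0 k * (x * y)"
      by (simp add: mult.assoc[symmetric] single_0_central)
    show "Poly_Mapping.single 0 k * x * y = Poly_Mapping.single 0 k * (x * y)"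
      by (simp add: mult.assoc)
    show "x * y \<in> ?B" if "x \<in> ?B" "y \<in> ?B"
      using that Q(3) keys_mult[of x y] by blast
    show "V.subspace ?B"
    proof (rule V.subspaceI)
      fix c and x :: "'m \<Rightarrow>\<^sub>0 'k" assume "x \<in> ?B"
      then show "Poly_Mapping.single 0 c * x \<in> ?B"
        using keys_mult[of "Poly_Mapping.single 0 c" x] by (auto split: if_splits dest!: subsetD)
    qed (auto dest: subsetD[OF Poly_Mapping.keys_add])
    show "1 \<in> ?B" using Q(2) by simp
    show "finite ((\<lambda>x. Poly_Mapping.single x (1::'k)) ` Q)" using Q(1) by simp
    show "?B \<subseteq> V.span ((\<lambda>x. Poly_Mapping.single x 1) ` Q)"
    proof
      fix b assume b: "b \<in> ?B"
      have "(\<Sum>x\<in>Poly_Mapping.keys b. Poly_Mapping.single 0 (Poly_Mapping.lookup b x) * Poly_Mapping.single x 1)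
        \<in> V.span ((\<lambda>x. Poly_Mapping.single x 1) ` Q)"
        using b by (intro V.span_sum V.span_scale V.span_base) auto
      then show "b \<in> V.span ((\<lambda>x. Poly_Mapping.single x 1) ` Q)"
        using poly_mapping_sum_single[of b] by (simp add: mult_single)
    qed
  qed
qed

text \<open>
  The identity of the contracted algebra of a finite set of pairs is \<open>\<Sum>u\<in>U. u\<close>; as \<open>PZero\<close> is a
  basis vector here and not zero, the multiple of \<open>PZero\<close> makes this an identity on \<open>PZero\<close> as well.
\<close>

definition orth_sum :: "'l polycyclic set \<Rightarrow> ('l polycyclic \<Rightarrow>\<^sub>0 'k::field)" where
  "orth_sum U = (\<Sum>u\<in>U. Poly_Mapping.single u 1) - Poly_Mapping.single PZero (of_nat (card U) - 1)"

text \<open>\<open>U\<close> plays the role of the diagonal matrix units: every element other than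
  \<open>PZero\<close> is fixed by exactly one of them on each side and annihilated by the others.
  \<open>Q\<close> is a semigroup only, whose span has its own identity
  \<open>orth_sum U\<close>.\<close>

locale polycyclic_system =
  fixes Q U :: "'l polycyclic set"
  assumes finite_Q: "finite Q" and U_Q: "U \<subseteq> Q" and PZero_Q: "PZero \<in> Q"
    and closed_Q: "\<lbrakk>x \<in> Q; y \<in> Q\<rbrakk> \<Longrightarrow> x + y \<in> Q"
    and left_unit: "x \<in> Q \<Longrightarrow> x \<noteq> PZero \<Longrightarrow> \<exists>u\<in>U. u + x = x \<and> (\<forall>v\<in>U - {u}. v + x = PZero)"
    and right_unit: "x \<in> Q \<Longrightarrow> x \<noteq> PZero \<Longrightarrow> \<exists>u\<in>U. x + u = x \<and> (\<forall>v\<in>U - {u}. x + v = PZero)"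
begin

lemma finite_U: "finite U"
  using finite_Q U_Q finite_subset by blast

lemma orth_sum_keys: "Poly_Mapping.keys (orth_sum U :: 'l polycyclic \<Rightarrow>\<^sub>0 'k::field) \<subseteq> Q"
  unfolding orth_sum_def using U_Q PZero_Q by (intro keys_minus_subset keys_sum_subset) auto

lemma
  assumes "x \<in> Q"
  shows orth_sum_single: "orth_sum U * Poly_Mapping.single x (c::'k::field) = Poly_Mapping.single x c"
    and single_orth_sum: "Poly_Mapping.single x (c::'k::field) * orth_sum U = Poly_Mapping.single x c"
proof -
  let ?z = "\<lambda>n. Poly_Mapping.single PZero n :: 'l polycyclic \<Rightarrow>\<^sub>0 'k"
  have const: "(\<Sum>v\<in>W. ?z c) = ?z (of_nat (card W) * c)" for W :: "'l polycyclic set"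
    unfolding sum_constant single_of_nat[symmetric] mult_single by simp
  \<comment> \<open>One unit reproduces \<open>x\<close> and the other \<open>card U - 1\<close>
    units give \<open>PZero\<close>; the correction term of \<open>orth_sum\<close> removes exactly
    this surplus.\<close>
  have split: "(\<Sum>v\<in>U. Poly_Mapping.single (f v) c) =
      Poly_Mapping.single x c + ?z ((of_nat (card U) - 1) * c)"
    if u: "u \<in> U" "f u = x" "\<forall>v\<in>U - {u}. f v = PZero" for u f
  proof -
    have "(\<Sum>v\<in>U. Poly_Mapping.single (f v) c) =
        Poly_Mapping.single x c + (\<Sum>v\<in>U - {u}. ?z c)"
      using u finite_U by (subst sum.remove[of _ u]) (auto intro!: sum.cong)
    moreover have "(\<Sum>v\<in>U - {u}. ?z c) = ?z (of_nat (card (U - {u})) * c)"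
      by (rule const)
    moreover have "of_nat (card (U - {u})) = (of_nat (card U) - 1 :: 'k)"
      using card.remove[OF finite_U u(1)] by simp
    ultimately show ?thesis by simp
  qed
  have PZ: "(\<Sum>v\<in>U. ?z c) = ?z (of_nat (card U) * c)"
    by (rule const)
  have "\<exists>u\<in>U. u + x = x \<and> (\<forall>v\<in>U - {u}. v + x = PZero)" if "x \<noteq> PZero"
    using left_unit assms that by blast
  then show "orth_sum U * Poly_Mapping.single x c = Poly_Mapping.single x c"
    using split[of _ "\<lambda>v. v + x"]
    by (cases "x = PZero")
      (auto simp: orth_sum_def left_diff_distrib sum_distrib_right mult_single PZ single_diff[symmetric] left_diff_distrib simp del: sum_constant)
  have "\<exists>u\<in>U. x + u = x \<and> (\<forall>v\<in>U - {u}. x + v = PZero)" if "x \<noteq> PZero"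
    using right_unit assms that by blast
  then show "Poly_Mapping.single x c * orth_sum U = Poly_Mapping.single x c"
    using split[of _ "\<lambda>v. x + v"]
    by (cases "x = PZero")
      (auto simp: orth_sum_def right_diff_distrib sum_distrib_left mult_single PZ single_diff[symmetric]
        mult.commute left_diff_distrib simp del: sum_constant)
qed

lemma
  assumes "Poly_Mapping.keys b \<subseteq> Q"
  shows orth_sum_mult: "orth_sum U * b = (b :: 'l polycyclic \<Rightarrow>\<^sub>0 'k::field)"
    and mult_orth_sum: "b * orth_sum U = b"
proof -
  have "orth_sum U * b = (\<Sum>x\<in>Poly_Mapping.keys b. orth_sum U * Poly_Mapping.single x (Poly_Mapping.lookup b x))"
    by (subst (1) poly_mapping_sum_single) (simp add: sum_distrib_left)
  also have "\<dots> = b"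
    using assms by (subst (4) poly_mapping_sum_single) (auto intro!: sum.cong orth_sum_single)
  finally show "orth_sum U * b = b" .
  have "b * orth_sum U = (\<Sum>x\<in>Poly_Mapping.keys b. Poly_Mapping.single x (Poly_Mapping.lookup b x) * orth_sum U)"
    by (subst (1) poly_mapping_sum_single) (simp add: sum_distrib_right)
  also have "\<dots> = b"
    using assms by (subst (4) poly_mapping_sum_single) (auto intro!: sum.cong single_orth_sum)
  finally show "b * orth_sum U = b" .
qed

text \<open>With the neutral element adjoined, \<open>Q\<close> becomes a finite submonoid. Its span
  is a unital algebra of finite dimension in which \<open>orth_sum U\<close> is an idempotent, so
  the statement about corners applies.\<close>

theorem stable_range_one:
  fixes d d' :: "'l polycyclic \<Rightarrow>\<^sub>0 'k::field"
  assumes d: "Poly_Mapping.keys d \<subseteq> Q" and d': "Poly_Mapping.keys d' \<subseteq> Q"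
  obtains y u where "Poly_Mapping.keys y \<subseteq> Q" "Poly_Mapping.keys u \<subseteq> Q"
    "(d + (orth_sum U - d * d') * y) * u = orth_sum U"
    "u * (d + (orth_sum U - d * d') * y) = orth_sum U"
proof -
  let ?e = "orth_sum U :: 'l polycyclic \<Rightarrow>\<^sub>0 'k"
  have Q0: "x + y \<in> insert 0 Q" if "x \<in> insert 0 Q" "y \<in> insert 0 Q" for x y
    using that closed_Q by auto
  interpret F: findim_subalgebra "\<lambda>c a. Poly_Mapping.single 0 c * (a :: 'l polycyclic \<Rightarrow>\<^sub>0 'k)"
    "{b. Poly_Mapping.keys b \<subseteq> insert 0 Q}" "(\<lambda>x. Poly_Mapping.single x 1) ` insert 0 Q"
    by (rule findim_subalgebra_keys) (use finite_Q Q0 in auto)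
  obtain y u where yu: "Poly_Mapping.keys y \<subseteq> insert 0 Q" "Poly_Mapping.keys u \<subseteq> insert 0 Q"
    "(d + (?e - d * d') * (?e * y * ?e)) * (?e * u * ?e) = ?e"
    "(?e * u * ?e) * (d + (?e - d * d') * (?e * y * ?e)) = ?e"
    by (rule F.stable_range_one_corner[of ?e d d'])
      (use orth_sum_keys d d' orth_sum_mult[OF orth_sum_keys] in \<open>auto simp: orth_sum_mult mult_orth_sum\<close>)
  \<comment> \<open>\<open>Q\<close> absorbs products with elements of \<open>insert 0 Q\<close>, so
    compression by \<open>orth_sum U\<close> brings the support back into \<open>Q\<close>.\<close>
  have ideal: "Poly_Mapping.keys (?e * y * ?e) \<subseteq> Q" if "Poly_Mapping.keys y \<subseteq> insert 0 Q" for y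
  proof -
    have "Poly_Mapping.keys (?e * y) \<subseteq> Q"
      by (rule keys_mult_closed[OF orth_sum_keys that]) (auto intro: closed_Q)
    then show ?thesis by (rule keys_mult_closed[OF _ orth_sum_keys]) (auto intro: closed_Q)
  qed
  show ?thesis using that[of "?e * y * ?e" "?e * u * ?e"] ideal yu by blast
qed

end

section \<open>The Leavitt path algebra as a graded ring\<close>

abbreviation deg :: "('v, 'e) lpa_gen fmon \<Rightarrow> int" where
  "deg \<equiv> word_degree (\<lambda>_. 1)"

lemma deg_plus: "deg (x + y) = deg x + deg y"
  by (simp add: word_degree_def plus_fmon_def)

lemma plus_fmon_eq_0: "x + y = 0 \<longleftrightarrow> x = 0 \<and> y = (0 :: 'g fmon)"
  by (cases x; cases y) (auto simp: zero_fmon_def plus_fmon_def)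

section \<open>Homogeneous components in the free algebra\<close>

definition homog :: "int \<Rightarrow> ('v, 'e, 'k::field) lpa_free \<Rightarrow> bool" where
  "homog n p \<longleftrightarrow> (\<forall>u\<in>Poly_Mapping.keys p. deg u = n)"

definition proj :: "int \<Rightarrow> ('v, 'e, 'k::field) lpa_free \<Rightarrow> ('v, 'e, 'k) lpa_free" where
  "proj n p = (\<Sum>x | x \<in> Poly_Mapping.keys p \<and> deg x = n. Poly_Mapping.single x (Poly_Mapping.lookup p x))"

lemma lookup_proj: "Poly_Mapping.lookup (proj n p) x = (if deg x = n then Poly_Mapping.lookup p x else 0)"
proof -
  have fin: "finite {x. x \<in> Poly_Mapping.keys p \<and> deg x = n}" by simp
  show ?thesis
    by (cases "x \<in> Poly_Mapping.keys p")
      (auto simp: proj_def lookup_sum lookup_single when_def in_keys_iff sum.delta'[OF fin])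
qed

lemma keys_proj: "Poly_Mapping.keys (proj n p) = {x\<in>Poly_Mapping.keys p. deg x = n}"
  by (auto simp: in_keys_iff lookup_proj split: if_splits)

lemma homog_proj: "homog n (proj n p)"
  by (simp add: homog_def keys_proj)

lemma proj_add: "proj n (p + q) = proj n p + proj n q"
  by (rule poly_mapping_eqI) (simp add: lookup_proj lookup_add)

lemma proj_zero [simp]: "proj n 0 = 0"
  by (rule poly_mapping_eqI) (simp add: lookup_proj)

lemma proj_uminus: "proj n (- p) = - proj n p"
  by (rule poly_mapping_eqI) (simp add: lookup_proj)

lemma proj_diff: "proj n (p - q) = proj n p - proj n q"
  by (rule poly_mapping_eqI) (simp add: lookup_proj lookup_minus)

lemma proj_sum: "proj n (\<Sum>i\<in>S. f i) = (\<Sum>i\<in>S. proj n (f i))"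
  by (induction S rule: infinite_finite_induct) (auto simp: proj_add)

lemma proj_homog: "homog m p \<Longrightarrow> proj n p = (if n = m then p else 0)"
  by (rule poly_mapping_eqI) (auto simp: lookup_proj homog_def in_keys_iff)

lemma proj_eq_0: "n \<notin> deg ` Poly_Mapping.keys p \<Longrightarrow> proj n p = 0"
  by (rule poly_mapping_eqI) (auto simp: lookup_proj in_keys_iff)

lemma proj_single: "proj n (Poly_Mapping.single x c) = (if deg x = n then Poly_Mapping.single x c else 0)"
  by (rule poly_mapping_eqI) (auto simp: lookup_proj lookup_single when_def)

lemma proj_single_mult:
  "proj n (Poly_Mapping.single x c * p) = Poly_Mapping.single x c * proj (n - deg x) p"
proof -
  let ?f = "\<lambda>y. Poly_Mapping.single y (Poly_Mapping.lookup p y)"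
  have "proj n (Poly_Mapping.single x c * p) = (\<Sum>y\<in>Poly_Mapping.keys p. proj n (Poly_Mapping.single x c * ?f y))"
    by (subst (1) poly_mapping_sum_single[of p]) (simp only: sum_distrib_left proj_sum)
  also have "\<dots> = (\<Sum>y\<in>Poly_Mapping.keys p. Poly_Mapping.single x c * proj (n - deg x) (?f y))"
    by (intro sum.cong refl) (simp add: mult_single proj_single deg_plus eq_diff_eq add.commute)
  also have "\<dots> = Poly_Mapping.single x c * proj (n - deg x) p"
    by (simp only: sum_distrib_left[symmetric] proj_sum[symmetric] poly_mapping_sum_single[symmetric])
  finally show ?thesis .
qed

lemma proj_mult_single:
  "proj n (p * Poly_Mapping.single x c) = proj (n - deg x) p * Poly_Mapping.single x c"
proof -
  let ?f = "\<lambda>y. Poly_Mapping.single y (Poly_Mapping.lookup p y)"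
  have "proj n (p * Poly_Mapping.single x c) = (\<Sum>y\<in>Poly_Mapping.keys p. proj n (?f y * Poly_Mapping.single x c))"
    by (subst (1) poly_mapping_sum_single[of p]) (simp only: sum_distrib_right proj_sum)
  also have "\<dots> = (\<Sum>y\<in>Poly_Mapping.keys p. proj (n - deg x) (?f y) * Poly_Mapping.single x c)"
    by (intro sum.cong refl) (simp add: mult_single proj_single deg_plus eq_diff_eq)
  also have "\<dots> = proj (n - deg x) p * Poly_Mapping.single x c"
    by (simp only: sum_distrib_right[symmetric] proj_sum[symmetric] poly_mapping_sum_single[symmetric])
  finally show ?thesis .
qed

lemma sum_proj:
  assumes "finite S" "deg ` Poly_Mapping.keys p \<subseteq> S"
  shows "(\<Sum>n\<in>S. proj n p) = p"
proof (rule poly_mapping_eqI)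
  fix x
  show "Poly_Mapping.lookup (\<Sum>n\<in>S. proj n p) x = Poly_Mapping.lookup p x"
    using assms by (cases "x \<in> Poly_Mapping.keys p") (auto simp: lookup_sum lookup_proj in_keys_iff)
qed

lemma homog_add: "\<lbrakk>homog n p; homog n q\<rbrakk> \<Longrightarrow> homog n (p + q)"
  unfolding homog_def using Poly_Mapping.keys_add[of p q] by (meson UnE subsetD)

lemma homog_uminus: "homog n p \<Longrightarrow> homog n (- p)"
  by (simp add: homog_def in_keys_iff)

lemma homog_diff: "\<lbrakk>homog n p; homog n q\<rbrakk> \<Longrightarrow> homog n (p - q)"
  using homog_add[of n p "- q"] homog_uminus by auto

lemma homog_zero [simp]: "homog n 0"
  by (simp add: homog_def)

lemma homog_sum: "(\<And>i. i \<in> S \<Longrightarrow> homog n (f i)) \<Longrightarrow> homog n (\<Sum>i\<in>S. f i)"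
  by (induction S rule: infinite_finite_induct) (auto intro: homog_add)

lemma homog_mult: "\<lbrakk>homog m p; homog n q\<rbrakk> \<Longrightarrow> homog (m + n) (p * q)"
  unfolding homog_def using keys_mult[of p q] by (force simp: deg_plus)

lemma homog_gen: "homog (gen_degree (\<lambda>_. 1) x) (gen x)"
  by (simp add: homog_def gen_def word_degree_def)

lemma homog_Vertex: "homog 0 (gen (Vertex v))"
  and homog_Edge: "homog 1 (gen (Edge e))"
  and homog_Ghost: "homog (- 1) (gen (Ghost e))"
  using homog_gen[of "Vertex v"] homog_gen[of "Edge e"] homog_gen[of "Ghost e"] by simp_all

lemma homog_lpa_relators:
  fixes r :: "('v, 'e, 'k::field) lpa_free"
  assumes "r \<in> lpa_relators E"
  shows "\<exists>n. homog n r"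
proof -
  let ?V = "\<lambda>v. gen (Vertex v) :: ('v, 'e, 'k) lpa_free"
  let ?E = "\<lambda>e. gen (Edge e) :: ('v, 'e, 'k) lpa_free"
  let ?G = "\<lambda>e. gen (Ghost e) :: ('v, 'e, 'k) lpa_free"
  note V = homog_Vertex and E = homog_Edge and G = homog_Ghost
  note hom = homog_mult[OF V V, simplified] homog_mult[OF V E, simplified] homog_mult[OF E V, simplified]
    homog_mult[OF V G, simplified] homog_mult[OF G V, simplified] homog_mult[OF G E, simplified]
    homog_mult[OF E G, simplified] V E G
  have "homog 0 (?V u * ?V v - (if u = v then ?V v else 0))" for u v
    by (rule homog_diff) (auto intro: hom)
  moreover have "homog 1 (?V u * ?E e - ?E e)" "homog 1 (?E e * ?V u - ?E e)"
    "homog (- 1) (?V u * ?G e - ?G e)" "homog (- 1) (?G e * ?V u - ?G e)" for u e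
    by (rule homog_diff; rule hom)+
  moreover have "homog 0 (?G e * ?E f - (if e = f then ?V (head E e) else 0))" for e f
    by (rule homog_diff) (auto intro: hom)
  moreover have "homog 0 (?V v - (\<Sum>e \<in> out_arcs E v. ?E e * ?G e))" for v
    by (intro homog_diff homog_sum hom)
  ultimately show ?thesis
    using assms unfolding lpa_relators_def by (elim UnE CollectE exE conjE) (simp only:, blast)+
qed

section \<open>The defining ideal, congruence modulo it, and the quotient\<close>

locale lpa = wf_digraph E for E :: "('v, 'e) pre_digraph" +
  fixes K :: "'k::field itself"
begin

definition R :: "('v, 'e, 'k) lpa_free set" where "R = carrier (free_ring E)"

definition I :: "('v, 'e, 'k) lpa_free set" where "I = lpa_ideal E"

definition Aug :: "('v, 'e, 'k) lpa_free set" where "Aug = free_augmentation E"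

definition A :: "('v, 'e, 'k) lpa_free set gring" where
  "A = leavitt_path_algebra TYPE('k) E (\<lambda>_. 1)"

definition words :: "('v, 'e) lpa_gen fmon set" where
  "words = {w. set (letters w) \<subseteq> lpa_gens E}"

lemma R_iff: "p \<in> R \<longleftrightarrow> Poly_Mapping.keys p \<subseteq> words"
  by (auto simp: R_def free_ring_def words_def)

lemma words_plus: "\<lbrakk>x \<in> words; y \<in> words\<rbrakk> \<Longrightarrow> x + y \<in> words"
  by (auto simp: words_def plus_fmon_def)

lemma R_add: "\<lbrakk>p \<in> R; q \<in> R\<rbrakk> \<Longrightarrow> p + q \<in> R"
  unfolding R_iff using Poly_Mapping.keys_add[of p q] by (meson Un_least order_trans)

lemma R_uminus: "p \<in> R \<Longrightarrow> - p \<in> R"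
  unfolding R_iff by (simp add: in_keys_iff subset_iff)

lemma R_diff: "\<lbrakk>p \<in> R; q \<in> R\<rbrakk> \<Longrightarrow> p - q \<in> R"
  using R_add[of p "- q"] R_uminus by auto

lemma R_mult: "\<lbrakk>p \<in> R; q \<in> R\<rbrakk> \<Longrightarrow> p * q \<in> R"
  unfolding R_iff by (rule keys_mult_closed[OF _ _ words_plus])

lemma R_zero [simp]: "0 \<in> R" and R_one [simp]: "1 \<in> R"
  by (auto simp: R_iff words_def zero_fmon_def)

lemma R_sum: "(\<And>i. i \<in> S \<Longrightarrow> f i \<in> R) \<Longrightarrow> (\<Sum>i\<in>S. f i) \<in> R"
  by (induction S rule: infinite_finite_induct) (auto intro: R_add)

lemma R_single: "x \<in> words \<Longrightarrow> Poly_Mapping.single x c \<in> R"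
  by (auto simp: R_iff)

lemma R_scalar: "Poly_Mapping.single 0 c \<in> R"
  by (rule R_single) (simp add: words_def zero_fmon_def)

lemma R_gen: "x \<in> lpa_gens E \<Longrightarrow> gen x \<in> R"
  unfolding gen_def by (rule R_single) (simp add: words_def)

lemma R_V: "v \<in> verts E \<Longrightarrow> gen (Vertex v) \<in> R"
  and R_E: "e \<in> arcs E \<Longrightarrow> gen (Edge e) \<in> R"
  and R_G: "e \<in> arcs E \<Longrightarrow> gen (Ghost e) \<in> R"
  by (auto intro!: R_gen simp: lpa_gens_def)

lemma R_proj: "p \<in> R \<Longrightarrow> proj n p \<in> R"
  by (auto simp: R_iff keys_proj)

lemmas R_closed = R_add R_diff R_mult R_sum R_scalar R_V R_E R_G R_zero R_one R_uminus

lemma free_ring_simps [simp]: "carrier (free_ring E) = R" "monoid.mult (free_ring E) = (*)"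
  "add (free_ring E) = (+)" "ring.zero (free_ring E) = (0 :: ('v, 'e, 'k) lpa_free)"
  "one (free_ring E) = (1 :: ('v, 'e, 'k) lpa_free)"
  unfolding R_def by (simp_all add: free_ring_def)

lemma ring_free_ring: "ring (free_ring E :: ('v, 'e, 'k) lpa_free ring)"
proof (rule ringI)
  show "abelian_group (free_ring E :: ('v, 'e, 'k) lpa_free ring)"
    by (rule abelian_groupI) (auto simp: R_closed add.assoc add.commute intro!: bexI[of _ "- _"])
  show "monoid (free_ring E :: ('v, 'e, 'k) lpa_free ring)"
    by (rule monoidI) (auto simp: R_closed mult.assoc)
qed (auto simp: distrib_left distrib_right)

sublocale F: ring "free_ring E :: ('v, 'e, 'k) lpa_free ring"
  by (rule ring_free_ring)

lemma relators_R: "lpa_relators E \<subseteq> R"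
  unfolding lpa_relators_def regular_vertex_def by (auto intro!: R_closed simp: in_out_arcs_conv)

lemma ideal_I: "ideal I (free_ring E :: ('v, 'e, 'k) lpa_free ring)"
  unfolding I_def lpa_ideal_def by (rule F.genideal_ideal) (simp add: relators_R)

sublocale I: ideal I "free_ring E :: ('v, 'e, 'k) lpa_free ring"
  by (rule ideal_I)

lemma relators_I: "lpa_relators E \<subseteq> I"
  unfolding I_def lpa_ideal_def by (rule F.genideal_self) (simp add: relators_R)

lemma I_zero [simp]: "0 \<in> I" using I.zero_closed by simp

lemma I_add: "\<lbrakk>p \<in> I; q \<in> I\<rbrakk> \<Longrightarrow> p + q \<in> I" using I.a_closed by simp

lemma I_uminus: "p \<in> I \<Longrightarrow> - p \<in> I"
proof -
  assume p: "p \<in> I"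
  have "- 1 * p \<in> I" using I.I_l_closed[OF p, of "- 1"] by (simp add: R_uminus)
  then show ?thesis by simp
qed

lemma I_mult_left: "\<lbrakk>r \<in> R; p \<in> I\<rbrakk> \<Longrightarrow> r * p \<in> I"
  and I_mult_right: "\<lbrakk>p \<in> I; r \<in> R\<rbrakk> \<Longrightarrow> p * r \<in> I"
  using I.I_l_closed[of p r] I.I_r_closed[of p r] by simp_all

lemma I_sum: "(\<And>i. i \<in> S \<Longrightarrow> f i \<in> I) \<Longrightarrow> (\<Sum>i\<in>S. f i) \<in> I"
  by (induction S rule: infinite_finite_induct) (auto intro: I_add)

text \<open>The ideal is graded because its generators are homogeneous: the elements all of whose
  components lie in \<open>I\<close> form an ideal that contains the relators. Multiplication by a
  single word only shifts degrees, which gives closure under products.\<close>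

lemma proj_I: "p \<in> I \<Longrightarrow> proj n p \<in> I"
proof -
  let ?J = "{p \<in> R. \<forall>n. proj n p \<in> I}"
  have "ideal ?J (free_ring E :: ('v, 'e, 'k) lpa_free ring)"
  proof (rule idealI[OF ring_free_ring])
    show "subgroup ?J (add_monoid (free_ring E))"
    proof
      fix p assume "p \<in> ?J"
      then have "- p \<in> ?J" by (auto simp: proj_uminus intro: I_uminus R_uminus)
      moreover have "inv\<^bsub>add_monoid (free_ring E)\<^esub> p = - p"
        using \<open>p \<in> ?J\<close> F.minus_equality[of "- p" p] by (simp add: a_inv_def R_uminus)
      ultimately show "inv\<^bsub>add_monoid (free_ring E)\<^esub> p \<in> ?J" by simp
    qed (auto simp: proj_add R_add I_add)
  next
    fix p r :: "('v, 'e, 'k) lpa_free" assume "p \<in> ?J" "r \<in> carrier (free_ring E)"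
    then have p: "p \<in> R" "\<And>n. proj n p \<in> I" and r: "r \<in> R" by simp_all
    have single: "Poly_Mapping.single x (Poly_Mapping.lookup r x) \<in> R" if "x \<in> Poly_Mapping.keys r" for x
      using that r by (auto simp: R_iff)
    have "proj n (r * p) = (\<Sum>x\<in>Poly_Mapping.keys r.
        Poly_Mapping.single x (Poly_Mapping.lookup r x) * proj (n - deg x) p)" for n
      by (subst poly_mapping_sum_single[of r]) (simp only: sum_distrib_right proj_sum proj_single_mult)
    then have "proj n (r * p) \<in> I" for n using p single by (auto intro!: I_sum I_mult_left)
    then show "r \<otimes>\<^bsub>free_ring E\<^esub> p \<in> ?J" using p r by (simp add: R_mult)
    have "proj n (p * r) = (\<Sum>x\<in>Poly_Mapping.keys r.
        proj (n - deg x) p * Poly_Mapping.single x (Poly_Mapping.lookup r x))" for n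
      by (subst poly_mapping_sum_single[of r]) (simp only: sum_distrib_left proj_sum proj_mult_single)
    then have "proj n (p * r) \<in> I" for n using p single by (auto intro!: I_sum I_mult_right)
    then show "p \<otimes>\<^bsub>free_ring E\<^esub> r \<in> ?J" using p r by (simp add: R_mult)
  qed
  moreover have "lpa_relators E \<subseteq> ?J"
  proof
    fix r :: "('v, 'e, 'k) lpa_free" assume r: "r \<in> lpa_relators E"
    then obtain m where "homog m r" using homog_lpa_relators by blast
    then show "r \<in> ?J" using r relators_R relators_I by (auto simp: proj_homog)
  qed
  ultimately have "I \<subseteq> ?J" unfolding I_def lpa_ideal_def by (rule F.genideal_minimal)
  then show "p \<in> I \<Longrightarrow> proj n p \<in> I" by blast
qed

definition cong :: "('v, 'e, 'k) lpa_free \<Rightarrow> ('v, 'e, 'k) lpa_free \<Rightarrow> bool" (infix "\<asymp>" 50) where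
  "p \<asymp> q \<longleftrightarrow> p - q \<in> I"

lemma cong_refl [simp]: "p \<asymp> p" by (simp add: cong_def)

lemma cong_sym: "p \<asymp> q \<Longrightarrow> q \<asymp> p"
  unfolding cong_def using I_uminus[of "p - q"] by simp

lemma cong_trans [trans]: "p \<asymp> q \<Longrightarrow> q \<asymp> r \<Longrightarrow> p \<asymp> r"
  unfolding cong_def using I_add[of "p - q" "q - r"] by simp

lemma cong_add: "p \<asymp> p' \<Longrightarrow> q \<asymp> q' \<Longrightarrow> p + q \<asymp> p' + q'"
  unfolding cong_def using I_add[of "p - p'" "q - q'"] by (simp add: algebra_simps)

lemma cong_left: "p \<asymp> q \<Longrightarrow> r \<in> R \<Longrightarrow> r * p \<asymp> r * q"
  and cong_right: "p \<asymp> q \<Longrightarrow> r \<in> R \<Longrightarrow> p * r \<asymp> q * r"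
  unfolding cong_def using I_mult_left[of r "p - q"] I_mult_right[of "p - q" r]
  by (simp_all add: algebra_simps)

lemma cong_sum: "(\<And>i. i \<in> S \<Longrightarrow> f i \<asymp> g i) \<Longrightarrow> (\<Sum>i\<in>S. f i) \<asymp> (\<Sum>i\<in>S. g i)"
  by (induction S rule: infinite_finite_induct) (auto intro: cong_add)

lemma cong_proj: "p \<asymp> q \<Longrightarrow> proj n p \<asymp> proj n q"
  unfolding cong_def using proj_I[of "p - q" n] by (simp add: proj_diff)

definition cls :: "('v, 'e, 'k) lpa_free \<Rightarrow> ('v, 'e, 'k) lpa_free set" where
  "cls p = I +>\<^bsub>free_ring E\<^esub> p"

lemma cls_eq_iff: "cls p = cls q \<longleftrightarrow> p \<asymp> q"
proof -
  have cls: "cls p = (\<lambda>h. h + p) ` I" for p by (auto simp: cls_def a_r_coset_def')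
  show ?thesis
  proof
    assume "cls p = cls q"
    moreover have "p \<in> cls p" unfolding cls using I_zero by (metis add_0 imageI)
    ultimately show "p \<asymp> q" by (auto simp: cls cong_def)
  next
    assume pq: "p \<asymp> q"
    have "cls p \<subseteq> cls q" if "p \<asymp> q" for p q
    proof
      fix z assume "z \<in> cls p"
      then obtain h where "h \<in> I" "z = (h + (p - q)) + q" by (auto simp: cls)
      moreover have "h + (p - q) \<in> I" using that \<open>h \<in> I\<close> unfolding cong_def by (intro I_add)
      ultimately show "z \<in> cls q" unfolding cls by blast
    qed
    then show "cls p = cls q" using pq cong_sym by blast
  qed
qed

lemma Aug_iff: "p \<in> Aug \<longleftrightarrow> p \<in> R \<and> Poly_Mapping.lookup p 0 = 0"
  by (simp add: Aug_def free_augmentation_def)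

lemma Aug_R: "p \<in> Aug \<Longrightarrow> p \<in> R" by (simp add: Aug_iff)

lemma Aug_zero [simp]: "0 \<in> Aug" and Aug_add: "\<lbrakk>p \<in> Aug; q \<in> Aug\<rbrakk> \<Longrightarrow> p + q \<in> Aug"
  and Aug_uminus: "p \<in> Aug \<Longrightarrow> - p \<in> Aug"
  by (auto simp: Aug_iff R_add R_uminus lookup_add)

lemma Aug_sum: "(\<And>i. i \<in> S \<Longrightarrow> f i \<in> Aug) \<Longrightarrow> (\<Sum>i\<in>S. f i) \<in> Aug"
  by (induction S rule: infinite_finite_induct) (auto intro: Aug_add)

lemma Aug_proj: "p \<in> Aug \<Longrightarrow> proj n p \<in> Aug"
  by (simp add: Aug_iff R_proj lookup_proj)

lemma
  assumes "p \<in> R" "q \<in> R"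
  shows Aug_mult_left: "q \<in> Aug \<Longrightarrow> p * q \<in> Aug" and Aug_mult_right: "p \<in> Aug \<Longrightarrow> p * q \<in> Aug"
  using assms keys_mult[of p q] by (auto simp: Aug_iff R_mult in_keys_iff plus_fmon_eq_0 subset_iff)

lemma Aug_gen: "x \<in> lpa_gens E \<Longrightarrow> gen x \<in> Aug"
  using R_gen[of x] by (simp add: Aug_iff gen_def lookup_single zero_fmon_def)

lemma carrier_A: "carrier A = cls ` Aug"
  by (auto simp: A_def leavitt_path_algebra_def cls_def I_def Aug_def)

lemma zero_A: "\<zero>\<^bsub>A\<^esub> = cls 0"
proof -
  have "cls 0 = I" by (auto simp: cls_def a_r_coset_def')
  then show ?thesis by (simp add: A_def leavitt_path_algebra_def FactRing_def I_def)
qed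

lemma add_A: "\<lbrakk>p \<in> R; q \<in> R\<rbrakk> \<Longrightarrow> cls p \<oplus>\<^bsub>A\<^esub> cls q = cls (p + q)"
  using I.a_rcos_sum[of p q]
  by (simp add: A_def leavitt_path_algebra_def FactRing_def cls_def I_def)

lemma mult_A: "\<lbrakk>p \<in> R; q \<in> R\<rbrakk> \<Longrightarrow> cls p \<otimes>\<^bsub>A\<^esub> cls q = cls (p * q)"
  using I.rcoset_mult_add[of p q]
  by (simp add: A_def leavitt_path_algebra_def FactRing_def cls_def I_def)

lemma rgrade_A: "rgrade A n = cls ` {p \<in> Aug. homog n p}"
  by (auto simp: A_def leavitt_path_algebra_def cls_def I_def Aug_def homog_def)

definition rep :: "('v, 'e, 'k) lpa_free set \<Rightarrow> ('v, 'e, 'k) lpa_free" where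
  "rep a = (SOME p. p \<in> Aug \<and> cls p = a)"

lemma
  assumes "a \<in> carrier A"
  shows rep_Aug: "rep a \<in> Aug" and cls_rep: "cls (rep a) = a" and rep_R: "rep a \<in> R"
proof -
  have "\<exists>p. p \<in> Aug \<and> cls p = a" using assms by (auto simp: carrier_A)
  then have "rep a \<in> Aug \<and> cls (rep a) = a" unfolding rep_def by (rule someI_ex)
  then show "rep a \<in> Aug" "cls (rep a) = a" "rep a \<in> R" by (auto simp: Aug_R)
qed

lemma rep_cls: "p \<in> Aug \<Longrightarrow> rep (cls p) \<asymp> p"
  using cls_rep[of "cls p"] imageI[of p Aug cls] by (simp add: cls_eq_iff carrier_A)

lemma cls_Aug: "p \<in> Aug \<Longrightarrow> cls p \<in> carrier A"
  by (simp add: carrier_A)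

lemma abelian_group_A: "abelian_group A"
proof (rule abelian_groupI)
  fix x y z assume "x \<in> carrier A" "y \<in> carrier A" "z \<in> carrier A"
  then show "x \<oplus>\<^bsub>A\<^esub> y \<oplus>\<^bsub>A\<^esub> z = x \<oplus>\<^bsub>A\<^esub> (y \<oplus>\<^bsub>A\<^esub> z)"
    by (auto simp: carrier_A add_A Aug_R R_add add.assoc)
next
  fix x assume "x \<in> carrier A"
  then obtain p where p: "p \<in> Aug" "x = cls p" by (auto simp: carrier_A)
  then show "\<exists>y\<in>carrier A. y \<oplus>\<^bsub>A\<^esub> x = \<zero>\<^bsub>A\<^esub>"
    by (intro bexI[of _ "cls (- p)"]) (auto simp: add_A zero_A Aug_R R_uminus carrier_A Aug_uminus)
qed (auto simp: carrier_A add_A zero_A Aug_R Aug_add add.commute)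

sublocale A: abelian_group A
  by (rule abelian_group_A)

lemma finsum_A:
  "finite S \<Longrightarrow> (\<And>i. i \<in> S \<Longrightarrow> f i \<in> Aug) \<Longrightarrow> finsum A (\<lambda>i. cls (f i)) S = cls (\<Sum>i\<in>S. f i)"
proof (induction S rule: finite_induct)
  case empty
  show ?case by (simp add: zero_A)
next
  case (insert x S)
  then show ?case
    by (subst A.finsum_insert) (auto simp: add_A Aug_R Aug_sum R_sum cls_Aug)
qed

section \<open>The defining relations and local units\<close>

abbreviation V :: "'v \<Rightarrow> ('v, 'e, 'k) lpa_free" where "V v \<equiv> gen (Vertex v)"
abbreviation Ed :: "'e \<Rightarrow> ('v, 'e, 'k) lpa_free" where "Ed e \<equiv> gen (Edge e)"
abbreviation Gh :: "'e \<Rightarrow> ('v, 'e, 'k) lpa_free" where "Gh e \<equiv> gen (Ghost e)"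

lemma V_V: "\<lbrakk>u \<in> verts E; v \<in> verts E\<rbrakk> \<Longrightarrow> V u * V v \<asymp> (if u = v then V v else 0)"
  and V_Ed: "e \<in> arcs E \<Longrightarrow> V (tail E e) * Ed e \<asymp> Ed e"
  and Ed_V: "e \<in> arcs E \<Longrightarrow> Ed e * V (head E e) \<asymp> Ed e"
  and V_Gh: "e \<in> arcs E \<Longrightarrow> V (head E e) * Gh e \<asymp> Gh e"
  and Gh_V: "e \<in> arcs E \<Longrightarrow> Gh e * V (tail E e) \<asymp> Gh e"
  and Gh_Ed: "\<lbrakk>e \<in> arcs E; f \<in> arcs E\<rbrakk> \<Longrightarrow> Gh e * Ed f \<asymp> (if e = f then V (head E e) else 0)"
  unfolding cong_def by (rule subsetD[OF relators_I], unfold lpa_relators_def, blast)+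

lemma V_idem: "v \<in> verts E \<Longrightarrow> V v * V v \<asymp> V v"
  using V_V[of v v] by simp

fun source :: "('v, 'e) lpa_gen \<Rightarrow> 'v" where
  "source (Vertex v) = v"
| "source (Edge e) = tail E e"
| "source (Ghost e) = head E e"

fun target :: "('v, 'e) lpa_gen \<Rightarrow> 'v" where
  "target (Vertex v) = v"
| "target (Edge e) = head E e"
| "target (Ghost e) = tail E e"

lemma
  assumes "x \<in> lpa_gens E"
  shows source_verts: "source x \<in> verts E" and target_verts: "target x \<in> verts E"
    and V_source: "V (source x) * gen x \<asymp> gen x" and V_target: "gen x * V (target x) \<asymp> gen x"
  using assms by (auto simp: lpa_gens_def V_idem V_Ed Ed_V V_Gh Gh_V)

lemma V_gen: "\<lbrakk>x \<in> lpa_gens E; u \<in> verts E\<rbrakk> \<Longrightarrow> V u * gen x \<asymp> (if u = source x then gen x else 0)"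
proof -
  assume x: "x \<in> lpa_gens E" and u: "u \<in> verts E"
  have "V u * gen x \<asymp> V u * (V (source x) * gen x)"
    by (rule cong_left[OF cong_sym[OF V_source[OF x]] R_V[OF u]])
  also have "\<dots> = V u * V (source x) * gen x" by (simp add: mult.assoc)
  also have "\<dots> \<asymp> (if u = source x then V (source x) else 0) * gen x"
    by (rule cong_right[OF V_V[OF u source_verts[OF x]] R_gen[OF x]])
  also have "\<dots> \<asymp> (if u = source x then gen x else 0)"
    using V_source[OF x] by simp
  finally show ?thesis .
qed

lemma gen_V: "\<lbrakk>x \<in> lpa_gens E; u \<in> verts E\<rbrakk> \<Longrightarrow> gen x * V u \<asymp> (if u = target x then gen x else 0)"
proof -
  assume x: "x \<in> lpa_gens E" and u: "u \<in> verts E"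
  have "gen x * V u \<asymp> gen x * V (target x) * V u"
    by (rule cong_right[OF cong_sym[OF V_target[OF x]] R_V[OF u]])
  also have "\<dots> = gen x * (V (target x) * V u)" by (simp add: mult.assoc)
  also have "\<dots> \<asymp> gen x * (if target x = u then V u else 0)"
    by (rule cong_left[OF V_V[OF target_verts[OF x] u] R_gen[OF x]])
  also have "\<dots> \<asymp> (if u = target x then gen x else 0)"
    using V_target[OF x] by auto
  finally show ?thesis .
qed

definition unit :: "'v set \<Rightarrow> ('v, 'e, 'k) lpa_free" where "unit W = (\<Sum>v\<in>W. V v)"

lemma unit_R: "W \<subseteq> verts E \<Longrightarrow> unit W \<in> R"
  unfolding unit_def by (intro R_sum R_V) auto

lemma unit_Aug: "W \<subseteq> verts E \<Longrightarrow> unit W \<in> Aug"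
  unfolding unit_def by (intro Aug_sum Aug_gen) (auto simp: lpa_gens_def)

lemma homog_unit: "homog 0 (unit W)"
  unfolding unit_def by (intro homog_sum homog_Vertex)

lemma
  assumes "finite W" "W \<subseteq> verts E" "x \<in> lpa_gens E"
  shows unit_gen: "unit W * gen x \<asymp> (if source x \<in> W then gen x else 0)"
    and gen_unit: "gen x * unit W \<asymp> (if target x \<in> W then gen x else 0)"
proof -
  have "unit W * gen x \<asymp> (\<Sum>v\<in>W. if v = source x then gen x else 0)"
    unfolding unit_def sum_distrib_right by (intro cong_sum V_gen) (use assms in auto)
  then show "unit W * gen x \<asymp> (if source x \<in> W then gen x else 0)"
    using assms(1) by (simp add: sum.delta)
  have "gen x * unit W \<asymp> (\<Sum>v\<in>W. if v = target x then gen x else 0)"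
    unfolding unit_def sum_distrib_left by (intro cong_sum gen_V) (use assms in auto)
  then show "gen x * unit W \<asymp> (if target x \<in> W then gen x else 0)"
    using assms(1) by (simp add: sum.delta)
qed

lemma word_Cons: "Poly_Mapping.single (Word (x # xs)) c = gen x * Poly_Mapping.single (Word xs) c"
  by (simp add: gen_def mult_single plus_fmon_def)

text \<open>The support of an element of \<open>Aug\<close> omits the empty word, so every word in
  it has a first letter, whose source vertex fixes it from the left. Allowing all larger sets
  \<open>W'\<close> lets one set serve finitely many elements.\<close>

lemma local_unit:
  assumes "p \<in> Aug"
  obtains W where "finite W" "W \<subseteq> verts E"
    "\<And>W'. \<lbrakk>finite W'; W \<subseteq> W'; W' \<subseteq> verts E\<rbrakk> \<Longrightarrow> unit W' * p \<asymp> p"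
proof
  let ?W = "(\<lambda>w. source (hd (letters w))) ` Poly_Mapping.keys p"
  have key: "\<exists>x xs. w = Word (x # xs) \<and> x \<in> lpa_gens E \<and> set xs \<subseteq> lpa_gens E"
    if "w \<in> Poly_Mapping.keys p" for w
  proof -
    have "w \<noteq> 0" "w \<in> words" using assms that by (auto simp: Aug_iff R_iff in_keys_iff)
    then show ?thesis
      by (cases w; cases "letters w") (auto simp: words_def zero_fmon_def)
  qed
  show "finite ?W" by simp
  show "?W \<subseteq> verts E" using key source_verts by fastforce
  fix W' assume W': "finite W'" "?W \<subseteq> W'" "W' \<subseteq> verts E"
  have "unit W' * Poly_Mapping.single w (Poly_Mapping.lookup p w) \<asymp> Poly_Mapping.single w (Poly_Mapping.lookup p w)"
    if w: "w \<in> Poly_Mapping.keys p" for w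
  proof -
    obtain x xs where x: "w = Word (x # xs)" "x \<in> lpa_gens E" "set xs \<subseteq> lpa_gens E"
      using key[OF w] by blast
    have "source x \<in> W'" using W'(2) w x(1) by fastforce
    then have "unit W' * gen x \<asymp> gen x" using unit_gen[OF W'(1,3) x(2)] by simp
    then have "unit W' * gen x * Poly_Mapping.single (Word xs) c \<asymp> gen x * Poly_Mapping.single (Word xs) c" for c
      by (rule cong_right) (use x in \<open>auto intro: R_single simp: words_def\<close>)
    then show ?thesis unfolding x word_Cons by (simp add: mult.assoc)
  qed
  then have "(\<Sum>w\<in>Poly_Mapping.keys p. unit W' * Poly_Mapping.single w (Poly_Mapping.lookup p w)) \<asymp>
      (\<Sum>w\<in>Poly_Mapping.keys p. Poly_Mapping.single w (Poly_Mapping.lookup p w))"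
    by (rule cong_sum)
  then show "unit W' * p \<asymp> p"
    by (simp only: sum_distrib_left[symmetric] poly_mapping_sum_single[symmetric])
qed

section \<open>Monomials built from paths and ghost paths\<close>

definition epath :: "'e list \<Rightarrow> ('v, 'e, 'k) lpa_free" where
  "epath es = prod_list (map Ed es)"

text \<open>Ghost paths are read backwards, since the adjoint of a product is the reversed product
  of the adjoints.\<close>

definition gpath :: "'e list \<Rightarrow> ('v, 'e, 'k) lpa_free" where
  "gpath es = prod_list (rev (map Gh es))"

lemma epath_simps [simp]: "epath [] = 1" "epath (e # es) = Ed e * epath es"
  "epath (es @ fs) = epath es * epath fs"
  by (simp_all add: epath_def)

lemma gpath_simps [simp]: "gpath [] = 1" "gpath (e # es) = gpath es * Gh e"
  "gpath (es @ fs) = gpath fs * gpath es"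
  by (simp_all add: gpath_def)

lemma
  assumes "set es \<subseteq> arcs E"
  shows epath_R: "epath es \<in> R" and gpath_R: "gpath es \<in> R"
  using assms by (induction es) (auto intro: R_closed)

lemma awalk_Nil: "awalk v [] w \<longleftrightarrow> v \<in> verts E \<and> w = v"
  by (auto simp: awalk_def)

lemma awalk_Cons: "awalk v (e # es) w \<longleftrightarrow> e \<in> arcs E \<and> v = tail E e \<and> awalk (head E e) es w"
  by (auto simp: awalk_def)

lemma awalk_R: "awalk v es w \<Longrightarrow> v \<in> verts E \<and> w \<in> verts E \<and> epath es \<in> R \<and> gpath es \<in> R"
proof -
  assume w: "awalk v es w"
  then have "v \<in> verts E \<and> w \<in> verts E"
    by (induction es arbitrary: v) (auto simp: awalk_Nil awalk_Cons)
  moreover have "set es \<subseteq> arcs E" using w by (simp add: awalk_def)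
  ultimately show ?thesis by (simp add: epath_R gpath_R)
qed

lemma V_Ed_epath: "awalk v (e # es) w \<Longrightarrow> V v * (Ed e * epath es) \<asymp> Ed e * (V (head E e) * epath es)"
proof -
  assume w: "awalk v (e # es) w"
  then have e: "e \<in> arcs E" "v = tail E e" "awalk (head E e) es w" by (auto simp: awalk_Cons)
  have es: "epath es \<in> R" using awalk_R e by blast
  have "V v * Ed e \<asymp> Ed e * V (head E e)"
    using e V_Ed Ed_V cong_sym cong_trans by blast
  from cong_right[OF this es] show ?thesis by (simp add: mult.assoc)
qed

lemma epath_V: "awalk v es w \<Longrightarrow> V v * epath es * V w \<asymp> V v * epath es"
proof (induction es arbitrary: v)
  case Nil
  then show ?case by (auto simp: awalk_Nil V_idem)
next
  case (Cons e es)
  then have e: "e \<in> arcs E" "v = tail E e" "awalk (head E e) es w" by (auto simp: awalk_Cons)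
  have R: "V w \<in> R" "Ed e \<in> R" using awalk_R[OF e(3)] e(1) by (auto intro: R_closed)
  have "V v * epath (e # es) * V w \<asymp> Ed e * (V (head E e) * epath es) * V w"
    using cong_right[OF V_Ed_epath[OF Cons.prems] R(1)] by (simp add: mult.assoc)
  also have "\<dots> = Ed e * (V (head E e) * epath es * V w)" by (simp add: mult.assoc)
  also have "\<dots> \<asymp> Ed e * (V (head E e) * epath es)" by (rule cong_left[OF Cons.IH[OF e(3)] R(2)])
  also have "\<dots> \<asymp> V v * epath (e # es)" using cong_sym[OF V_Ed_epath[OF Cons.prems]] by simp
  finally show ?case .
qed

lemma gpath_V: "awalk v es w \<Longrightarrow> V w * (gpath es * V v) \<asymp> gpath es * V v"
proof (induction es arbitrary: v)
  case Nil
  then show ?case by (auto simp: awalk_Nil V_idem)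
next
  case (Cons e es)
  then have e: "e \<in> arcs E" "v = tail E e" "awalk (head E e) es w" by (auto simp: awalk_Cons)
  have R: "V w \<in> R" "Gh e \<in> R" "gpath es \<in> R" using awalk_R[OF e(3)] e(1) by (auto intro: R_closed)
  have "Gh e * V v \<asymp> V (head E e) * Gh e"
    using e V_Gh Gh_V cong_sym cong_trans by blast
  from cong_left[OF this R(3)]
  have *: "gpath (e # es) * V v \<asymp> gpath es * V (head E e) * Gh e" by (simp add: mult.assoc)
  have "V w * (gpath (e # es) * V v) \<asymp> V w * (gpath es * V (head E e) * Gh e)"
    by (rule cong_left[OF * R(1)])
  also have "\<dots> = V w * (gpath es * V (head E e)) * Gh e" by (simp add: mult.assoc)
  also have "\<dots> \<asymp> gpath es * V (head E e) * Gh e" by (rule cong_right[OF Cons.IH[OF e(3)] R(2)])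
  also have "\<dots> \<asymp> gpath (e # es) * V v" by (rule cong_sym[OF *])
  finally show ?case .
qed

lemma Gh_V_Ed:
  assumes "e \<in> arcs E" "f \<in> arcs E" "tail E f = v"
  shows "Gh e * (V v * Ed f) \<asymp> (if e = f then V (head E e) else 0)"
proof -
  have "Gh e * (V v * Ed f) \<asymp> Gh e * Ed f"
    using assms V_Ed by (auto intro: cong_left R_closed)
  then show ?thesis using Gh_Ed[OF assms(1,2)] cong_trans by blast
qed

text \<open>The relation for \<open>e\<^sup>* f\<close> strips common initial edges one at a time
  and gives zero at the first difference. What survives is the unmatched end of the longer path with
  a vertex attached.\<close>

lemma gpath_epath:
  assumes "awalk u es w" "awalk u fs w'"
  shows "gpath es * (V u * epath fs) \<asymp>
    (if prefix es fs then V w * epath (drop (length es) fs)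
     else if prefix fs es then gpath (drop (length fs) es) * V w' else 0)"
  using assms
proof (induction es arbitrary: u fs)
  case Nil
  then show ?case by (auto simp: awalk_Nil)
next
  case (Cons e es)
  show ?case
  proof (cases fs)
    case Nil
    then show ?thesis using Cons.prems(2) by (simp add: awalk_Nil)
  next
    case fs: (Cons f fs')
    have e: "e \<in> arcs E" "u = tail E e" "awalk (head E e) es w" using Cons.prems by (auto simp: awalk_Cons)
    have f: "f \<in> arcs E" "u = tail E f" "awalk (head E f) fs' w'" using Cons.prems fs by (auto simp: awalk_Cons)
    have R: "gpath es \<in> R" "epath fs' \<in> R" using awalk_R[OF e(3)] awalk_R[OF f(3)] by auto
    have "gpath (e # es) * (V u * epath fs) = gpath es * (Gh e * (V u * Ed f) * epath fs')"
      by (simp add: fs mult.assoc)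
    also have "\<dots> \<asymp> gpath es * ((if e = f then V (head E e) else 0) * epath fs')"
      by (intro cong_left cong_right Gh_V_Ed) (use e f R in auto)
    finally have *: "gpath (e # es) * (V u * epath fs) \<asymp>
      gpath es * ((if e = f then V (head E e) else 0) * epath fs')" .
    show ?thesis
    proof (cases "e = f")
      case True
      then have "awalk (head E e) fs' w'" using f(3) by simp
      from Cons.IH[OF e(3) this] show ?thesis
        by (intro cong_trans[OF *])
          (cases "prefix es fs'"; cases "prefix fs' es"; simp add: fs True)
    next
      case False
      then show ?thesis using * by (auto simp: fs)
    qed
  qed
qed

text \<open>The monomial \<open>es fs\<^sup>*\<close>. Its outer vertices are written out because
  \<open>epath []\<close> and \<open>gpath []\<close> are the unit of the free ring, which lies
  outside \<open>Aug\<close>; for trivial paths the monomial thus represents the vertex.\<close>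

definition pathmon :: "'v \<Rightarrow> 'e list \<Rightarrow> 'v \<Rightarrow> 'e list \<Rightarrow> ('v, 'e, 'k) lpa_free" where
  "pathmon v es u fs = V v * epath es * (gpath fs * V u)"

lemma pathmon_Aug: "\<lbrakk>awalk v es w; awalk u fs w'\<rbrakk> \<Longrightarrow> pathmon v es u fs \<in> Aug"
  unfolding pathmon_def using awalk_R[of v es w] awalk_R[of u fs w']
  by (auto intro!: Aug_mult_right R_closed Aug_gen simp: lpa_gens_def)

lemma pathmon_R: "\<lbrakk>awalk v es w; awalk u fs w'\<rbrakk> \<Longrightarrow> pathmon v es u fs \<in> R"
  using pathmon_Aug Aug_R by blast

lemma homog_pathmon: "homog (int (length es) - int (length fs)) (pathmon v es u fs)"
proof -
  have E: "homog (int (length es)) (epath es)" for es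
  proof (induction es)
    case (Cons e es)
    then show ?case using homog_mult[OF homog_Edge Cons] by simp
  qed (simp add: homog_def word_degree_def zero_fmon_def)
  have G: "homog (- int (length es)) (gpath es)" for es
  proof (induction es)
    case (Cons e es)
    then show ?case using homog_mult[OF Cons homog_Ghost] by (simp add: algebra_simps)
  qed (simp add: homog_def word_degree_def zero_fmon_def)
  show ?thesis unfolding pathmon_def
    using homog_mult[OF homog_mult[OF homog_Vertex E] homog_mult[OF G homog_Vertex]] by simp
qed

text \<open>This is the multiplication rule of the polycyclic monoid: the two inner paths are
  compared, and the rest of the longer one is appended to the outer path of the other
  factor.\<close>

lemma pathmon_mult:
  assumes "awalk v es w" "awalk u fs w" "awalk u es' w'" "awalk z gs w'"
  shows "pathmon v es u fs * pathmon u es' z gs \<asymp>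
    (if prefix fs es' then pathmon v (es @ drop (length fs) es') z gs
     else if prefix es' fs then pathmon v es z (gs @ drop (length es') fs) else 0)"
proof -
  note Rs = awalk_R[OF assms(1)] awalk_R[OF assms(2)] awalk_R[OF assms(3)] awalk_R[OF assms(4)]
  have u: "u \<in> verts E" using Rs by blast
  have "pathmon v es u fs * pathmon u es' z gs = V v * epath es * gpath fs * (V u * V u) * (epath es' * gpath gs * V z)"
    by (simp add: pathmon_def mult.assoc)
  also have "\<dots> \<asymp> V v * epath es * gpath fs * V u * (epath es' * gpath gs * V z)"
    by (intro cong_left cong_right V_idem u) (use Rs in \<open>auto intro!: R_closed\<close>)
  also have "\<dots> = V v * epath es * (gpath fs * (V u * epath es')) * (gpath gs * V z)"
    by (simp add: mult.assoc)
  also have "\<dots> \<asymp> V v * epath es * (if prefix fs es' then V w * epath (drop (length fs) es')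
     else if prefix es' fs then gpath (drop (length es') fs) * V w' else 0) * (gpath gs * V z)"
    by (intro cong_left cong_right gpath_epath[OF assms(2,3)]) (use Rs in \<open>auto intro!: R_closed\<close>)
  also have "\<dots> \<asymp> (if prefix fs es' then pathmon v (es @ drop (length fs) es') z gs
     else if prefix es' fs then pathmon v es z (gs @ drop (length es') fs) else 0)"
  proof -
    consider "prefix fs es'" | "\<not> prefix fs es'" "prefix es' fs" | "\<not> prefix fs es'" "\<not> prefix es' fs" by blast
    then show ?thesis
    proof cases
      case 1
      have "set es' \<subseteq> arcs E" using assms(3) by (auto simp: awalk_def)
      then have R: "epath (drop (length fs) es') \<in> R"
        using set_drop_subset by (intro epath_R) fast
      have "V v * epath es * V w * (epath (drop (length fs) es') * (gpath gs * V z)) \<asymp>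
          V v * epath es * (epath (drop (length fs) es') * (gpath gs * V z))"
        by (intro cong_right epath_V[OF assms(1)]) (use Rs R in \<open>auto intro!: R_closed\<close>)
      then show ?thesis using 1 by (simp add: pathmon_def mult.assoc)
    next
      case 2
      have "set fs \<subseteq> arcs E" using assms(2) by (auto simp: awalk_def)
      then have R: "gpath (drop (length es') fs) \<in> R"
        using set_drop_subset by (intro gpath_R) fast
      have "V v * epath es * gpath (drop (length es') fs) * (V w' * (gpath gs * V z)) \<asymp>
          V v * epath es * gpath (drop (length es') fs) * (gpath gs * V z)"
        by (intro cong_left gpath_V[OF assms(4)]) (use Rs R in \<open>auto intro!: R_closed\<close>)
      then show ?thesis using 2 by (simp add: pathmon_def mult.assoc)
    next
      case 3
      then show ?thesis by simp
    qed
  qed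
  finally show ?thesis .
qed

lemma pathmon_mult_distinct:
  assumes "awalk v es w" "awalk u fs w" "awalk u' es' w'" "awalk z gs w'" "u \<noteq> u'"
  shows "pathmon v es u fs * pathmon u' es' z gs \<asymp> 0"
proof -
  note Rs = awalk_R[OF assms(1)] awalk_R[OF assms(2)] awalk_R[OF assms(3)] awalk_R[OF assms(4)]
  have "pathmon v es u fs * pathmon u' es' z gs = V v * epath es * gpath fs * (V u * V u') * (epath es' * gpath gs * V z)"
    by (simp add: pathmon_def mult.assoc)
  also have "\<dots> \<asymp> V v * epath es * gpath fs * (if u = u' then V u' else 0) * (epath es' * gpath gs * V z)"
    by (intro cong_left cong_right V_V) (use Rs in \<open>auto intro!: R_closed\<close>)
  finally show ?thesis using assms(5) by simp
qed

lemma
  assumes "awalk v es w" "awalk u fs w" "finite W" "W \<subseteq> verts E"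
  shows unit_pathmon: "unit W * pathmon v es u fs \<asymp> (if v \<in> W then pathmon v es u fs else 0)"
    and pathmon_unit: "pathmon v es u fs * unit W \<asymp> (if u \<in> W then pathmon v es u fs else 0)"
proof -
  note Rs = awalk_R[OF assms(1)] awalk_R[OF assms(2)]
  have "unit W * gen (Vertex v) * (epath es * (gpath fs * V u)) \<asymp>
      (if source (Vertex v) \<in> W then V v else 0) * (epath es * (gpath fs * V u))"
    by (intro cong_right unit_gen) (use assms Rs in \<open>auto intro!: R_closed simp: lpa_gens_def\<close>)
  then show "unit W * pathmon v es u fs \<asymp> (if v \<in> W then pathmon v es u fs else 0)"
    by (cases "v \<in> W") (simp_all add: pathmon_def mult.assoc)
  have "V v * epath es * gpath fs * (gen (Vertex u) * unit W) \<asymp>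
      V v * epath es * gpath fs * (if target (Vertex u) \<in> W then V u else 0)"
    by (intro cong_left gen_unit) (use assms Rs in \<open>auto intro!: R_closed simp: lpa_gens_def\<close>)
  then show "pathmon v es u fs * unit W \<asymp> (if u \<in> W then pathmon v es u fs else 0)"
    by (cases "u \<in> W") (simp_all add: pathmon_def mult.assoc)
qed

text \<open>The induction step in reducing words to monomials. The difference of the lengths is
  tracked explicitly: the class of a monomial might be zero, and then homogeneity says nothing about
  its paths.\<close>

lemma gen_pathmon:
  assumes x: "x \<in> lpa_gens E" and w: "awalk v es w" "awalk u fs w"
  shows "gen x * pathmon v es u fs \<asymp> 0 \<or>
    (\<exists>v' es' u' fs' w'. awalk v' es' w' \<and> awalk u' fs' w' \<and> gen x * pathmon v es u fs \<asymp> pathmon v' es' u' fs' \<and>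
      int (length es') - int (length fs') = gen_degree (\<lambda>_. 1) x + int (length es) - int (length fs))"
proof (cases "v = target x")
  case False
  note Rs = awalk_R[OF w(1)] awalk_R[OF w(2)]
  have "gen x * V v * (epath es * (gpath fs * V u)) \<asymp> 0 * (epath es * (gpath fs * V u))"
    using gen_V[OF x, of v] False Rs by (intro cong_right) (auto intro!: R_closed)
  then show ?thesis by (simp add: pathmon_def mult.assoc)
next
  case v: True
  note Rs = awalk_R[OF w(1)] awalk_R[OF w(2)]
  show ?thesis
  proof (cases x)
    case (Vertex v')
    have "V v * V v * (epath es * (gpath fs * V u)) \<asymp> V v * (epath es * (gpath fs * V u))"
      using V_idem Rs by (intro cong_right) (auto intro!: R_closed)
    then have "gen x * pathmon v es u fs \<asymp> pathmon v es u fs"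
      using v Vertex by (simp add: pathmon_def mult.assoc)
    then show ?thesis using w Vertex by (intro disjI2 exI conjI[OF w(1) conjI[OF w(2) conjI]]) auto
  next
    case (Edge e)
    then have e: "e \<in> arcs E" "v = head E e" using x v by (auto simp: lpa_gens_def)
    have "Ed e * V (head E e) \<asymp> V (tail E e) * Ed e"
      using e V_Ed Ed_V cong_sym cong_trans by blast
    then have "Ed e * V v * (epath es * (gpath fs * V u)) \<asymp> V (tail E e) * Ed e * (epath es * (gpath fs * V u))"
      using Rs e by (intro cong_right) (auto intro!: R_closed)
    then have "gen x * pathmon v es u fs \<asymp> pathmon (tail E e) (e # es) u fs"
      using Edge by (simp add: pathmon_def mult.assoc)
    moreover have w': "awalk (tail E e) (e # es) w" using w e by (simp add: awalk_Cons)
    ultimately show ?thesis using Edge w(2)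
      by (intro disjI2 exI[of _ "tail E e"] exI[of _ "e # es"] exI[of _ u] exI[of _ fs] exI[of _ w]) auto
  next
    case (Ghost e)
    then have e: "e \<in> arcs E" "v = tail E e" using x v by (auto simp: lpa_gens_def)
    show ?thesis
    proof (cases es)
      case Nil
      then have wv: "w = v" using w by (simp add: awalk_Nil)
      have "Gh e * V v \<asymp> V (head E e) * Gh e"
        using e V_Gh Gh_V cong_sym cong_trans by blast
      then have "Gh e * V v * (gpath fs * V u) \<asymp> V (head E e) * Gh e * (gpath fs * V u)"
        using Rs e by (intro cong_right) (auto intro!: R_closed)
      \<comment> \<open>The ghost edge finds no edge to cancel and joins the far end of the ghost
        path.\<close>
      then have "gen x * pathmon v es u fs \<asymp> pathmon (head E e) [] u (fs @ [e])"
        using Ghost Nil by (simp add: pathmon_def mult.assoc)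
      moreover have w': "awalk (head E e) [] (head E e)" "awalk u (fs @ [e]) (head E e)"
        using e w(2) wv by (auto simp: awalk_Nil awalk_append_iff awalk_Cons awlast_if_cas dest: awalkE)
      ultimately show ?thesis using Ghost Nil
        by (intro disjI2 exI[of _ "head E e"] exI[of _ "[]"] exI[of _ u] exI[of _ "fs @ [e]"]) auto
    next
      case (Cons f es')
      then have f: "f \<in> arcs E" "v = tail E f" "awalk (head E f) es' w" using w by (auto simp: awalk_Cons)
      have "epath es' \<in> R" using awalk_R[OF f(3)] by blast
      then have "Gh e * (V v * Ed f) * (epath es' * (gpath fs * V u)) \<asymp>
          (if e = f then V (head E e) else 0) * (epath es' * (gpath fs * V u))"
        using Rs e f by (intro cong_right Gh_V_Ed) (auto intro!: R_closed)
      then have *: "gen x * pathmon v es u fs \<asymp> (if e = f then pathmon (head E f) es' u fs else 0)"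
        using Ghost Cons by (cases "e = f") (simp_all add: pathmon_def mult.assoc)
      then show ?thesis
      proof (cases "e = f")
        case True
        then show ?thesis using * f(3) w(2) Ghost Cons
          by (intro disjI2 exI conjI[OF f(3) conjI[OF w(2) conjI]]) auto
      qed simp
    qed
  qed
qed

lemma word_pathmon:
  assumes "set xs \<subseteq> lpa_gens E" "xs \<noteq> []"
  shows "Poly_Mapping.single (Word xs) 1 \<asymp> (0 :: ('v, 'e, 'k) lpa_free) \<or>
    (\<exists>v es u fs w. awalk v es w \<and> awalk u fs w \<and> Poly_Mapping.single (Word xs) 1 \<asymp> pathmon v es u fs \<and>
      int (length es) - int (length fs) = deg (Word xs))"
  using assms
proof (induction xs)
  case (Cons x xs)
  have x: "x \<in> lpa_gens E" using Cons.prems by simp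
  have deg: "deg (Word (x # xs)) = gen_degree (\<lambda>_. 1) x + deg (Word xs)" by (simp add: word_degree_def)
  show ?case
  proof (cases "xs = []")
    case True
    have t: "awalk (target x) [] (target x)" using target_verts[OF x] by (simp add: awalk_Nil)
    \<comment> \<open>A single letter is viewed as acting on the trivial monomial at its
      target.\<close>
    have "gen x * pathmon (target x) [] (target x) [] \<asymp> gen x * V (target x)"
      unfolding pathmon_def using V_idem[OF target_verts[OF x]] R_gen[OF x] by (auto intro: cong_left)
    also have "\<dots> \<asymp> gen x" by (rule V_target[OF x])
    finally have *: "gen x \<asymp> gen x * pathmon (target x) [] (target x) []" by (rule cong_sym)
    have deg_x: "deg (Word (x # xs)) = gen_degree (\<lambda>_. 1) x" by (simp add: True word_degree_def)
    have gen_x: "Poly_Mapping.single (Word (x # xs)) 1 = gen x" by (simp add: True gen_def)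
    from gen_pathmon[OF x t t] show ?thesis
      unfolding gen_x deg_x
    proof (elim disjE exE conjE)
      fix v' es' u' fs' w'
      assume a: "awalk v' es' w'" "awalk u' fs' w'"
        "gen x * pathmon (target x) [] (target x) [] \<asymp> pathmon v' es' u' fs'"
        "int (length es') - int (length fs') = gen_degree (\<lambda>_. 1) x + int (length ([] :: 'e list)) - int (length ([] :: 'e list))"
      show "gen x \<asymp> 0 \<or> (\<exists>v es u fs w. awalk v es w \<and> awalk u fs w \<and> gen x \<asymp> pathmon v es u fs \<and>
          int (length es) - int (length fs) = gen_degree (\<lambda>_. 1) x)"
        using cong_trans[OF * a(3)] a(1,2) a(4)[simplified] by blast
    qed (blast intro: cong_trans[OF *])
  next
    case False
    let ?s = "Poly_Mapping.single (Word xs) 1 :: ('v, 'e, 'k) lpa_free"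
    have s: "Poly_Mapping.single (Word (x # xs)) 1 = gen x * ?s" by (rule word_Cons)
    from Cons.IH False Cons.prems consider "?s \<asymp> 0" |
      v es u fs w where "awalk v es w" "awalk u fs w" "?s \<asymp> pathmon v es u fs"
        "int (length es) - int (length fs) = deg (Word xs)" by auto
    then show ?thesis
    proof cases
      case 1
      then show ?thesis using cong_left[OF 1 R_gen[OF x]] by (simp add: s)
    next
      case 2
      show ?thesis
        using gen_pathmon[OF x 2(1,2)] cong_trans[OF cong_left[OF 2(3) R_gen[OF x]]] 2(4)
        unfolding s deg by (metis add_diff_eq)
    qed
  qed
qed simp

end

section \<open>Graded homomorphisms and Evans cancellation\<close>

lemma (in abelian_monoid) finsum_superset:
  assumes "finite T" "S \<subseteq> T" "\<And>i. i \<in> T - S \<Longrightarrow> f i = \<zero>" "\<And>i. i \<in> S \<Longrightarrow> f i \<in> carrier G"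
  shows "finsum G f T = finsum G f S"
proof -
  have "finsum G f (S \<union> (T - S)) = finsum G f S \<oplus> finsum G f (T - S)"
    using assms by (intro finsum_Un_disjoint) (auto intro: finite_subset)
  moreover have "S \<union> (T - S) = T" using assms(2) by blast
  moreover have "finsum G f (T - S) = finsum G (\<lambda>_. \<zero>) (T - S)"
    using assms(3) by (intro finsum_cong') auto
  ultimately show ?thesis using assms(4) by (simp add: finsum_closed)
qed

context abelian_group
begin

lemma diff_self: "x \<in> carrier G \<Longrightarrow> x \<ominus> x = \<zero>"
  by (simp add: minus_eq r_neg)

lemma diff_eq_zeroD: "\<lbrakk>x \<ominus> y = \<zero>; x \<in> carrier G; y \<in> carrier G\<rbrakk> \<Longrightarrow> x = y"
  by (metis a_inv_closed minus_eq minus_equality minus_minus)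

lemma add_diff_cancel: "\<lbrakk>x \<in> carrier G; y \<in> carrier G\<rbrakk> \<Longrightarrow> x \<oplus> y \<ominus> x = y"
  by (metis a_comm a_inv_closed a_assoc minus_eq r_neg r_zero)

lemma diff_add_diff: "\<lbrakk>x \<in> carrier G; y \<in> carrier G; z \<in> carrier G\<rbrakk> \<Longrightarrow> x \<ominus> (z \<oplus> (x \<ominus> y)) = y \<ominus> z"
proof -
  assume c: "x \<in> carrier G" "y \<in> carrier G" "z \<in> carrier G"
  have "x \<ominus> (z \<oplus> (x \<ominus> y)) = (x \<oplus> \<ominus> x) \<oplus> (y \<oplus> \<ominus> z)"
    using c by (simp add: minus_eq minus_add a_ac)
  then show ?thesis using c by (simp add: minus_eq r_neg)
qed

end

text \<open>Any finite index set that contains the support will do, so two decompositions can be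
  compared over a common set and exact supports never have to be computed.\<close>

lemma internal_direct_sumI:
  assumes M: "abelian_group M"
    and sub: "\<And>n. additive_subgroup (C n) M"
    and ex: "\<And>x. x \<in> carrier M \<Longrightarrow> \<exists>c S. finite S \<and> (\<forall>n. c n \<in> C n) \<and> (\<forall>n. n \<notin> S \<longrightarrow> c n = \<zero>\<^bsub>M\<^esub>) \<and>
      x = finsum M c S"
    and un: "\<And>c c' S. \<lbrakk>finite S; \<forall>n. c n \<in> C n; \<forall>n. c' n \<in> C n; \<forall>n. n \<notin> S \<longrightarrow> c n = \<zero>\<^bsub>M\<^esub>;
      \<forall>n. n \<notin> S \<longrightarrow> c' n = \<zero>\<^bsub>M\<^esub>; finsum M c S = finsum M c' S\<rbrakk> \<Longrightarrow> c = c'"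
  shows "internal_direct_sum M C"
proof -
  interpret abelian_group M by (rule M)
  have C: "C n \<subseteq> carrier M" for n by (rule additive_subgroup.a_subset[OF sub])
  have supp: "finsum M c S = finsum M c {n. c n \<noteq> \<zero>\<^bsub>M\<^esub>}"
    if "finite S" "\<forall>n. c n \<in> C n" "\<forall>n. n \<notin> S \<longrightarrow> c n = \<zero>\<^bsub>M\<^esub>" for c S
    using that C by (intro finsum_superset) auto
  show ?thesis
    unfolding internal_direct_sum_def
  proof (intro conjI ballI allI sub)
    fix x assume x: "x \<in> carrier M"
    then obtain c S where c: "finite S" "\<forall>n. c n \<in> C n" "\<forall>n. n \<notin> S \<longrightarrow> c n = \<zero>\<^bsub>M\<^esub>" "x = finsum M c S"
      using ex by blast
    have "finite {n. c n \<noteq> \<zero>\<^bsub>M\<^esub>}" by (rule finite_subset[OF _ c(1)]) (use c in auto)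
    show "\<exists>!c. (\<forall>n. c n \<in> C n) \<and> finite {n. c n \<noteq> \<zero>\<^bsub>M\<^esub>} \<and> x = finsum M c {n. c n \<noteq> \<zero>\<^bsub>M\<^esub>}"
    proof (rule ex1I[of _ c])
      show "(\<forall>n. c n \<in> C n) \<and> finite {n. c n \<noteq> \<zero>\<^bsub>M\<^esub>} \<and> x = finsum M c {n. c n \<noteq> \<zero>\<^bsub>M\<^esub>}"
        using c supp \<open>finite {n. c n \<noteq> \<zero>\<^bsub>M\<^esub>}\<close> by metis
    next
      fix c' assume c': "(\<forall>n. c' n \<in> C n) \<and> finite {n. c' n \<noteq> \<zero>\<^bsub>M\<^esub>} \<and> x = finsum M c' {n. c' n \<noteq> \<zero>\<^bsub>M\<^esub>}"
      let ?T = "S \<union> {n. c' n \<noteq> \<zero>\<^bsub>M\<^esub>}"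
      have fin: "finite ?T" using c c' by blast
      have "finsum M c ?T = finsum M c' ?T"
        using supp[OF fin, of c] supp[OF fin, of c'] supp[of S c] c c' by fastforce
      then show "c' = c" using c c' fin by (intro un[of ?T]) auto
    qed
  qed
qed

context graded_module
begin

lemma grade_subgroup: "additive_subgroup (grade M n) M"
  using grading by (simp add: internal_direct_sum_def)

lemma grade_closed: "x \<in> grade M n \<Longrightarrow> x \<in> carrier M"
  using additive_subgroup.a_subset[OF grade_subgroup] by blast

lemma grade_add: "\<lbrakk>x \<in> grade M n; y \<in> grade M n\<rbrakk> \<Longrightarrow> x \<oplus> y \<in> grade M n"
  using additive_subgroup.a_closed[OF grade_subgroup] by blast

lemma grade_zero [simp]: "\<zero> \<in> grade M n"
  using additive_subgroup.zero_closed[OF grade_subgroup] by blast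

lemma grade_minus: "x \<in> grade M n \<Longrightarrow> \<ominus> x \<in> grade M n"
  using subgroup.m_inv_closed[OF additive_subgroup.a_subgroup[OF grade_subgroup]]
  by (simp add: a_inv_def)

lemma grade_finsum: "(\<And>i. i \<in> S \<Longrightarrow> f i \<in> grade M n) \<Longrightarrow> finsum M f S \<in> grade M n"
proof (induction S rule: infinite_finite_induct)
  case (insert x F)
  then have "f \<in> F \<rightarrow> carrier M" "f x \<in> carrier M" by (auto intro: grade_closed)
  with insert show ?case by (simp add: grade_add)
qed simp_all

lemma decompose:
  assumes "x \<in> carrier M"
  obtains c S where "finite S" "\<And>n. c n \<in> grade M n" "\<And>n. n \<notin> S \<Longrightarrow> c n = \<zero>" "x = finsum M c S"
proof -
  have "\<exists>c. (\<forall>n. c n \<in> grade M n) \<and> finite {n. c n \<noteq> \<zero>} \<and> x = finsum M c {n. c n \<noteq> \<zero>}"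
    by (rule ex1_implies_ex[OF bspec[OF conjunct2[OF grading[unfolded internal_direct_sum_def]] assms]])
  then obtain c where c: "(\<forall>n. c n \<in> grade M n) \<and> finite {n. c n \<noteq> \<zero>} \<and> x = finsum M c {n. c n \<noteq> \<zero>}"
    by (rule exE)
  show ?thesis
    by (rule that[of "{n. c n \<noteq> \<zero>}" c]) (use c in simp_all)
qed

lemma decompose_unique:
  assumes "finite S" "\<And>n. c n \<in> grade M n" "\<And>n. c' n \<in> grade M n"
    "\<And>n. n \<notin> S \<Longrightarrow> c n = \<zero>" "\<And>n. n \<notin> S \<Longrightarrow> c' n = \<zero>" "finsum M c S = finsum M c' S"
  shows "c = c'"
proof -
  have *: "finsum M c S = finsum M c {n. c n \<noteq> \<zero>}" "finite {n. c n \<noteq> \<zero>}"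
    if "\<And>n. c n \<in> grade M n" "\<And>n. n \<notin> S \<Longrightarrow> c n = \<zero>" for c
    using that assms(1) by (auto intro!: finsum_superset grade_closed intro: finite_subset[of _ S])
  have cl: "finsum M c S \<in> carrier M" using assms(2) grade_closed by (intro finsum_closed) auto
  define P where "P b \<longleftrightarrow> (\<forall>n. b n \<in> grade M n) \<and> finite {n. b n \<noteq> \<zero>} \<and>
    finsum M c S = finsum M b {n. b n \<noteq> \<zero>}" for b
  have "\<exists>!b. P b"
    unfolding P_def by (rule bspec[OF conjunct2[OF grading[unfolded internal_direct_sum_def]] cl])
  moreover have "P c" unfolding P_def by (intro conjI allI assms(2) *(1,2) assms(4))
  moreover have "P c'" unfolding P_def assms(6) by (intro conjI allI assms(3) *(1,2) assms(5))
  ultimately show ?thesis by blast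
qed

lemma smult_zero: "a \<in> carrier A \<Longrightarrow> a \<odot> \<zero> = \<zero>"
  by (metis smult_closed smult_r_distr zero_closed r_zero add.r_cancel_one')

lemma smult_minus: "\<lbrakk>a \<in> carrier A; x \<in> carrier M\<rbrakk> \<Longrightarrow> a \<odot> (\<ominus> x) = \<ominus> (a \<odot> x)"
  by (metis smult_closed smult_r_distr smult_zero a_inv_closed minus_equality l_neg)

lemma smult_finsum:
  "\<lbrakk>a \<in> carrier A; \<And>i. i \<in> S \<Longrightarrow> f i \<in> carrier M\<rbrakk> \<Longrightarrow> a \<odot> finsum M f S = finsum M (\<lambda>i. a \<odot> f i) S"
  by (induction S rule: infinite_finite_induct)
    (auto simp: smult_zero smult_r_distr smult_closed Pi_iff finsum_closed)

end

lemma
  assumes "f \<in> gmod_hom A M N"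
  shows gmod_hom_closed: "x \<in> carrier M \<Longrightarrow> f x \<in> carrier N"
    and gmod_hom_add: "\<lbrakk>x \<in> carrier M; y \<in> carrier M\<rbrakk> \<Longrightarrow> f (x \<oplus>\<^bsub>M\<^esub> y) = f x \<oplus>\<^bsub>N\<^esub> f y"
    and gmod_hom_smult: "\<lbrakk>a \<in> carrier A; x \<in> carrier M\<rbrakk> \<Longrightarrow> f (a \<odot>\<^bsub>M\<^esub> x) = a \<odot>\<^bsub>N\<^esub> f x"
    and gmod_hom_grade: "x \<in> grade M n \<Longrightarrow> f x \<in> grade N n"
  using assms by (auto simp: gmod_hom_def image_subset_iff)

lemma gmod_homI:
  assumes "\<And>x. x \<in> carrier M \<Longrightarrow> f x \<in> carrier N"
    "\<And>x y. \<lbrakk>x \<in> carrier M; y \<in> carrier M\<rbrakk> \<Longrightarrow> f (x \<oplus>\<^bsub>M\<^esub> y) = f x \<oplus>\<^bsub>N\<^esub> f y"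
    "\<And>a x. \<lbrakk>a \<in> carrier A; x \<in> carrier M\<rbrakk> \<Longrightarrow> f (a \<odot>\<^bsub>M\<^esub> x) = a \<odot>\<^bsub>N\<^esub> f x"
    "\<And>n x. x \<in> grade M n \<Longrightarrow> f x \<in> grade N n"
  shows "f \<in> gmod_hom A M N"
  using assms by (auto simp: gmod_hom_def)

lemma gmod_hom_comp:
  "\<lbrakk>f \<in> gmod_hom A M N; g \<in> gmod_hom A N L\<rbrakk> \<Longrightarrow> (\<lambda>x. g (f x)) \<in> gmod_hom A M L"
  by (auto simp: gmod_hom_def Pi_iff image_subset_iff)

lemma gmod_hom_id: "(\<lambda>x. x) \<in> gmod_hom A M M"
  by (auto simp: gmod_hom_def)

locale gmod_pair = M: graded_module A M + N: graded_module A N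
  for A :: "'a gring" and M :: "('a, 'b) gmodule" and N :: "('a, 'c) gmodule"
begin

lemma hom_sum:
  assumes f: "f \<in> gmod_hom A M N" and g: "g \<in> gmod_hom A M N"
  shows "(\<lambda>x. f x \<oplus>\<^bsub>N\<^esub> g x) \<in> gmod_hom A M N"
  by (rule gmod_homI)
    (auto simp: gmod_hom_closed[OF f] gmod_hom_closed[OF g] gmod_hom_add[OF f] gmod_hom_add[OF g]
      gmod_hom_smult[OF f] gmod_hom_smult[OF g] N.smult_r_distr N.a_ac
      intro: N.grade_add gmod_hom_grade[OF f] gmod_hom_grade[OF g])

lemma hom_minus:
  assumes f: "f \<in> gmod_hom A M N"
  shows "(\<lambda>x. \<ominus>\<^bsub>N\<^esub> f x) \<in> gmod_hom A M N"
  by (rule gmod_homI)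
    (auto simp: gmod_hom_closed[OF f] gmod_hom_add[OF f] gmod_hom_smult[OF f] N.smult_minus N.minus_add
      intro: N.grade_minus gmod_hom_grade[OF f])

lemma hom_diff:
  assumes f: "f \<in> gmod_hom A M N" and g: "g \<in> gmod_hom A M N"
  shows "(\<lambda>x. f x \<ominus>\<^bsub>N\<^esub> g x) \<in> gmod_hom A M N"
  unfolding a_minus_def by (intro hom_sum hom_minus f g)

lemma hom_zero:
  assumes f: "f \<in> gmod_hom A M N"
  shows "f \<zero>\<^bsub>M\<^esub> = \<zero>\<^bsub>N\<^esub>"
  by (metis M.l_zero M.zero_closed N.add.r_cancel_one' gmod_hom_add[OF f] gmod_hom_closed[OF f])

lemma hom_uminus:
  assumes f: "f \<in> gmod_hom A M N" and x: "x \<in> carrier M"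
  shows "f (\<ominus>\<^bsub>M\<^esub> x) = \<ominus>\<^bsub>N\<^esub> f x"
  using gmod_hom_add[OF f, of "\<ominus>\<^bsub>M\<^esub> x" x] hom_zero[OF f] x
  by (intro N.minus_equality[symmetric]) (auto simp: gmod_hom_closed[OF f] M.l_neg)

lemma hom_minus_distrib:
  assumes f: "f \<in> gmod_hom A M N" and x: "x \<in> carrier M" "y \<in> carrier M"
  shows "f (x \<ominus>\<^bsub>M\<^esub> y) = f x \<ominus>\<^bsub>N\<^esub> f y"
  using x by (simp add: a_minus_def gmod_hom_add[OF f] hom_uminus[OF f])

lemma hom_finsum:
  assumes f: "f \<in> gmod_hom A M N" and c: "\<And>i. i \<in> S \<Longrightarrow> c i \<in> carrier M"
  shows "f (finsum M c S) = finsum N (\<lambda>i. f (c i)) S"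
  using c
  by (induction S rule: infinite_finite_induct)
    (auto simp: hom_zero[OF f] gmod_hom_add[OF f] gmod_hom_closed[OF f] Pi_iff M.finsum_closed)

text \<open>A bijective graded homomorphism reflects degrees because decompositions are unique.\<close>

lemma hom_inverse:
  assumes f: "f \<in> gmod_hom A M N" and bij: "bij_betw f (carrier M) (carrier N)"
  shows "inv_into (carrier M) f \<in> gmod_hom A N M"
proof -
  let ?g = "inv_into (carrier M) f"
  have g: "?g x \<in> carrier M" "f (?g x) = x" if "x \<in> carrier N" for x
    using that bij by (auto simp: bij_betw_def inv_into_into f_inv_into_f)
  have eq: "?g x = y" if "y \<in> carrier M" "f y = x" for x y
    using that bij by (auto simp: bij_betw_def)
  show ?thesis
  proof (rule gmod_homI)
    fix n x assume x: "x \<in> grade N n"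
    then have xN: "x \<in> carrier N" by (rule N.grade_closed)
    obtain c S where c: "finite S" "\<And>n. c n \<in> grade M n" "\<And>n. n \<notin> S \<Longrightarrow> c n = \<zero>\<^bsub>M\<^esub>" "?g x = finsum M c S"
      using M.decompose[OF g(1)[OF xN]] by metis
    have cM: "c m \<in> carrier M" for m using c(2) M.grade_closed by blast
    define b where "b m = (if m = n then x else \<zero>\<^bsub>N\<^esub>)" for m
    have "finsum N b (insert n S) = finsum N b {n}"
      using c(1) xN by (intro N.finsum_superset) (auto simp: b_def)
    also have "\<dots> = x" using xN by (simp add: b_def)
    also have "x = finsum N (\<lambda>m. f (c m)) S"
      using hom_finsum[OF f, of S c] cM c(4) g(2)[OF xN] by simp
    also have "\<dots> = finsum N (\<lambda>m. f (c m)) (insert n S)"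
      using c by (intro N.finsum_superset[symmetric]) (auto simp: hom_zero[OF f] gmod_hom_closed[OF f] cM)
    finally have "b = (\<lambda>m. f (c m))"
      using c x by (intro N.decompose_unique[of "insert n S"])
        (auto simp: b_def hom_zero[OF f] intro: gmod_hom_grade[OF f])
    then have "?g x = c n" using eq[OF cM, of n x] by (auto simp: b_def dest!: fun_cong[of _ _ n])
    then show "?g x \<in> grade M n" using c(2) by simp
  qed (auto intro!: eq simp: g gmod_hom_add[OF f] gmod_hom_smult[OF f] M.smult_closed)
qed

end

text \<open>
  Stable range one of the graded endomorphism ring. In a pair with \<open>d d' + e = 1\<close> the element \<open>e\<close> is
  determined as \<open>1 - d d'\<close>, and \<open>u\<close> is the inverse of \<open>d + e y\<close>.
\<close>

definition sr1 :: "'a gring \<Rightarrow> ('a, 'b) gmodule \<Rightarrow> bool" where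
  "sr1 A M \<longleftrightarrow> (\<forall>d \<in> gmod_hom A M M. \<forall>d' \<in> gmod_hom A M M. \<exists>y \<in> gmod_hom A M M. \<exists>u \<in> gmod_hom A M M.
     \<forall>x \<in> carrier M. d (u x) \<oplus>\<^bsub>M\<^esub> (y (u x) \<ominus>\<^bsub>M\<^esub> d (d' (y (u x)))) = x \<and>
       u (d x \<oplus>\<^bsub>M\<^esub> (y x \<ominus>\<^bsub>M\<^esub> d (d' (y x)))) = x)"

text \<open>The module version of the passage to corners: an endomorphism \<open>d\<close> of the
  retract is extended to \<open>D\<close> by the identity on the kernel of \<open>g\<close>, and a
  solution for the extensions is compressed by \<open>g\<close> and \<open>h\<close>.\<close>

lemma sr1_retract:
  assumes "graded_module A M" "graded_module A N"
    and g: "g \<in> gmod_hom A M N" and h: "h \<in> gmod_hom A N M"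
    and gh: "\<And>z. z \<in> carrier N \<Longrightarrow> g (h z) = z" and sr: "sr1 A M"
  shows "sr1 A N"
  unfolding sr1_def
proof (intro ballI)
  interpret M: graded_module A M by fact
  interpret N: graded_module A N by fact
  interpret MM: gmod_pair A M M ..
  interpret MN: gmod_pair A M N ..
  interpret NM: gmod_pair A N M ..
  interpret NN: gmod_pair A N N ..
  fix d d' assume d: "d \<in> gmod_hom A N N" and d': "d' \<in> gmod_hom A N N"
  define D where "D x = h (d (g x)) \<oplus>\<^bsub>M\<^esub> (x \<ominus>\<^bsub>M\<^esub> h (g x))" for x
  define D' where "D' x = h (d' (g x)) \<oplus>\<^bsub>M\<^esub> (x \<ominus>\<^bsub>M\<^esub> h (g x))" for x
  have D: "D \<in> gmod_hom A M M" and D': "D' \<in> gmod_hom A M M"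
    unfolding D_def D'_def
    by (intro MM.hom_sum MM.hom_diff gmod_hom_id gmod_hom_comp[OF g h]
        gmod_hom_comp[OF gmod_hom_comp[OF g d] h] gmod_hom_comp[OF gmod_hom_comp[OF g d'] h])+
  obtain Y U where Y: "Y \<in> gmod_hom A M M" and U: "U \<in> gmod_hom A M M"
    and TU: "\<And>x. x \<in> carrier M \<Longrightarrow> D (U x) \<oplus>\<^bsub>M\<^esub> (Y (U x) \<ominus>\<^bsub>M\<^esub> D (D' (Y (U x)))) = x"
    and UT: "\<And>x. x \<in> carrier M \<Longrightarrow> U (D x \<oplus>\<^bsub>M\<^esub> (Y x \<ominus>\<^bsub>M\<^esub> D (D' (Y x)))) = x"
    using sr D D' unfolding sr1_def by blast
  define T where "T x = D x \<oplus>\<^bsub>M\<^esub> (Y x \<ominus>\<^bsub>M\<^esub> D (D' (Y x)))" for x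
  note cl [simp] = gmod_hom_closed[OF g] gmod_hom_closed[OF h] gmod_hom_closed[OF d] gmod_hom_closed[OF d']
    gmod_hom_closed[OF D] gmod_hom_closed[OF D'] gmod_hom_closed[OF Y] gmod_hom_closed[OF U]
  note dist = gmod_hom_add[OF g] gmod_hom_add[OF h] MN.hom_minus_distrib[OF g] NM.hom_minus_distrib[OF h]
  have gD: "g (D x) = d (g x)" "g (D' x) = d' (g x)" if "x \<in> carrier M" for x
    using that N.diff_self[of "g x"] by (simp_all add: D_def D'_def dist gh)
  \<comment> \<open>Both extensions are the identity on the kernel of \<open>g\<close>, so the
    defect \<open>1 - D D'\<close> is concentrated on the retract, where it is
    \<open>1 - d d'\<close>.\<close>
  have defect: "w \<ominus>\<^bsub>M\<^esub> D (D' w) = h (g w \<ominus>\<^bsub>N\<^esub> d (d' (g w)))" if w: "w \<in> carrier M" for w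
  proof -
    have "D' w \<ominus>\<^bsub>M\<^esub> h (d' (g w)) = w \<ominus>\<^bsub>M\<^esub> h (g w)"
      unfolding D'_def using w by (simp add: M.add_diff_cancel)
    then have "D (D' w) = h (d (d' (g w))) \<oplus>\<^bsub>M\<^esub> (w \<ominus>\<^bsub>M\<^esub> h (g w))"
      using w gD by (simp add: D_def[of "D' w"])
    then show ?thesis
      using w by (simp add: dist M.diff_add_diff)
  qed
  have gT: "g (T w) = d (g w) \<oplus>\<^bsub>N\<^esub> (g (Y w) \<ominus>\<^bsub>N\<^esub> d (d' (g (Y w))))" if "w \<in> carrier M" for w
    using that by (simp add: T_def defect gmod_hom_add[OF g] gD gh)
  have Tcl [simp]: "T w \<in> carrier M" if "w \<in> carrier M" for w using that by (simp add: T_def)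
  \<comment> \<open>\<open>T\<close> does not change the component in the kernel of
    \<open>g\<close>. Hence \<open>T\<close> and its inverse preserve the image of \<open>h\<close>,
    and compressing the inverse inverts the compression of \<open>T\<close>.\<close>
  have hgT: "T w \<ominus>\<^bsub>M\<^esub> h (g (T w)) = w \<ominus>\<^bsub>M\<^esub> h (g w)" if w: "w \<in> carrier M" for w
  proof -
    have "T w = h (d (g w)) \<oplus>\<^bsub>M\<^esub> (w \<ominus>\<^bsub>M\<^esub> h (g w)) \<oplus>\<^bsub>M\<^esub> h (g (Y w) \<ominus>\<^bsub>N\<^esub> d (d' (g (Y w))))"
      using w by (simp add: T_def defect) (simp add: D_def)
    also have "\<dots> = h (g (T w)) \<oplus>\<^bsub>M\<^esub> (w \<ominus>\<^bsub>M\<^esub> h (g w))"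
      using w by (simp add: gT gmod_hom_add[OF h] M.a_ac)
    finally show ?thesis
      using w M.add_diff_cancel[of "h (g (T w))" "w \<ominus>\<^bsub>M\<^esub> h (g w)"] by simp
  qed
  define y where "y z = g (Y (h z))" for z
  define u where "u z = g (U (h z))" for z
  have y: "y \<in> gmod_hom A N N" and u: "u \<in> gmod_hom A N N"
    unfolding y_def u_def by (intro gmod_hom_comp[OF gmod_hom_comp[OF h Y] g] gmod_hom_comp[OF gmod_hom_comp[OF h U] g])+
  have t: "d z \<oplus>\<^bsub>N\<^esub> (y z \<ominus>\<^bsub>N\<^esub> d (d' (y z))) = g (T (h z))" if "z \<in> carrier N" for z
    using that by (simp add: gT y_def gh)
  have fix_iff: "h (g x) = x" if "x \<ominus>\<^bsub>M\<^esub> h (g x) = \<zero>\<^bsub>M\<^esub>" "x \<in> carrier M" for x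
    using M.diff_eq_zeroD[OF that(1)] that(2) by simp
  have zz: "h z \<ominus>\<^bsub>M\<^esub> h (g (h z)) = \<zero>\<^bsub>M\<^esub>" if "z \<in> carrier N" for z
    using that by (simp add: gh M.diff_self)
  show "\<exists>y\<in>gmod_hom A N N. \<exists>u\<in>gmod_hom A N N. \<forall>x\<in>carrier N.
      d (u x) \<oplus>\<^bsub>N\<^esub> (y (u x) \<ominus>\<^bsub>N\<^esub> d (d' (y (u x)))) = x \<and> u (d x \<oplus>\<^bsub>N\<^esub> (y x \<ominus>\<^bsub>N\<^esub> d (d' (y x)))) = x"
  proof (rule bexI[OF _ y], rule bexI[OF _ u], intro ballI conjI)
    fix z assume z: "z \<in> carrier N"
    have uz: "u z \<in> carrier N" using z by (simp add: u_def)
    let ?w = "U (h z)"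
    have w: "?w \<in> carrier M" and Tw: "T ?w = h z" using z TU[of "h z"] by (simp_all add: T_def)
    have "h (g ?w) = ?w" using hgT[OF w] zz[OF z] by (intro fix_iff w) (simp add: Tw)
    then have "g (T (h (u z))) = z" using Tw gh[OF z] by (simp add: u_def)
    then show "d (u z) \<oplus>\<^bsub>N\<^esub> (y (u z) \<ominus>\<^bsub>N\<^esub> d (d' (y (u z)))) = z" using t[OF uz] by simp
    have "h (g (T (h z))) = T (h z)" using hgT[of "h z"] zz[OF z] z by (intro fix_iff) simp_all
    then have "u (g (T (h z))) = z" using UT[of "h z"] z gh[OF z] by (simp add: u_def T_def)
    then show "u (d z \<oplus>\<^bsub>N\<^esub> (y z \<ominus>\<^bsub>N\<^esub> d (d' (y z)))) = z" using t[OF z] by simp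
  qed
qed

section \<open>Direct sums of graded modules and cancellation\<close>

lemma gmod_sum_simps [simp]:
  "carrier (gmod_sum M N) = carrier M \<times> carrier N" "\<zero>\<^bsub>gmod_sum M N\<^esub> = (\<zero>\<^bsub>M\<^esub>, \<zero>\<^bsub>N\<^esub>)"
  "(x, y) \<oplus>\<^bsub>gmod_sum M N\<^esub> (x', y') = (x \<oplus>\<^bsub>M\<^esub> x', y \<oplus>\<^bsub>N\<^esub> y')"
  "a \<odot>\<^bsub>gmod_sum M N\<^esub> (x, y) = (a \<odot>\<^bsub>M\<^esub> x, a \<odot>\<^bsub>N\<^esub> y)" "grade (gmod_sum M N) n = grade M n \<times> grade N n"
  by (simp_all add: gmod_sum_def)

lemma abelian_group_sum:
  assumes "abelian_group M" "abelian_group N"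
  shows "abelian_group (gmod_sum M N)"
proof -
  interpret M: abelian_group M by fact
  interpret N: abelian_group N by fact
  show ?thesis
  proof (rule abelian_groupI)
    fix x assume "x \<in> carrier (gmod_sum M N)"
    then show "\<exists>y\<in>carrier (gmod_sum M N). y \<oplus>\<^bsub>gmod_sum M N\<^esub> x = \<zero>\<^bsub>gmod_sum M N\<^esub>"
      by (cases x) (auto intro!: bexI[of _ "(\<ominus>\<^bsub>M\<^esub> fst x, \<ominus>\<^bsub>N\<^esub> snd x)"] simp: M.l_neg N.l_neg)
  qed (auto simp: M.a_ac N.a_ac)
qed

lemma finsum_sum:
  assumes "abelian_group M" "abelian_group N"
    and "\<And>i. i \<in> S \<Longrightarrow> f i \<in> carrier M \<times> carrier N"
  shows "finsum (gmod_sum M N) f S = (finsum M (\<lambda>i. fst (f i)) S, finsum N (\<lambda>i. snd (f i)) S)"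
proof -
  interpret M: abelian_group M by fact
  interpret N: abelian_group N by fact
  interpret S: abelian_group "gmod_sum M N" by (rule abelian_group_sum) fact+
  show ?thesis
    using assms(3)
  proof (induction S rule: infinite_finite_induct)
    case (insert x F)
    then have "f \<in> F \<rightarrow> carrier M \<times> carrier N" "f x \<in> carrier M \<times> carrier N"
      "(\<lambda>i. fst (f i)) \<in> F \<rightarrow> carrier M" "(\<lambda>i. snd (f i)) \<in> F \<rightarrow> carrier N" by fastforce+
    with insert show ?case by (cases "f x") auto
  qed auto
qed

lemma graded_module_sum:
  assumes "graded_module A M" "graded_module A N"
  shows "graded_module A (gmod_sum M N)"
proof -
  interpret M: graded_module A M by fact
  interpret N: graded_module A N by fact
  interpret S: abelian_group "gmod_sum M N" by (rule abelian_group_sum) unfold_locales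
  have fs: "finsum (gmod_sum M N) c S = (finsum M (\<lambda>i. fst (c i)) S, finsum N (\<lambda>i. snd (c i)) S)"
    if "\<forall>n. c n \<in> grade (gmod_sum M N) n" for c S
    by (rule finsum_sum) (use that M.abelian_group_axioms N.abelian_group_axioms
      in \<open>auto simp: mem_Times_iff intro: M.grade_closed N.grade_closed\<close>)
  show ?thesis
  proof unfold_locales
    show "internal_direct_sum (gmod_sum M N) (grade (gmod_sum M N))"
    proof (rule internal_direct_sumI[OF S.abelian_group_axioms])
      fix n
      show "additive_subgroup (grade (gmod_sum M N) n) (gmod_sum M N)"
      proof (intro additive_subgroup.intro subgroup.intro)
        fix x assume x: "x \<in> grade (gmod_sum M N) n"
        then obtain p q where pq: "x = (p, q)" "p \<in> grade M n" "q \<in> grade N n" by auto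
        have "\<ominus>\<^bsub>gmod_sum M N\<^esub> x = (\<ominus>\<^bsub>M\<^esub> p, \<ominus>\<^bsub>N\<^esub> q)"
          using pq by (intro S.minus_equality) (auto simp: M.l_neg N.l_neg M.grade_closed N.grade_closed)
        then show "inv\<^bsub>add_monoid (gmod_sum M N)\<^esub> x \<in> grade (gmod_sum M N) n"
          using pq unfolding a_inv_def[symmetric] by (simp add: M.grade_minus N.grade_minus)
      qed (auto intro: M.grade_closed N.grade_closed M.grade_add N.grade_add)
    next
      fix x assume "x \<in> carrier (gmod_sum M N)"
      then obtain p q where x: "x = (p, q)" "p \<in> carrier M" "q \<in> carrier N" by auto
      obtain S c where c: "finite S" "\<And>n. c n \<in> grade M n" "\<And>n. n \<notin> S \<Longrightarrow> c n = \<zero>\<^bsub>M\<^esub>" "p = finsum M c S"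
        using M.decompose[OF x(2)] by metis
      obtain S' c' where c': "finite S'" "\<And>n. c' n \<in> grade N n" "\<And>n. n \<notin> S' \<Longrightarrow> c' n = \<zero>\<^bsub>N\<^esub>"
        "q = finsum N c' S'" using N.decompose[OF x(3)] by metis
      have "finsum M c (S \<union> S') = p" unfolding c(4)
        using c c' by (intro M.finsum_superset) (auto intro: M.grade_closed)
      moreover have "finsum N c' (S \<union> S') = q" unfolding c'(4)
        using c c' by (intro N.finsum_superset) (auto intro: N.grade_closed)
      ultimately show "\<exists>c S. finite S \<and> (\<forall>n. c n \<in> grade (gmod_sum M N) n) \<and>
          (\<forall>n. n \<notin> S \<longrightarrow> c n = \<zero>\<^bsub>gmod_sum M N\<^esub>) \<and> x = finsum (gmod_sum M N) c S"
        using c c' x fs[of "\<lambda>n. (c n, c' n)"]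
        by (intro exI[of _ "\<lambda>n. (c n, c' n)"] exI[of _ "S \<union> S'"]) simp
    next
      fix c c' and S :: "int set"
      assume *: "finite S" "\<forall>n. c n \<in> grade (gmod_sum M N) n" "\<forall>n. c' n \<in> grade (gmod_sum M N) n"
        "\<forall>n. n \<notin> S \<longrightarrow> c n = \<zero>\<^bsub>gmod_sum M N\<^esub>" "\<forall>n. n \<notin> S \<longrightarrow> c' n = \<zero>\<^bsub>gmod_sum M N\<^esub>"
        "finsum (gmod_sum M N) c S = finsum (gmod_sum M N) c' S"
      have "(\<lambda>n. fst (c n)) = (\<lambda>n. fst (c' n))"
        by (rule M.decompose_unique[of S]) (use * fs[of c] fs[of c'] in \<open>auto simp: mem_Times_iff\<close>)
      moreover have "(\<lambda>n. snd (c n)) = (\<lambda>n. snd (c' n))"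
        by (rule N.decompose_unique[of S]) (use * fs[of c] fs[of c'] in \<open>auto simp: mem_Times_iff\<close>)
      ultimately show "c = c'" by (simp add: fun_eq_iff prod_eq_iff)
    qed
  qed (auto simp: M.smult_closed N.smult_closed M.smult_l_distr N.smult_l_distr M.smult_r_distr N.smult_r_distr
      M.smult_assoc N.smult_assoc M.smult_grade N.smult_grade)
qed

lemma fst_hom: "fst \<in> gmod_hom A (gmod_sum M N) M"
  and snd_hom: "snd \<in> gmod_hom A (gmod_sum M N) N"
  by (rule gmod_homI; auto)+

lemma
  assumes "graded_module A M" "graded_module A N"
  shows inl_hom: "(\<lambda>x. (x, \<zero>\<^bsub>N\<^esub>)) \<in> gmod_hom A M (gmod_sum M N)"
    and inr_hom: "(\<lambda>x. (\<zero>\<^bsub>M\<^esub>, x)) \<in> gmod_hom A N (gmod_sum M N)"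
proof -
  interpret M: graded_module A M by fact
  interpret N: graded_module A N by fact
  show "(\<lambda>x. (x, \<zero>\<^bsub>N\<^esub>)) \<in> gmod_hom A M (gmod_sum M N)" "(\<lambda>x. (\<zero>\<^bsub>M\<^esub>, x)) \<in> gmod_hom A N (gmod_sum M N)"
    by (rule gmod_homI; simp add: M.smult_zero N.smult_zero)+
qed

text \<open>Write the isomorphism as a matrix with rows \<open>(a, b)\<close> and
  \<open>(c, d)\<close>, and the second column of its inverse as \<open>(b', d')\<close>; then
  \<open>c b' = 1 - d d'\<close>. Stable range one supplies \<open>y\<close> with
  \<open>t = d + c b' y\<close> invertible, so a shear by \<open>b' y\<close> turns the corner
  \<open>d\<close> into a pivot, and eliminating it leaves an isomorphism from \<open>P\<close> to
  \<open>Q\<close>.\<close>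

theorem cancel_sr1:
  assumes "graded_module A P" "graded_module A Q" "graded_module A Z"
    and iso: "gmod_isomorphic A (gmod_sum P Z) (gmod_sum Q Z)" and sr: "sr1 A Z"
  shows "gmod_isomorphic A P Q"
proof -
  interpret P: graded_module A P by fact
  interpret Q: graded_module A Q by fact
  interpret Z: graded_module A Z by fact
  interpret S: graded_module A "gmod_sum P Z" by (rule graded_module_sum) fact+
  interpret S': graded_module A "gmod_sum Q Z" by (rule graded_module_sum) fact+
  interpret SS': gmod_pair A "gmod_sum P Z" "gmod_sum Q Z" ..
  interpret PP: gmod_pair A P P ..
  interpret PQ: gmod_pair A P Q ..
  interpret PZ: gmod_pair A P Z ..
  interpret ZZ: gmod_pair A Z Z ..
  obtain f where f: "f \<in> gmod_hom A (gmod_sum P Z) (gmod_sum Q Z)"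
    and bij: "bij_betw f (carrier P \<times> carrier Z) (carrier Q \<times> carrier Z)"
    using iso by (auto simp: gmod_isomorphic_def)
  define f' where "f' = inv_into (carrier P \<times> carrier Z) f"
  have f': "f' \<in> gmod_hom A (gmod_sum Q Z) (gmod_sum P Z)"
    using SS'.hom_inverse[OF f] bij by (simp add: f'_def)
  have ff': "f (f' w) = w" if "w \<in> carrier Q \<times> carrier Z" for w
    using that bij by (simp add: f'_def bij_betw_def f_inv_into_f)
  define a where "a p = fst (f (p, \<zero>\<^bsub>Z\<^esub>))" for p
  define c where "c p = snd (f (p, \<zero>\<^bsub>Z\<^esub>))" for p
  define b where "b z = fst (f (\<zero>\<^bsub>P\<^esub>, z))" for z
  define d where "d z = snd (f (\<zero>\<^bsub>P\<^esub>, z))" for z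
  define b' where "b' z = fst (f' (\<zero>\<^bsub>Q\<^esub>, z))" for z
  define d' where "d' z = snd (f' (\<zero>\<^bsub>Q\<^esub>, z))" for z
  have a: "a \<in> gmod_hom A P Q" unfolding a_def
    by (rule gmod_hom_comp[OF gmod_hom_comp[OF inl_hom[OF assms(1,3)] f] fst_hom])
  have c: "c \<in> gmod_hom A P Z" unfolding c_def
    by (rule gmod_hom_comp[OF gmod_hom_comp[OF inl_hom[OF assms(1,3)] f] snd_hom])
  have b: "b \<in> gmod_hom A Z Q" unfolding b_def
    by (rule gmod_hom_comp[OF gmod_hom_comp[OF inr_hom[OF assms(1,3)] f] fst_hom])
  have d: "d \<in> gmod_hom A Z Z" unfolding d_def
    by (rule gmod_hom_comp[OF gmod_hom_comp[OF inr_hom[OF assms(1,3)] f] snd_hom])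
  have b': "b' \<in> gmod_hom A Z P" unfolding b'_def
    by (rule gmod_hom_comp[OF gmod_hom_comp[OF inr_hom[OF assms(2,3)] f'] fst_hom])
  have d': "d' \<in> gmod_hom A Z Z" unfolding d'_def
    by (rule gmod_hom_comp[OF gmod_hom_comp[OF inr_hom[OF assms(2,3)] f'] snd_hom])
  note cl [simp] = gmod_hom_closed[OF a] gmod_hom_closed[OF b] gmod_hom_closed[OF c] gmod_hom_closed[OF d]
    gmod_hom_closed[OF b'] gmod_hom_closed[OF d']
  have f_eq: "f (p, z) = (a p \<oplus>\<^bsub>Q\<^esub> b z, c p \<oplus>\<^bsub>Z\<^esub> d z)" if "p \<in> carrier P" "z \<in> carrier Z" for p z
  proof -
    have "f (p, z) = f (p, \<zero>\<^bsub>Z\<^esub>) \<oplus>\<^bsub>gmod_sum Q Z\<^esub> f (\<zero>\<^bsub>P\<^esub>, z)"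
      using gmod_hom_add[OF f, of "(p, \<zero>\<^bsub>Z\<^esub>)" "(\<zero>\<^bsub>P\<^esub>, z)"] that by simp
    also have "\<dots> = (a p, c p) \<oplus>\<^bsub>gmod_sum Q Z\<^esub> (b z, d z)" by (simp add: a_def b_def c_def d_def)
    finally show ?thesis by simp
  qed
  have cb': "c (b' z) = z \<ominus>\<^bsub>Z\<^esub> d (d' z)" if z: "z \<in> carrier Z" for z
  proof -
    have "f (b' z, d' z) = (\<zero>\<^bsub>Q\<^esub>, z)" using ff'[of "(\<zero>\<^bsub>Q\<^esub>, z)"] z by (simp add: b'_def d'_def)
    then have "z = d (d' z) \<oplus>\<^bsub>Z\<^esub> c (b' z)" using z by (simp add: f_eq Z.a_comm)
    then show ?thesis using Z.add_diff_cancel[of "d (d' z)" "c (b' z)"] z by simp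
  qed
  obtain y u where y: "y \<in> gmod_hom A Z Z" and u: "u \<in> gmod_hom A Z Z"
    and tu: "\<And>z. z \<in> carrier Z \<Longrightarrow> d (u z) \<oplus>\<^bsub>Z\<^esub> (y (u z) \<ominus>\<^bsub>Z\<^esub> d (d' (y (u z)))) = z"
    and ut: "\<And>z. z \<in> carrier Z \<Longrightarrow> u (d z \<oplus>\<^bsub>Z\<^esub> (y z \<ominus>\<^bsub>Z\<^esub> d (d' (y z)))) = z"
    using sr d d' unfolding sr1_def by blast
  note cl' [simp] = gmod_hom_closed[OF y] gmod_hom_closed[OF u]
  define t where "t z = d z \<oplus>\<^bsub>Z\<^esub> c (b' (y z))" for z
  have tu: "t (u z) = z" and ut: "u (t z) = z" if "z \<in> carrier Z" for z
    using tu[OF that] ut[OF that] that by (simp_all add: t_def cb')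
  \<comment> \<open>\<open>k p\<close> solves \<open>c p + t (k p) = 0\<close>, and
    \<open>s p\<close> applies the shear. Thus \<open>p \<mapsto> (s p, k p)\<close> parametrises
    the preimage of \<open>Q\<close> under \<open>f\<close>.\<close>
  define k where "k p = \<ominus>\<^bsub>Z\<^esub> u (c p)" for p
  define s where "s p = p \<oplus>\<^bsub>P\<^esub> b' (y (k p))" for p
  have k: "k \<in> gmod_hom A P Z" unfolding k_def by (intro PZ.hom_minus gmod_hom_comp[OF c u])
  have s: "s \<in> gmod_hom A P P" unfolding s_def
    by (intro PP.hom_sum gmod_hom_id gmod_hom_comp[OF gmod_hom_comp[OF k y] b'])
  note cl'' [simp] = gmod_hom_closed[OF k] gmod_hom_closed[OF s]
  define h where "h p = a (s p) \<oplus>\<^bsub>Q\<^esub> b (k p)" for p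
  have h: "h \<in> gmod_hom A P Q" unfolding h_def
    by (intro PQ.hom_sum gmod_hom_comp[OF s a] gmod_hom_comp[OF k b])
  have t_minus: "t (\<ominus>\<^bsub>Z\<^esub> z) = \<ominus>\<^bsub>Z\<^esub> t z" if "z \<in> carrier Z" for z
  proof -
    have "t \<in> gmod_hom A Z Z" unfolding t_def
      by (intro ZZ.hom_sum d gmod_hom_comp[OF gmod_hom_comp[OF y b'] c])
    then show ?thesis using ZZ.hom_uminus that by blast
  qed
  have f_h: "f (s p, k p) = (h p, \<zero>\<^bsub>Z\<^esub>)" if p: "p \<in> carrier P" for p
  proof -
    have "c (s p) \<oplus>\<^bsub>Z\<^esub> d (k p) = c p \<oplus>\<^bsub>Z\<^esub> t (k p)"
      using p by (simp add: s_def gmod_hom_add[OF c] t_def Z.a_ac)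
    also have "t (k p) = \<ominus>\<^bsub>Z\<^esub> c p" using p by (simp add: k_def t_minus tu)
    finally show ?thesis using p by (simp add: f_eq h_def Z.r_neg)
  qed
  have "inj_on h (carrier P)"
  proof (rule inj_onI)
    fix p q assume pq: "p \<in> carrier P" "q \<in> carrier P" "h p = h q"
    then have "f (s p, k p) = f (s q, k q)" using f_h by simp
    then have "(s p, k p) = (s q, k q)"
      using bij pq by (intro inj_onD[of f "carrier P \<times> carrier Z"]) (auto simp: bij_betw_def)
    then have "s p = s q" "k p = k q" by simp_all
    then show "p = q" using pq by (simp add: s_def)
  qed
  moreover have "q \<in> h ` carrier P" if q: "q \<in> carrier Q" for q
  proof -
    obtain p z where pz: "p \<in> carrier P" "z \<in> carrier Z" "f (p, z) = (q, \<zero>\<^bsub>Z\<^esub>)"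
    proof -
      have "(q, \<zero>\<^bsub>Z\<^esub>) \<in> f ` (carrier P \<times> carrier Z)" using bij q by (simp add: bij_betw_def)
      then show ?thesis using that by force
    qed
    \<comment> \<open>Undoing the shear recovers the parameter from a point of that
      preimage.\<close>
    define p' where "p' = p \<ominus>\<^bsub>P\<^esub> b' (y z)"
    have p': "p' \<in> carrier P" using pz by (simp add: p'_def)
    have p: "p = p' \<oplus>\<^bsub>P\<^esub> b' (y z)"
      using pz by (simp add: p'_def P.minus_eq P.a_assoc P.l_neg)
    have "c p' \<oplus>\<^bsub>Z\<^esub> t z = \<zero>\<^bsub>Z\<^esub>"
      using pz p' by (simp add: f_eq p gmod_hom_add[OF c] t_def Z.a_ac)
    then have "t z = \<ominus>\<^bsub>Z\<^esub> c p'"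
      using pz p' Z.minus_equality[of "t z" "c p'"] by (simp add: t_def Z.a_comm)
    then have "z = u (\<ominus>\<^bsub>Z\<^esub> c p')" using ut[OF pz(2)] by simp
    then have "k p' = z" using p' by (simp add: k_def ZZ.hom_uminus[OF u])
    then have "h p' = q" using f_h[OF p'] pz(3) p by (simp add: s_def)
    then show ?thesis using p' by blast
  qed
  ultimately have "bij_betw h (carrier P) (carrier Q)"
    by (auto simp: bij_betw_def gmod_hom_closed[OF h])
  then show ?thesis using h unfolding gmod_isomorphic_def by blast
qed

section \<open>Isomorphism as an equivalence relation\<close>

lemma gmod_isomorphic_refl: "gmod_isomorphic A M M"
  unfolding gmod_isomorphic_def using gmod_hom_id by (intro bexI[of _ "\<lambda>x. x"]) (auto simp: bij_betw_def)

lemma gmod_isomorphic_sym: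
  assumes "graded_module A M" "graded_module A N" "gmod_isomorphic A M N"
  shows "gmod_isomorphic A N M"
proof -
  interpret M: graded_module A M by fact
  interpret N: graded_module A N by fact
  interpret gmod_pair A M N ..
  obtain f where "f \<in> gmod_hom A M N" "bij_betw f (carrier M) (carrier N)"
    using assms(3) by (auto simp: gmod_isomorphic_def)
  then show ?thesis
    unfolding gmod_isomorphic_def using hom_inverse bij_betw_inv_into by blast
qed

lemma gmod_isomorphic_trans:
  assumes "gmod_isomorphic A M N" "gmod_isomorphic A N L"
  shows "gmod_isomorphic A M L"
proof -
  obtain f g where "f \<in> gmod_hom A M N" "bij_betw f (carrier M) (carrier N)"
    "g \<in> gmod_hom A N L" "bij_betw g (carrier N) (carrier L)"
    using assms by (auto simp: gmod_isomorphic_def)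
  then show ?thesis
    unfolding gmod_isomorphic_def using gmod_hom_comp bij_betw_trans[of f _ _ g]
    by (intro bexI[of _ "\<lambda>x. g (f x)"]) (auto simp: comp_def)
qed

lemma gmod_isomorphic_sum_right:
  assumes "gmod_isomorphic A N N'"
  shows "gmod_isomorphic A (gmod_sum M N) (gmod_sum M N')"
proof -
  obtain f where f: "f \<in> gmod_hom A N N'" "bij_betw f (carrier N) (carrier N')"
    using assms by (auto simp: gmod_isomorphic_def)
  have "(\<lambda>(x, y). (x, f y)) \<in> gmod_hom A (gmod_sum M N) (gmod_sum M N')"
    by (rule gmod_homI) (auto simp: gmod_hom_closed[OF f(1)] gmod_hom_add[OF f(1)] gmod_hom_smult[OF f(1)]
        gmod_hom_grade[OF f(1)])
  moreover have "bij_betw (\<lambda>(x, y). (x, f y)) (carrier M \<times> carrier N) (carrier M \<times> carrier N')"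
    using f(2) by (force simp: bij_betw_def inj_on_def image_iff)
  ultimately show ?thesis unfolding gmod_isomorphic_def by auto
qed

section \<open>Copies of graded modules and biproducts\<close>

text \<open>Transport along an injection \<open>f\<close> with left inverse \<open>g\<close>. A
  direct sum lives on a product type, whereas the members of \<open>fg_proj_gmods\<close> live on
  \<open>nat \<Rightarrow> 'a\<close>.\<close>

definition gmod_copy :: "('b \<Rightarrow> 'c) \<Rightarrow> ('c \<Rightarrow> 'b) \<Rightarrow> ('a, 'b) gmodule \<Rightarrow> ('a, 'c) gmodule" where
  "gmod_copy f g M =
     \<lparr>carrier = f ` carrier M, monoid.mult = undefined, one = undefined, ring.zero = f \<zero>\<^bsub>M\<^esub>,
      add = (\<lambda>x y. f (g x \<oplus>\<^bsub>M\<^esub> g y)), smult = (\<lambda>a x. f (a \<odot>\<^bsub>M\<^esub> g x)), grade = (\<lambda>n. f ` grade M n)\<rparr>"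

lemma graded_module_copy:
  assumes "graded_module A M" and gf: "\<And>x. g (f x) = x"
  shows "graded_module A (gmod_copy f g M)"
proof -
  interpret M: graded_module A M by fact
  let ?N = "gmod_copy f g M"
  have N: "carrier ?N = f ` carrier M" "\<zero>\<^bsub>?N\<^esub> = f \<zero>\<^bsub>M\<^esub>" "f x \<oplus>\<^bsub>?N\<^esub> f y = f (x \<oplus>\<^bsub>M\<^esub> y)"
    "a \<odot>\<^bsub>?N\<^esub> f x = f (a \<odot>\<^bsub>M\<^esub> x)" "grade ?N n = f ` grade M n" for x y a n
    by (simp_all add: gmod_copy_def gf)
  have inj: "f x = f y \<longleftrightarrow> x = y" for x y using gf by metis
  interpret N: abelian_group ?N
    by (rule abelian_groupI)
      (auto simp: N M.a_ac inj intro!: imageI bexI[of _ "\<ominus>\<^bsub>M\<^esub> _"] M.l_neg)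
  have fs: "finsum ?N c S = f (finsum M (\<lambda>i. g (c i)) S)" if "\<forall>n. c n \<in> f ` carrier M" for c S
  proof (induction S rule: infinite_finite_induct)
    case (insert x F)
    have "c \<in> F \<rightarrow> carrier ?N" "c x \<in> carrier ?N" using that by (auto simp: N)
    moreover have gc: "g (c i) \<in> carrier M" "f (g (c i)) = c i" for i
      using that gf by (metis imageE)+
    moreover have "c x \<oplus>\<^bsub>?N\<^esub> f z = f (g (c x) \<oplus>\<^bsub>M\<^esub> z)" for z
      using N(3)[of "g (c x)" z] gc by simp
    ultimately show ?case using insert by (simp add: Pi_iff)
  qed (simp_all add: N)
  have grade_carrier: "grade ?N n \<subseteq> f ` carrier M" for n using M.grade_closed by (auto simp: N)
  show ?thesis
  proof unfold_locales
    show "internal_direct_sum ?N (grade ?N)"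
    proof (rule internal_direct_sumI[OF N.abelian_group_axioms])
      fix n
      show "additive_subgroup (grade ?N n) ?N"
      proof (intro additive_subgroup.intro subgroup.intro)
        fix x assume "x \<in> grade ?N n"
        then obtain p where p: "x = f p" "p \<in> grade M n" by (auto simp: N)
        have "\<ominus>\<^bsub>?N\<^esub> x = f (\<ominus>\<^bsub>M\<^esub> p)"
          using p by (intro N.minus_equality) (auto simp: N M.l_neg M.grade_closed)
        then show "inv\<^bsub>add_monoid ?N\<^esub> x \<in> grade ?N n"
          using p unfolding a_inv_def[symmetric] by (simp add: N M.grade_minus)
      qed (use grade_carrier in \<open>auto simp: N intro: M.grade_add\<close>)
    next
      fix x assume "x \<in> carrier ?N"
      then obtain p where p: "x = f p" "p \<in> carrier M" by (auto simp: N)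
      obtain S c where c: "finite S" "\<And>n. c n \<in> grade M n" "\<And>n. n \<notin> S \<Longrightarrow> c n = \<zero>\<^bsub>M\<^esub>" "p = finsum M c S"
        using M.decompose[OF p(2)] by metis
      then show "\<exists>c S. finite S \<and> (\<forall>n. c n \<in> grade ?N n) \<and> (\<forall>n. n \<notin> S \<longrightarrow> c n = \<zero>\<^bsub>?N\<^esub>) \<and> x = finsum ?N c S"
        using fs[of "\<lambda>n. f (c n)"] p M.grade_closed[OF c(2)]
        by (intro exI[of _ "\<lambda>n. f (c n)"] exI[of _ S]) (auto simp: N gf)
    next
      fix c c' and S :: "int set"
      assume *: "finite S" "\<forall>n. c n \<in> grade ?N n" "\<forall>n. c' n \<in> grade ?N n" "\<forall>n. n \<notin> S \<longrightarrow> c n = \<zero>\<^bsub>?N\<^esub>"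
        "\<forall>n. n \<notin> S \<longrightarrow> c' n = \<zero>\<^bsub>?N\<^esub>" "finsum ?N c S = finsum ?N c' S"
      have cN: "\<forall>n. c n \<in> f ` carrier M" "\<forall>n. c' n \<in> f ` carrier M" using *(2,3) grade_carrier by blast+
      have gc: "g (c n) \<in> grade M n" "g (c' n) \<in> grade M n" "f (g (c n)) = c n" "f (g (c' n)) = c' n" for n
        using *(2,3) gf by (metis (no_types, lifting) N(5) imageE)+
      have "(\<lambda>n. g (c n)) = (\<lambda>n. g (c' n))"
        by (rule M.decompose_unique[of S]) (use * gc fs[OF cN(1)] fs[OF cN(2)] in \<open>auto simp: N gf inj\<close>)
      then show "c = c'" using gc(3,4) by (metis ext)
    qed
  qed (auto simp: N M.smult_closed M.smult_l_distr M.smult_r_distr M.smult_assoc intro!: imageI M.smult_grade)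
qed

lemma gmod_copy_hom:
  assumes gf: "\<And>x. g (f x) = x"
  shows "f \<in> gmod_hom A M (gmod_copy f g M)" "g \<in> gmod_hom A (gmod_copy f g M) M"
  by (auto intro!: gmod_homI simp: gmod_copy_def gf)

text \<open>By the identity \<open>i p + j q = 1\<close>, the images of \<open>P\<close> and
  \<open>Q\<close> generate \<open>M\<close>, and a map out of \<open>M\<close> is assembled from
  its restrictions along \<open>i\<close> and \<open>j\<close>. This carries unitality, finite
  generation and projectivity over to \<open>M\<close>.\<close>

locale gmod_biproduct = P: graded_module A P + Q: graded_module A Q + M: graded_module A M
  for A :: "'a gring" and P :: "('a, 'b) gmodule" and Q :: "('a, 'c) gmodule" and M :: "('a, 'd) gmodule" +
  fixes i j p q
  assumes i: "i \<in> gmod_hom A P M" and j: "j \<in> gmod_hom A Q M"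
    and p: "p \<in> gmod_hom A M P" and q: "q \<in> gmod_hom A M Q"
    and ip_jq: "x \<in> carrier M \<Longrightarrow> i (p x) \<oplus>\<^bsub>M\<^esub> j (q x) = x"
begin

lemma unital:
  assumes "unital_graded_module A P" "unital_graded_module A Q"
  shows "unital_graded_module A M"
proof unfold_locales
  let ?G = "\<lambda>N. generate (add_monoid N) {a \<odot>\<^bsub>N\<^esub> x | a x. a \<in> carrier A \<and> x \<in> carrier N}"
  have sub: "?G M \<subseteq> carrier M"
    using M.add.generate_incl[of "{a \<odot>\<^bsub>M\<^esub> x | a x. a \<in> carrier A \<and> x \<in> carrier M}"] M.smult_closed by auto
  have img: "f x \<in> ?G M"
    if N: "graded_module A N" and f: "f \<in> gmod_hom A N M" and x: "x \<in> ?G N"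
    for N :: "('a, 'n) gmodule" and f x
  proof -
    interpret N: graded_module A N by fact
    interpret gmod_pair A N M ..
    have subN: "?G N \<subseteq> carrier N"
      using N.add.generate_incl[of "{a \<odot>\<^bsub>N\<^esub> x | a x. a \<in> carrier A \<and> x \<in> carrier N}"] N.smult_closed by auto
    show ?thesis
      using x
    proof (induction rule: generate.induct)
      case one
      then show ?case using generate.one[of "add_monoid M"] by (simp add: hom_zero[OF f])
    next
      case (incl h)
      then have "f h \<in> {a \<odot>\<^bsub>M\<^esub> x | a x. a \<in> carrier A \<and> x \<in> carrier M}"
        using gmod_hom_smult[OF f] gmod_hom_closed[OF f] by blast
      then show ?case by (rule generate.incl)
    next
      case (inv h)
      then have "h \<in> carrier N" using N.smult_closed by auto
      then have "f (inv\<^bsub>add_monoid N\<^esub> h) = inv\<^bsub>add_monoid M\<^esub> (f h)"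
        using hom_uminus[OF f] by (simp add: a_inv_def)
      moreover have "inv\<^bsub>add_monoid M\<^esub> (f h) \<in> ?G M"
      proof (rule generate.inv)
        show "f h \<in> {a \<odot>\<^bsub>M\<^esub> x | a x. a \<in> carrier A \<and> x \<in> carrier M}"
          using inv gmod_hom_smult[OF f] gmod_hom_closed[OF f] by blast
      qed
      ultimately show ?case by simp
    next
      case (eng h1 h2)
      then have "f (h1 \<otimes>\<^bsub>add_monoid N\<^esub> h2) = f h1 \<otimes>\<^bsub>add_monoid M\<^esub> f h2"
        using gmod_hom_add[OF f] subN by auto
      then show ?case using generate.eng[OF eng.IH] by simp
    qed
  qed
  have "x \<in> ?G M" if x: "x \<in> carrier M" for x
  proof -
    have "i (p x) \<in> ?G M"
      by (rule img[OF P.graded_module_axioms i])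
        (use x gmod_hom_closed[OF p] unital_graded_module.unital[OF assms(1)] in simp)
    moreover have "j (q x) \<in> ?G M"
      by (rule img[OF Q.graded_module_axioms j])
        (use x gmod_hom_closed[OF q] unital_graded_module.unital[OF assms(2)] in simp)
    ultimately have "i (p x) \<otimes>\<^bsub>add_monoid M\<^esub> j (q x) \<in> ?G M" by (rule generate.eng)
    then show ?thesis using ip_jq[OF x] by simp
  qed
  with sub show "?G M = carrier M" by blast
qed

lemma submodule_preimage:
  assumes N: "graded_module A N" and f: "f \<in> gmod_hom A N M" and H: "submodule H A M"
  shows "submodule {x \<in> carrier N. f x \<in> H} A N"
proof -
  interpret N: graded_module A N by fact
  interpret gmod_pair A N M ..
  interpret H: submodule H A M by fact
  show ?thesis
  proof (intro submodule.intro subgroup.intro submodule_axioms.intro)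
    fix x assume x: "x \<in> {x \<in> carrier N. f x \<in> H}"
    then have "f (\<ominus>\<^bsub>N\<^esub> x) = \<ominus>\<^bsub>M\<^esub> f x" using hom_uminus[OF f] by auto
    moreover have "\<ominus>\<^bsub>M\<^esub> f x \<in> H" using x H.m_inv_closed by (simp add: a_inv_def)
    ultimately have "\<ominus>\<^bsub>N\<^esub> x \<in> {x \<in> carrier N. f x \<in> H}" using x by simp
    then show "inv\<^bsub>add_monoid N\<^esub> x \<in> {x \<in> carrier N. f x \<in> H}" by (simp add: a_inv_def)
  next
    show "\<one>\<^bsub>add_monoid N\<^esub> \<in> {x \<in> carrier N. f x \<in> H}"
      using H.one_closed hom_zero[OF f] by simp
  next
    fix x y assume "x \<in> {x \<in> carrier N. f x \<in> H}" "y \<in> {x \<in> carrier N. f x \<in> H}"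
    then show "x \<otimes>\<^bsub>add_monoid N\<^esub> y \<in> {x \<in> carrier N. f x \<in> H}"
      using H.m_closed gmod_hom_add[OF f] by simp
  qed (auto simp: gmod_hom_smult[OF f] N.smult_closed)
qed

lemma fin_gen:
  assumes "fin_gen_gmod A P" "fin_gen_gmod A Q"
  shows "fin_gen_gmod A M"
proof -
  obtain S where S: "finite S" "S \<subseteq> carrier P" "\<And>H. submodule H A P \<and> S \<subseteq> H \<Longrightarrow> H = carrier P"
    using assms(1) unfolding fin_gen_gmod_def by blast
  obtain T where T: "finite T" "T \<subseteq> carrier Q" "\<And>H. submodule H A Q \<and> T \<subseteq> H \<Longrightarrow> H = carrier Q"
    using assms(2) unfolding fin_gen_gmod_def by blast
  show ?thesis
    unfolding fin_gen_gmod_def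
  proof (intro exI[of _ "i ` S \<union> j ` T"] conjI allI impI)
    show "finite (i ` S \<union> j ` T)" using S T by simp
    show "i ` S \<union> j ` T \<subseteq> carrier M" using S T gmod_hom_closed[OF i] gmod_hom_closed[OF j] by auto
  next
    fix H assume H: "submodule H A M \<and> i ` S \<union> j ` T \<subseteq> H"
    interpret H: submodule H A M using H by blast
    have P: "{x \<in> carrier P. i x \<in> H} = carrier P"
      using H S(2) by (intro S(3) conjI submodule_preimage[OF P.graded_module_axioms i]) auto
    have Q: "{x \<in> carrier Q. j x \<in> H} = carrier Q"
      using H T(2) by (intro T(3) conjI submodule_preimage[OF Q.graded_module_axioms j]) auto
    have "x \<in> H" if x: "x \<in> carrier M" for x
    proof -
      have "i (p x) \<in> H" "j (q x) \<in> H"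
        using P Q gmod_hom_closed[OF p x] gmod_hom_closed[OF q x] by blast+
      then show ?thesis using H.m_closed[of "i (p x)" "j (q x)"] ip_jq[OF x] by simp
    qed
    then show "H = carrier M" using H.subset by auto
  qed
qed

end

lemma (in gmod_biproduct) hom_biproduct:
  assumes N: "graded_module A N" and h: "h \<in> gmod_hom A P N" "k \<in> gmod_hom A Q N"
  shows "(\<lambda>x. h (p x) \<oplus>\<^bsub>N\<^esub> k (q x)) \<in> gmod_hom A M N"
proof -
  interpret N: graded_module A N by fact
  interpret gmod_pair A M N ..
  show ?thesis by (intro hom_sum gmod_hom_comp[OF p h(1)] gmod_hom_comp[OF q h(2)])
qed

lemma projective_biproduct:
  fixes P Q M :: "('a, 'b) gmodule"
  assumes "gmod_biproduct A P Q M i j p q" "projective_gmod A P" "projective_gmod A Q"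
  shows "projective_gmod A M"
  unfolding projective_gmod_def
proof (intro allI impI)
  interpret gmod_biproduct A P Q M i j p q by fact
  fix L N :: "('a, 'b) gmodule" and g f
  assume *: "unital_graded_module A L \<and> unital_graded_module A N \<and> g \<in> gmod_hom A L N \<and>
    g ` carrier L = carrier N \<and> f \<in> gmod_hom A M N"
  then have g: "g \<in> gmod_hom A L N" and f: "f \<in> gmod_hom A M N" by blast+
  have L: "graded_module A L" using * unital_graded_module.axioms(1) by blast
  obtain h where h: "h \<in> gmod_hom A P L" "\<And>x. x \<in> carrier P \<Longrightarrow> g (h x) = f (i x)"
    using assms(2) * gmod_hom_comp[OF i f] unfolding projective_gmod_def by metis
  obtain k where k: "k \<in> gmod_hom A Q L" "\<And>x. x \<in> carrier Q \<Longrightarrow> g (k x) = f (j x)"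
    using assms(3) * gmod_hom_comp[OF j f] unfolding projective_gmod_def by metis
  show "\<exists>h\<in>gmod_hom A M L. \<forall>x\<in>carrier M. g (h x) = f x"
  proof (rule bexI[OF _ hom_biproduct[OF L h(1) k(1)]], intro ballI)
    fix x assume x: "x \<in> carrier M"
    note cl = gmod_hom_closed[OF p x] gmod_hom_closed[OF q x]
    have "g (h (p x) \<oplus>\<^bsub>L\<^esub> k (q x)) = f (i (p x)) \<oplus>\<^bsub>N\<^esub> f (j (q x))"
      using h k cl by (simp add: gmod_hom_add[OF g] gmod_hom_closed[OF h(1)] gmod_hom_closed[OF k(1)])
    also have "\<dots> = f (i (p x) \<oplus>\<^bsub>M\<^esub> j (q x))"
      using cl by (simp add: gmod_hom_add[OF f] gmod_hom_closed[OF i] gmod_hom_closed[OF j])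
    finally show "g (h (p x) \<oplus>\<^bsub>L\<^esub> k (q x)) = f x" using ip_jq[OF x] by simp
  qed
qed

section \<open>Products of isomorphism classes and cancellation in the monoid\<close>

lemma fg_proj_gmodsD:
  assumes "P \<in> fg_proj_gmods A"
  shows "unital_graded_module A P" "graded_module A P" "fin_gen_gmod A P" "projective_gmod A P"
  using assms unital_graded_module.axioms(1) by (auto simp: fg_proj_gmods_def)

text \<open>Products of classes in \<open>gr_V\<close> are thus not empty, without which an equation
  between two of them would yield no isomorphism. The copy interleaves two sequences at the even and
  odd places of one.\<close>

lemma fg_proj_gmods_sum:
  assumes P: "P \<in> fg_proj_gmods A" and Q: "Q \<in> fg_proj_gmods A"
  obtains M where "M \<in> fg_proj_gmods A" "gmod_isomorphic A M (gmod_sum P Q)"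
proof -
  define f :: "(nat \<Rightarrow> 'a) \<times> (nat \<Rightarrow> 'a) \<Rightarrow> nat \<Rightarrow> 'a"
    where "f x n = (if even n then fst x (n div 2) else snd x (n div 2))" for x n
  define g :: "(nat \<Rightarrow> 'a) \<Rightarrow> (nat \<Rightarrow> 'a) \<times> (nat \<Rightarrow> 'a)"
    where "g x = (\<lambda>n. x (2 * n), \<lambda>n. x (2 * n + 1))" for x
  have gf: "g (f x) = x" for x by (simp add: f_def g_def)
  note P' = fg_proj_gmodsD[OF P] and Q' = fg_proj_gmodsD[OF Q]
  interpret P: graded_module A P by (rule P')
  interpret Q: graded_module A Q by (rule Q')
  let ?M = "gmod_copy f g (gmod_sum P Q)"
  have f: "f \<in> gmod_hom A (gmod_sum P Q) ?M" and g: "g \<in> gmod_hom A ?M (gmod_sum P Q)"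
    using gmod_copy_hom[of g f, OF gf] by auto
  have M: "graded_module A ?M"
    by (rule graded_module_copy[of A _ g f, OF graded_module_sum[OF P'(2) Q'(2)] gf])
  interpret M: graded_module A ?M by (rule M)
  have bi: "gmod_biproduct A P Q ?M (\<lambda>x. f (x, \<zero>\<^bsub>Q\<^esub>)) (\<lambda>x. f (\<zero>\<^bsub>P\<^esub>, x)) (\<lambda>x. fst (g x)) (\<lambda>x. snd (g x))"
  proof
    fix x assume "x \<in> carrier ?M"
    then obtain y z where "x = f (y, z)" "y \<in> carrier P" "z \<in> carrier Q" by (auto simp: gmod_copy_def)
    then show "f (fst (g x), \<zero>\<^bsub>Q\<^esub>) \<oplus>\<^bsub>?M\<^esub> f (\<zero>\<^bsub>P\<^esub>, snd (g x)) = x"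
      by (simp add: gf gmod_copy_def)
  qed (rule gmod_hom_comp[OF inl_hom[OF P'(2) Q'(2)] f] gmod_hom_comp[OF inr_hom[OF P'(2) Q'(2)] f]
      gmod_hom_comp[OF g fst_hom] gmod_hom_comp[OF g snd_hom])+
  interpret gmod_biproduct A P Q ?M "\<lambda>x. f (x, \<zero>\<^bsub>Q\<^esub>)" "\<lambda>x. f (\<zero>\<^bsub>P\<^esub>, x)" "\<lambda>x. fst (g x)" "\<lambda>x. snd (g x)"
    by (rule bi)
  have "?M \<in> fg_proj_gmods A"
    unfolding fg_proj_gmods_def
    using unital[OF P'(1) Q'(1)] fin_gen[OF P'(3) Q'(3)] projective_biproduct[OF bi P'(4) Q'(4)] by blast
  moreover have "gmod_isomorphic A ?M (gmod_sum P Q)"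
    unfolding gmod_isomorphic_def
    by (rule bexI[OF _ g]) (auto simp: gmod_copy_def bij_betw_def inj_on_def gf image_image)
  ultimately show ?thesis using that by blast
qed

text \<open>A module representing the sum of \<open>P\<close> and \<open>Z\<close> also represents a
  sum of some \<open>Q'\<close> in \<open>y\<close> and \<open>Z'\<close> in \<open>z\<close>.
  Replacing \<open>Z'\<close> by the isomorphic \<open>Z\<close> gives both sums the same second
  summand, and module cancellation applies.\<close>

theorem gr_V_cancel:
  assumes sr: "\<And>P. P \<in> fg_proj_gmods A \<Longrightarrow> sr1 A P"
    and x: "x \<in> carrier (gr_V A)" and y: "y \<in> carrier (gr_V A)" and z: "z \<in> carrier (gr_V A)"
    and eq: "x \<otimes>\<^bsub>gr_V A\<^esub> z = y \<otimes>\<^bsub>gr_V A\<^esub> z"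
  shows "x = y"
proof -
  note D = fg_proj_gmodsD(2)
  obtain P Q Z where P: "P \<in> fg_proj_gmods A" "x = gmod_iso_rel A `` {P}"
    and Q: "Q \<in> fg_proj_gmods A" "y = gmod_iso_rel A `` {Q}"
    and Z: "Z \<in> fg_proj_gmods A" "z = gmod_iso_rel A `` {Z}"
    using x y z unfolding gr_V_def by (auto simp: quotient_def)
  have self: "P \<in> x" "Z \<in> z"
    using P Z gmod_isomorphic_refl by (auto simp: gmod_iso_rel_def)
  obtain M where M: "M \<in> fg_proj_gmods A" "gmod_isomorphic A M (gmod_sum P Z)"
    using fg_proj_gmods_sum[OF P(1) Z(1)] .
  have "M \<in> x \<otimes>\<^bsub>gr_V A\<^esub> z" using M self by (auto simp: gr_V_def)
  then obtain Q' Z' where Q': "Q' \<in> y" and Z': "Z' \<in> z" and M': "gmod_isomorphic A M (gmod_sum Q' Z')"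
    unfolding eq by (auto simp: gr_V_def)
  have fg: "Q' \<in> fg_proj_gmods A" "gmod_isomorphic A Q Q'" "Z' \<in> fg_proj_gmods A" "gmod_isomorphic A Z Z'"
    using Q' Z' unfolding Q(2) Z(2) by (auto simp: gmod_iso_rel_def)
  have "gmod_isomorphic A (gmod_sum P Z) M"
    by (rule gmod_isomorphic_sym[OF D[OF M(1)] graded_module_sum[OF D[OF P(1)] D[OF Z(1)]] M(2)])
  then have "gmod_isomorphic A (gmod_sum P Z) (gmod_sum Q' Z)"
    by (rule gmod_isomorphic_trans[OF gmod_isomorphic_trans[OF _ M']
        gmod_isomorphic_sum_right[OF gmod_isomorphic_sym[OF D[OF Z(1)] D[OF fg(3)] fg(4)]]])
  then have "gmod_isomorphic A P Q'"
    by (rule cancel_sr1[OF D[OF P(1)] D[OF fg(1)] D[OF Z(1)] _ sr[OF Z(1)]])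
  then have PQ: "gmod_isomorphic A P Q"
    by (rule gmod_isomorphic_trans[OF _ gmod_isomorphic_sym[OF D[OF Q(1)] D[OF fg(1)] fg(2)]])
  have QP: "gmod_isomorphic A Q P" by (rule gmod_isomorphic_sym[OF D[OF P(1)] D[OF Q(1)] PQ])
  show ?thesis
    unfolding P(2) Q(2) using P(1) Q(1) gmod_isomorphic_trans[OF PQ] gmod_isomorphic_trans[OF QP]
    by (auto simp: gmod_iso_rel_def)
qed

section \<open>Shifted free modules over the Leavitt path algebra\<close>

context lpa
begin

lemma mult_A_closed: "\<lbrakk>a \<in> carrier A; b \<in> carrier A\<rbrakk> \<Longrightarrow> a \<otimes>\<^bsub>A\<^esub> b \<in> carrier A"
  by (auto simp: carrier_A mult_A Aug_R intro!: imageI Aug_mult_left)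

lemma mult_A_assoc:
  "\<lbrakk>a \<in> carrier A; b \<in> carrier A; c \<in> carrier A\<rbrakk> \<Longrightarrow> a \<otimes>\<^bsub>A\<^esub> b \<otimes>\<^bsub>A\<^esub> c = a \<otimes>\<^bsub>A\<^esub> (b \<otimes>\<^bsub>A\<^esub> c)"
  by (auto simp: carrier_A mult_A Aug_R R_mult mult.assoc)

lemma mult_A_l_distr:
  "\<lbrakk>a \<in> carrier A; b \<in> carrier A; c \<in> carrier A\<rbrakk> \<Longrightarrow> (a \<oplus>\<^bsub>A\<^esub> b) \<otimes>\<^bsub>A\<^esub> c = a \<otimes>\<^bsub>A\<^esub> c \<oplus>\<^bsub>A\<^esub> b \<otimes>\<^bsub>A\<^esub> c"
  by (auto simp: carrier_A mult_A add_A Aug_R R_mult R_add distrib_right)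

lemma mult_A_r_distr:
  "\<lbrakk>a \<in> carrier A; b \<in> carrier A; c \<in> carrier A\<rbrakk> \<Longrightarrow> a \<otimes>\<^bsub>A\<^esub> (b \<oplus>\<^bsub>A\<^esub> c) = a \<otimes>\<^bsub>A\<^esub> b \<oplus>\<^bsub>A\<^esub> a \<otimes>\<^bsub>A\<^esub> c"
  by (auto simp: carrier_A mult_A add_A Aug_R R_mult R_add distrib_left)

lemma mult_A_zero: "a \<in> carrier A \<Longrightarrow> a \<otimes>\<^bsub>A\<^esub> \<zero>\<^bsub>A\<^esub> = \<zero>\<^bsub>A\<^esub>" "a \<in> carrier A \<Longrightarrow> \<zero>\<^bsub>A\<^esub> \<otimes>\<^bsub>A\<^esub> a = \<zero>\<^bsub>A\<^esub>"
  by (auto simp: carrier_A mult_A zero_A Aug_R)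

lemma rgrade_A_carrier: "a \<in> rgrade A n \<Longrightarrow> a \<in> carrier A"
  by (auto simp: carrier_A rgrade_A)

lemma zero_rgrade_A [simp]: "\<zero>\<^bsub>A\<^esub> \<in> rgrade A n"
  by (auto simp: rgrade_A zero_A intro!: imageI)

lemma add_rgrade_A: "\<lbrakk>a \<in> rgrade A n; b \<in> rgrade A n\<rbrakk> \<Longrightarrow> a \<oplus>\<^bsub>A\<^esub> b \<in> rgrade A n"
  by (auto simp: rgrade_A add_A Aug_R intro!: imageI Aug_add homog_add)

lemma uminus_A: "p \<in> Aug \<Longrightarrow> \<ominus>\<^bsub>A\<^esub> cls p = cls (- p)"
  by (rule A.minus_equality) (auto simp: add_A zero_A carrier_A Aug_R R_uminus Aug_uminus)

lemma uminus_rgrade_A: "a \<in> rgrade A n \<Longrightarrow> \<ominus>\<^bsub>A\<^esub> a \<in> rgrade A n"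
  by (auto simp: rgrade_A uminus_A intro!: imageI Aug_uminus homog_uminus)

lemma mult_rgrade_A: "\<lbrakk>a \<in> rgrade A m; b \<in> rgrade A n\<rbrakk> \<Longrightarrow> a \<otimes>\<^bsub>A\<^esub> b \<in> rgrade A (m + n)"
  by (auto simp: rgrade_A mult_A Aug_R intro!: imageI Aug_mult_left homog_mult)

text \<open>The homogeneous component of a class; the choice made by \<open>rep\<close> does not
  affect it because the ideal is graded.\<close>

definition comp :: "int \<Rightarrow> ('v, 'e, 'k) lpa_free set \<Rightarrow> ('v, 'e, 'k) lpa_free set" where
  "comp n a = cls (proj n (rep a))"

lemma comp_cls: "p \<in> Aug \<Longrightarrow> comp n (cls p) = cls (proj n p)"
  unfolding comp_def by (simp add: cls_eq_iff cong_proj rep_cls)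

lemma comp_rgrade: "a \<in> carrier A \<Longrightarrow> comp n a \<in> rgrade A n"
  by (auto simp: comp_def rgrade_A rep_Aug Aug_proj homog_proj)

lemma comp_zero [simp]: "comp n \<zero>\<^bsub>A\<^esub> = \<zero>\<^bsub>A\<^esub>"
  by (simp add: zero_A comp_cls)

lemma proj_mult_unit: "proj n (p * unit W) = proj n p * unit W"
  unfolding unit_def sum_distrib_left proj_sum
  by (intro sum.cong refl) (simp add: gen_def proj_mult_single word_degree_def)

lemma comp_mult_unit:
  assumes a: "a \<in> carrier A" and W: "W \<subseteq> verts E"
  shows "comp n (a \<otimes>\<^bsub>A\<^esub> cls (unit W)) = comp n a \<otimes>\<^bsub>A\<^esub> cls (unit W)"
proof -
  obtain p where p: "p \<in> Aug" "a = cls p" using a by (auto simp: carrier_A)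
  have "a \<otimes>\<^bsub>A\<^esub> cls (unit W) = cls (p * unit W)" using p W by (simp add: mult_A Aug_R unit_R)
  moreover have "p * unit W \<in> Aug" using p W by (intro Aug_mult_right unit_R Aug_R)
  ultimately show ?thesis
    using p W by (simp add: comp_cls proj_mult_unit mult_A Aug_R Aug_proj unit_R)
qed

text \<open>The offset \<open>d\<close> anticipates shifted summands, in which degree
  \<open>n\<close> means degree \<open>n - d\<close> of the entry. Allowing every larger
  \<open>T\<close> lets several coordinates share one index set.\<close>

lemma comp_decomposition:
  assumes "a \<in> carrier A"
  obtains S where "finite S" "\<And>n. n \<notin> S \<Longrightarrow> comp (n - d) a = \<zero>\<^bsub>A\<^esub>"
    "\<And>T. \<lbrakk>finite T; S \<subseteq> T\<rbrakk> \<Longrightarrow> finsum A (\<lambda>n. comp (n - d) a) T = a"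
proof
  let ?S = "(\<lambda>m. m + d) ` deg ` Poly_Mapping.keys (rep a)"
  show "finite ?S" by simp
  have "n - d \<notin> deg ` Poly_Mapping.keys (rep a)" if "n \<notin> ?S" for n
    using that by (metis diff_add_cancel image_eqI)
  then show "comp (n - d) a = \<zero>\<^bsub>A\<^esub>" if "n \<notin> ?S" for n
    using that by (simp add: comp_def proj_eq_0 zero_A)
  fix T assume T: "finite T" "?S \<subseteq> T"
  have "finsum A (\<lambda>n. comp (n - d) a) T = cls (\<Sum>n\<in>T. proj (n - d) (rep a))"
    unfolding comp_def using T assms by (intro finsum_A) (auto intro: Aug_proj rep_Aug)
  also have "(\<Sum>n\<in>T. proj (n - d) (rep a)) = (\<Sum>n\<in>(\<lambda>n. n - d) ` T. proj n (rep a))"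
    by (subst sum.reindex) (auto simp: inj_on_def)
  also have "\<dots> = rep a"
  proof (rule sum_proj)
    have "m \<in> (\<lambda>n. n - d) ` T" if "m + d \<in> T" for m using imageI[OF that, of "\<lambda>n. n - d"] by simp
    then show "deg ` Poly_Mapping.keys (rep a) \<subseteq> (\<lambda>n. n - d) ` T" using T(2) by blast
  qed (use T in simp)
  finally show "finsum A (\<lambda>n. comp (n - d) a) T = a" using assms by (simp add: cls_rep)
qed

lemma comp_finsum:
  assumes S: "finite S" "\<And>n. b n \<in> rgrade A (n - d)" "\<And>n. n \<notin> S \<Longrightarrow> b n = \<zero>\<^bsub>A\<^esub>"
  shows "comp (n - d) (finsum A b S) = b n"
proof -
  have "\<exists>r. \<forall>n. r n \<in> Aug \<and> homog (n - d) (r n) \<and> b n = cls (r n)"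
    using S(2) by (intro choice) (auto simp: rgrade_A)
  then obtain r where r: "\<And>n. r n \<in> Aug" "\<And>n. homog (n - d) (r n)" "\<And>n. b n = cls (r n)" by blast
  have "finsum A b S = cls (\<Sum>n\<in>S. r n)"
    using finsum_A[OF S(1), of r] r by (metis (no_types, lifting) ext)
  then have "comp (n - d) (finsum A b S) = cls (\<Sum>m\<in>S. proj (n - d) (r m))"
    using r by (simp add: comp_cls Aug_sum proj_sum)
  also have "(\<Sum>m\<in>S. proj (n - d) (r m)) = (\<Sum>m\<in>S. if m = n then r n else 0)"
    by (intro sum.cong refl) (auto simp: proj_homog[OF r(2)])
  also have "cls \<dots> = b n" using S(1,3) r(3) by (auto simp: sum.delta zero_A)
  finally show ?thesis .
qed

text \<open>An element of \<open>AM\<close> is a finite sum of products \<open>a x\<close>, and a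
  sum of vertices that fixes all the coefficients \<open>a\<close> fixes it. Quantifying over larger
  sets allows the units of the summands to be merged.\<close>

lemma local_unit_module:
  assumes "unital_graded_module A Z" "x \<in> carrier Z"
  shows "\<exists>W. finite W \<and> W \<subseteq> verts E \<and>
    (\<forall>W'. finite W' \<and> W \<subseteq> W' \<and> W' \<subseteq> verts E \<longrightarrow> cls (unit W') \<odot>\<^bsub>Z\<^esub> x = x)"
proof -
  interpret Z: unital_graded_module A Z by fact
  let ?S = "{a \<odot>\<^bsub>Z\<^esub> x | a x. a \<in> carrier A \<and> x \<in> carrier Z}"
  have base: "\<exists>W. finite W \<and> W \<subseteq> verts E \<and>
      (\<forall>W'. finite W' \<and> W \<subseteq> W' \<and> W' \<subseteq> verts E \<longrightarrow> cls (unit W') \<odot>\<^bsub>Z\<^esub> h = h)" if hS: "h \<in> ?S" for h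
  proof -
    obtain a x where h: "h = a \<odot>\<^bsub>Z\<^esub> x" "a \<in> carrier A" "x \<in> carrier Z" using hS by blast
    then obtain p where p: "p \<in> Aug" "a = cls p" by (auto simp: carrier_A)
    obtain W where W: "finite W" "W \<subseteq> verts E"
      "\<And>W'. \<lbrakk>finite W'; W \<subseteq> W'; W' \<subseteq> verts E\<rbrakk> \<Longrightarrow> unit W' * p \<asymp> p"
      using local_unit[OF p(1)] by blast
    have "cls (unit W') \<odot>\<^bsub>Z\<^esub> h = h" if "finite W'" "W \<subseteq> W'" "W' \<subseteq> verts E" for W'
    proof -
      have "cls (unit W') \<odot>\<^bsub>Z\<^esub> h = (cls (unit W') \<otimes>\<^bsub>A\<^esub> a) \<odot>\<^bsub>Z\<^esub> x"
        using h that by (simp add: Z.smult_assoc cls_Aug unit_Aug)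
      also have "cls (unit W') \<otimes>\<^bsub>A\<^esub> a = a"
        using p that W(3)[OF that] by (simp add: mult_A Aug_R unit_R cls_eq_iff)
      finally show ?thesis using h by simp
    qed
    then show ?thesis using W by blast
  qed
  have "x \<in> generate (add_monoid Z) ?S"
    using assms(2) Z.unital by simp
  then show ?thesis
  proof (induction rule: generate.induct)
    case one
    show ?case by (rule exI[of _ "{}"]) (auto simp: Z.smult_zero carrier_A unit_Aug)
  next
    case (incl h)
    then show ?case by (rule base)
  next
    case (inv h)
    obtain W where W: "finite W" "W \<subseteq> verts E"
      "\<And>W'. finite W' \<and> W \<subseteq> W' \<and> W' \<subseteq> verts E \<longrightarrow> cls (unit W') \<odot>\<^bsub>Z\<^esub> h = h"
      using base[OF inv] by metis
    have "h \<in> carrier Z" using inv Z.smult_closed by auto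
    then show ?case
      using W unfolding a_inv_def[symmetric]
      by (intro exI[of _ W]) (auto simp: Z.smult_minus cls_Aug unit_Aug)
  next
    case (eng h1 h2)
    have cl: "h1 \<in> carrier Z" "h2 \<in> carrier Z" using eng(1,2) Z.unital by simp_all
    obtain W1 W2 where W: "finite W1" "W1 \<subseteq> verts E" "finite W2" "W2 \<subseteq> verts E"
      "\<And>W'. finite W' \<and> W1 \<subseteq> W' \<and> W' \<subseteq> verts E \<longrightarrow> cls (unit W') \<odot>\<^bsub>Z\<^esub> h1 = h1"
      "\<And>W'. finite W' \<and> W2 \<subseteq> W' \<and> W' \<subseteq> verts E \<longrightarrow> cls (unit W') \<odot>\<^bsub>Z\<^esub> h2 = h2"
      using eng.IH by blast
    show ?case
      using W cl by (intro exI[of _ "W1 \<union> W2"]) (auto simp: Z.smult_r_distr cls_Aug unit_Aug)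
  qed
qed

end

locale lpa_fm = lpa E K for E :: "('v, 'e) pre_digraph" and K :: "'k::field itself" +
  fixes k :: nat and dg :: "nat \<Rightarrow> int" and W :: "'v set"
  assumes finite_W: "finite W" and W_verts: "W \<subseteq> verts E"
begin

definition e where "e = cls (unit W)"

text \<open>The direct sum of the shifted modules \<open>A e(d\<^sub>i)\<close> as row vectors of
  length \<open>k\<close>, padded with zeros. This puts it on the very type on which the test
  modules for projectivity live. The degrees are such that the \<open>i\<close>-th generator has
  degree \<open>dg i\<close>.\<close>

definition F :: "(('v, 'e, 'k) lpa_free set, nat \<Rightarrow> ('v, 'e, 'k) lpa_free set) gmodule" where
  "F = \<lparr>carrier = {f. (\<forall>i. f i \<in> carrier A \<and> f i \<otimes>\<^bsub>A\<^esub> e = f i) \<and> (\<forall>i\<ge>k. f i = \<zero>\<^bsub>A\<^esub>)},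
     monoid.mult = undefined, one = undefined, ring.zero = (\<lambda>_. \<zero>\<^bsub>A\<^esub>),
     add = (\<lambda>f g i. f i \<oplus>\<^bsub>A\<^esub> g i), smult = (\<lambda>a f i. a \<otimes>\<^bsub>A\<^esub> f i),
     grade = (\<lambda>n. {f. (\<forall>i. f i \<in> rgrade A (n - dg i) \<and> f i \<otimes>\<^bsub>A\<^esub> e = f i) \<and> (\<forall>i\<ge>k. f i = \<zero>\<^bsub>A\<^esub>)})\<rparr>"

lemma unit_W: "unit W \<in> Aug" "unit W \<in> R"
  using unit_Aug unit_R W_verts by auto

lemma e_A: "e \<in> carrier A" and e_grade: "e \<in> rgrade A 0"
  using unit_W homog_unit by (auto simp: e_def carrier_A rgrade_A)

lemma unit_W_idem: "unit W * unit W \<asymp> unit W"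
proof -
  have "unit W * (\<Sum>v\<in>W. V v) \<asymp> (\<Sum>v\<in>W. V v)"
    unfolding sum_distrib_left
  proof (rule cong_sum)
    fix v assume "v \<in> W"
    then show "unit W * V v \<asymp> V v"
      using unit_gen[OF finite_W W_verts, of "Vertex v"] W_verts by (auto simp: lpa_gens_def)
  qed
  then show ?thesis by (simp add: unit_def)
qed

lemma e_idem: "e \<otimes>\<^bsub>A\<^esub> e = e"
  using unit_W unit_W_idem by (simp add: e_def mult_A cls_eq_iff)

lemma F_simps:
  "f \<in> carrier F \<longleftrightarrow> (\<forall>i. f i \<in> carrier A \<and> f i \<otimes>\<^bsub>A\<^esub> e = f i) \<and> (\<forall>i\<ge>k. f i = \<zero>\<^bsub>A\<^esub>)"
  "\<zero>\<^bsub>F\<^esub> = (\<lambda>_. \<zero>\<^bsub>A\<^esub>)" "f \<oplus>\<^bsub>F\<^esub> g = (\<lambda>i. f i \<oplus>\<^bsub>A\<^esub> g i)" "a \<odot>\<^bsub>F\<^esub> f = (\<lambda>i. a \<otimes>\<^bsub>A\<^esub> f i)"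
  "f \<in> grade F n \<longleftrightarrow> (\<forall>i. f i \<in> rgrade A (n - dg i) \<and> f i \<otimes>\<^bsub>A\<^esub> e = f i) \<and> (\<forall>i\<ge>k. f i = \<zero>\<^bsub>A\<^esub>)"
  by (simp_all add: F_def)

lemma uminus_e:
  assumes "a \<in> carrier A" "a \<otimes>\<^bsub>A\<^esub> e = a"
  shows "\<ominus>\<^bsub>A\<^esub> a \<otimes>\<^bsub>A\<^esub> e = \<ominus>\<^bsub>A\<^esub> a"
proof (rule A.minus_equality[symmetric])
  show "\<ominus>\<^bsub>A\<^esub> a \<otimes>\<^bsub>A\<^esub> e \<oplus>\<^bsub>A\<^esub> a = \<zero>\<^bsub>A\<^esub>"
    using mult_A_l_distr[of "\<ominus>\<^bsub>A\<^esub> a" a e] assms e_A mult_A_zero(2)[of e] by (simp add: A.l_neg)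
qed (use assms e_A in \<open>auto intro: mult_A_closed\<close>)

lemma abelian_group_F: "abelian_group F"
proof (rule abelian_groupI)
  fix f assume "f \<in> carrier F"
  then show "\<exists>g\<in>carrier F. g \<oplus>\<^bsub>F\<^esub> f = \<zero>\<^bsub>F\<^esub>"
    by (intro bexI[of _ "\<lambda>i. \<ominus>\<^bsub>A\<^esub> f i"]) (auto simp: F_simps A.l_neg uminus_e)
qed (auto simp: F_simps mult_A_l_distr A.a_ac e_A mult_A_zero)

sublocale FM: abelian_group F
  by (rule abelian_group_F)

lemma finsum_F: "(\<And>i. i \<in> S \<Longrightarrow> c i \<in> carrier F) \<Longrightarrow> finsum F c S j = finsum A (\<lambda>i. c i j) S"
proof (induction S rule: infinite_finite_induct)
  case (insert x S)
  then have "c \<in> S \<rightarrow> carrier F" "c x \<in> carrier F" by auto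
  moreover have "c i j \<in> carrier A" if "i \<in> insert x S" for i using insert.prems[OF that] by (simp add: F_simps)
  then have "(\<lambda>i. c i j) \<in> S \<rightarrow> carrier A" "c x j \<in> carrier A" by auto
  ultimately show ?case using insert by (simp add: F_simps)
qed (auto simp: F_simps)

lemma grade_F_carrier: "f \<in> grade F n \<Longrightarrow> f \<in> carrier F"
  by (auto simp: F_simps intro: rgrade_A_carrier)

lemma internal_direct_sum_F: "internal_direct_sum F (grade F)"
proof (rule internal_direct_sumI[OF abelian_group_F])
  fix n
  show "additive_subgroup (grade F n) F"
  proof (intro additive_subgroup.intro subgroup.intro)
    fix f assume f: "f \<in> grade F n"
    have "\<ominus>\<^bsub>F\<^esub> f = (\<lambda>i. \<ominus>\<^bsub>A\<^esub> f i)"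
      using grade_F_carrier[OF f] by (intro FM.minus_equality) (auto simp: F_simps A.l_neg uminus_e)
    moreover have "f i \<in> carrier A" for i using grade_F_carrier[OF f] by (simp add: F_simps)
    ultimately show "inv\<^bsub>add_monoid F\<^esub> f \<in> grade F n"
      using f unfolding a_inv_def[symmetric] by (simp add: F_simps uminus_rgrade_A uminus_e)
  next
    fix f g assume fg: "f \<in> grade F n" "g \<in> grade F n"
    have "f i \<in> carrier A" "g i \<in> carrier A" for i
      using fg[THEN grade_F_carrier] by (simp_all add: F_simps)
    then show "f \<otimes>\<^bsub>add_monoid F\<^esub> g \<in> grade F n"
      using fg by (simp add: F_simps add_rgrade_A mult_A_l_distr e_A)
  next
    show "grade F n \<subseteq> carrier (add_monoid F)" using grade_F_carrier by auto
  qed (auto simp: F_simps e_A mult_A_zero)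
next
  fix f assume f: "f \<in> carrier F"
  then have fA: "f i \<in> carrier A" "f i \<otimes>\<^bsub>A\<^esub> e = f i" for i by (auto simp: F_simps)
  define c where "c n i = comp (n - dg i) (f i)" for n i
  have "\<exists>S. finite S \<and> (\<forall>n. n \<notin> S \<longrightarrow> c n i = \<zero>\<^bsub>A\<^esub>) \<and>
      (\<forall>T. finite T \<and> S \<subseteq> T \<longrightarrow> finsum A (\<lambda>n. c n i) T = f i)" for i
  proof (rule comp_decomposition[OF fA(1)[of i], of "dg i"])
    fix S
    assume "finite S" "\<And>n. n \<notin> S \<Longrightarrow> comp (n - dg i) (f i) = \<zero>\<^bsub>A\<^esub>"
      "\<And>T. \<lbrakk>finite T; S \<subseteq> T\<rbrakk> \<Longrightarrow> finsum A (\<lambda>n. comp (n - dg i) (f i)) T = f i"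
    then show ?thesis unfolding c_def by (intro exI[of _ S]) simp
  qed
  then obtain S where S: "\<And>i. finite (S i)" "\<And>i n. n \<notin> S i \<Longrightarrow> c n i = \<zero>\<^bsub>A\<^esub>"
    "\<And>i T. \<lbrakk>finite T; S i \<subseteq> T\<rbrakk> \<Longrightarrow> finsum A (\<lambda>n. c n i) T = f i" by metis
  let ?T = "\<Union>i<k. S i"
  have c0: "c n i = \<zero>\<^bsub>A\<^esub>" if "k \<le> i" for n i using f that by (simp add: c_def F_simps)
  have cg: "c n \<in> grade F n" for n
    using fA comp_mult_unit[OF fA(1) W_verts] c0 by (auto simp: F_simps c_def comp_rgrade e_def)
  have "finsum F c ?T = f"
  proof
    fix i
    have "finsum F c ?T i = finsum A (\<lambda>n. c n i) ?T" using cg grade_F_carrier by (intro finsum_F) blast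
    also have "\<dots> = f i"
    proof (cases "i < k")
      case True
      then show ?thesis using S by (intro S(3)) auto
    next
      case False
      then show ?thesis using c0[of i] f by (simp add: F_simps)
    qed
    finally show "finsum F c ?T i = f i" .
  qed
  moreover have "c n = \<zero>\<^bsub>F\<^esub>" if "n \<notin> ?T" for n
  proof
    fix i show "c n i = \<zero>\<^bsub>F\<^esub> i" using that S(2)[of n i] c0[of i n] by (cases "i < k") (auto simp: F_simps)
  qed
  ultimately show "\<exists>c S. finite S \<and> (\<forall>n. c n \<in> grade F n) \<and> (\<forall>n. n \<notin> S \<longrightarrow> c n = \<zero>\<^bsub>F\<^esub>) \<and> f = finsum F c S"
    using S(1) cg by (intro exI[of _ c] exI[of _ ?T]) auto
next
  fix c c' and S :: "int set"
  assume *: "finite S" "\<forall>n. c n \<in> grade F n" "\<forall>n. c' n \<in> grade F n" "\<forall>n. n \<notin> S \<longrightarrow> c n = \<zero>\<^bsub>F\<^esub>"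
    "\<forall>n. n \<notin> S \<longrightarrow> c' n = \<zero>\<^bsub>F\<^esub>" "finsum F c S = finsum F c' S"
  \<comment> \<open>Components are recovered coordinatewise by \<open>comp\<close>, and this gives
    uniqueness of the decomposition.\<close>
  have key: "comp (n - dg i) (finsum F b S i) = b n i"
    if "\<forall>n. b n \<in> grade F n" "\<forall>n. n \<notin> S \<longrightarrow> b n = \<zero>\<^bsub>F\<^esub>" for b n i
  proof -
    have "finsum F b S i = finsum A (\<lambda>n. b n i) S"
      using that(1) by (intro finsum_F grade_F_carrier[where n = "_ :: int"]) blast
    then show ?thesis
      using that *(1) by (simp add: comp_finsum[of S "\<lambda>n. b n i" "dg i"] F_simps)
  qed
  show "c = c'"
    by (intro ext) (use key[OF *(2,4)] key[OF *(3,5)] *(6) in metis)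
qed

lemma unital_graded_module_F: "unital_graded_module A F"
proof unfold_locales
  show "internal_direct_sum F (grade F)" by (rule internal_direct_sum_F)
next
  let ?S = "{a \<odot>\<^bsub>F\<^esub> x | a x. a \<in> carrier A \<and> x \<in> carrier F}"
  have sub: "?S \<subseteq> carrier F"
    by (auto simp: F_simps mult_A_closed mult_A_assoc e_A mult_A_zero)
  have "f \<in> ?S" if f: "f \<in> carrier F" for f
  proof -
    have fA: "f i \<in> carrier A" for i using f by (simp add: F_simps)
    have "\<exists>W. finite W \<and> W \<subseteq> verts E \<and> (\<forall>W'. finite W' \<and> W \<subseteq> W' \<and> W' \<subseteq> verts E \<longrightarrow> unit W' * rep (f i) \<asymp> rep (f i))" for i
    proof (rule local_unit[OF rep_Aug[OF fA[of i]]])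
      fix W
      assume "finite W" "W \<subseteq> verts E"
        "\<And>W'. \<lbrakk>finite W'; W \<subseteq> W'; W' \<subseteq> verts E\<rbrakk> \<Longrightarrow> unit W' * rep (f i) \<asymp> rep (f i)"
      then show ?thesis by (intro exI[of _ W]) simp
    qed
    then obtain W' where W': "\<And>i. finite (W' i)" "\<And>i. W' i \<subseteq> verts E"
      "\<And>i W''. \<lbrakk>finite W''; W' i \<subseteq> W''; W'' \<subseteq> verts E\<rbrakk> \<Longrightarrow> unit W'' * rep (f i) \<asymp> rep (f i)" by metis
    \<comment> \<open>A common local unit of the finitely many nonzero entries fixes
      \<open>f\<close>, so every element is already a single product.\<close>
    let ?W = "\<Union>i<k. W' i"
    have W: "finite ?W" "?W \<subseteq> verts E" using W' by auto
    have u: "unit ?W \<in> Aug" "unit ?W \<in> R" using unit_Aug[OF W(2)] unit_R[OF W(2)] by auto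
    have "cls (unit ?W) \<otimes>\<^bsub>A\<^esub> f i = f i" for i
    proof (cases "i < k")
      case True
      then have "unit ?W * rep (f i) \<asymp> rep (f i)" using W by (intro W'(3)) auto
      then have "cls (unit ?W) \<otimes>\<^bsub>A\<^esub> cls (rep (f i)) = cls (rep (f i))"
        using u rep_R[OF fA] by (simp add: mult_A cls_eq_iff)
      then show ?thesis using cls_rep[OF fA] by simp
    next
      case False
      then show ?thesis using f u by (simp add: F_simps mult_A_zero cls_Aug)
    qed
    then have "f = cls (unit ?W) \<odot>\<^bsub>F\<^esub> f" by (simp add: F_simps)
    then show ?thesis using f u cls_Aug by blast
  qed
  then have "?S = carrier F" using sub by blast
  then show "generate (add_monoid F) ?S = carrier F"
    using FM.add.generate_incl[of "carrier F"] generate.incl[of _ "carrier F" "add_monoid F"] by auto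
next
  fix a m f n assume a: "a \<in> rgrade A m" and f: "f \<in> grade F n"
  have "f i \<in> carrier A" for i using grade_F_carrier[OF f] by (simp add: F_simps)
  then show "a \<odot>\<^bsub>F\<^esub> f \<in> grade F (m + n)"
    using a f rgrade_A_carrier[OF a]
    by (simp add: F_simps mult_A_assoc e_A mult_A_zero add_diff_eq[symmetric] mult_rgrade_A)
qed (auto simp: F_simps mult_A_closed mult_A_assoc mult_A_l_distr mult_A_r_distr e_A mult_A_zero)

end

section \<open>Matrices of monomials\<close>

text \<open>The root letter records the matrix position and the initial vertex. Comparing prefixes
  of rooted paths then checks these two as well, so the orthogonality of matrix units and of
  vertices is built into the polycyclic product.\<close>

datatype ('v, 'e) letter = Root nat 'v | Step 'e

fun unstep :: "('v, 'e) letter \<Rightarrow> 'e" where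
  "unstep (Step e) = e"
| "unstep (Root _ _) = undefined"

lemma unstep_Step [simp]: "unstep \<circ> Step = id"
  by auto

lemma map_unstep_Step: "map unstep (map Step es) = es"
  by simp

abbreviation rooted :: "nat \<Rightarrow> 'v \<Rightarrow> 'e list \<Rightarrow> ('v, 'e) letter list" where
  "rooted i v es \<equiv> Root i v # map Step es"

lemma prefix_map_Step: "prefix (map Step es) (map Step fs) \<longleftrightarrow> prefix es fs"
  by (metis map_mono_prefix map_unstep_Step)

context lpa_fm
begin

text \<open>
  The pair of rooted paths \<open>(j, v, ps)\<close> and \<open>(i, u, qs)\<close> stands for the matrix with the entry \<open>qs ps\<^sup>*\<close> in
  position \<open>(i, j)\<close>, acting on row vectors from the right. Matrix products then reverse the
  order of the polycyclic monoid, and composition of the actions does not.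
\<close>

fun entry :: "nat \<Rightarrow> nat \<Rightarrow> ('v, 'e) letter polycyclic \<Rightarrow> ('v, 'e, 'k) lpa_free" where
  "entry i j (PPair (Root j' v # ps) (Root i' u # qs)) =
     (if i = i' \<and> j = j' then pathmon u (map unstep qs) v (map unstep ps) else 0)"
| "entry i j _ = 0"

lemma entry_rooted [simp]:
  "entry i j (PPair (rooted j' v ps) (rooted i' u qs)) = (if i = i' \<and> j = j' then pathmon u qs v ps else 0)"
  by simp

text \<open>The last condition says that the monomial has degree \<open>dg i - dg j\<close>, as an
  entry of a degree-preserving matrix must. Put differently, the shifted lengths of the two halves
  agree.\<close>

inductive_set pairs :: "('v, 'e) letter polycyclic set" where
  "\<lbrakk>i < k; j < k; u \<in> W; v \<in> W; awalk u qs w; awalk v ps w; int (length qs) - dg i = int (length ps) - dg j\<rbrakk>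
    \<Longrightarrow> PPair (rooted j v ps) (rooted i u qs) \<in> pairs"

text \<open>Path length corrected by the shift. On \<open>pairs\<close> the other half gives the
  same value, so one bound controls both paths.\<close>

fun level :: "('v, 'e) letter polycyclic \<Rightarrow> int" where
  "level (PPair p (Root i u # qs)) = int (length qs) - dg i"
| "level _ = 0"

fun steps :: "('v, 'e) letter polycyclic \<Rightarrow> 'e set" where
  "steps (PPair p q) = {e. Step e \<in> set p \<union> set q}"
| "steps PZero = {}"

lemma finite_steps: "finite (steps x)"
proof (cases x)
  case (PPair p q)
  have "steps x \<subseteq> unstep ` (set p \<union> set q)" unfolding PPair by force
  then show ?thesis by (rule finite_subset) simp
qed simp

definition bounded_pairs :: "'e set \<Rightarrow> int \<Rightarrow> ('v, 'e) letter polycyclic set" where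
  "bounded_pairs T N = insert PZero {x \<in> pairs. steps x \<subseteq> T \<and> level x \<le> N}"

definition units :: "('v, 'e) letter polycyclic set" where
  "units = (\<lambda>(i, v). PPair (rooted i v []) (rooted i v [])) ` ({..<k} \<times> W)"

text \<open>The source of finiteness: the unmatched rest of the longer inner path is appended on the
  other side, which makes the level of the product equal to that of one factor, and no new edge
  appears. The second claim compares with matrix multiplication, where the factors come in the
  opposite order.\<close>

lemma pairs_plus:
  assumes "x \<in> pairs" "y \<in> pairs"
  shows "x + y = PZero \<or> x + y \<in> pairs \<and> steps (x + y) \<subseteq> steps x \<union> steps y \<and> level (x + y) \<le> max (level x) (level y)"
    and "entry i l (x + y) \<asymp> (\<Sum>j<k. entry i j y * entry j l x)"
proof -
  from assms(1) obtain ix jx ux vx qx wx px where x: "x = PPair (rooted jx vx px) (rooted ix ux qx)"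
    "ix < k" "jx < k" "ux \<in> W" "vx \<in> W" "awalk ux qx wx" "awalk vx px wx"
    "int (length qx) - dg ix = int (length px) - dg jx" by (cases rule: pairs.cases) blast
  from assms(2) obtain iy jy uy vy qy wy py where y: "y = PPair (rooted jy vy py) (rooted iy uy qy)"
    "iy < k" "jy < k" "uy \<in> W" "vy \<in> W" "awalk uy qy wy" "awalk vy py wy"
    "int (length qy) - dg iy = int (length py) - dg jy" by (cases rule: pairs.cases) blast
  have sum: "(\<Sum>j<k. entry i j y * entry j l x) =
      (if i = iy \<and> l = jx \<and> jy = ix then pathmon uy qy vy py * pathmon ux qx vx px else 0)"
  proof -
    have "(\<Sum>j<k. entry i j y * entry j l x) =
        (\<Sum>j<k. if j = jy then (if i = iy \<and> l = jx \<and> jy = ix then pathmon uy qy vy py * pathmon ux qx vx px else 0) else 0)"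
      unfolding x(1) y(1) entry_rooted by (intro sum.cong refl) auto
    then show ?thesis using y(3) by (simp add: sum.delta)
  qed
  \<comment> \<open>Different positions give a vanishing matrix product, different vertices a
    vanishing product of monomials; only for equal roots are the paths themselves compared.\<close>
  consider (1) xs where "ix = jy" "ux = vy" "py = qx @ xs"
    | (2) xs where "ix = jy" "ux = vy" "qx = py @ xs" "xs \<noteq> []"
    | (3) "ix \<noteq> jy" | (4) "ix = jy" "ux \<noteq> vy" | (5) "ix = jy" "ux = vy" "\<not> prefix qx py" "\<not> prefix py qx"
    by (metis prefix_def append_Nil2)
  note cases = this
  have xy: "x + y = (if ix = jy \<and> ux = vy \<and> prefix qx py then PPair (rooted jx vx (px @ drop (length qx) py)) (rooted iy uy qy)
      else if ix = jy \<and> ux = vy \<and> prefix py qx then PPair (rooted jx vx px) (rooted iy uy (qy @ drop (length py) qx))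
      else PZero)"
    unfolding x(1) y(1) by (auto simp: prefix_map_Step drop_map)
  from cases show "x + y = PZero \<or> x + y \<in> pairs \<and> steps (x + y) \<subseteq> steps x \<union> steps y \<and>
      level (x + y) \<le> max (level x) (level y)"
  proof cases
    case (1 xs)
    have z: "x + y = PPair (rooted jx vx (px @ xs)) (rooted iy uy qy)" using 1 xy by simp
    have "awalk ux (qx @ xs) wy" using y(7) 1 by simp
    then have "awalk wx xs wy" using x(6) by (metis awalk_append_iff awlast_if_cas awalkE)
    then have "awalk vx (px @ xs) wy" using x(7) by (auto simp: awalk_append_iff dest!: awlast_if_cas awalkE)
    then have "x + y \<in> pairs" unfolding z
      using x y 1 by (intro pairs.intros[of _ _ _ _ _ wy]) auto
    moreover have "steps (x + y) \<subseteq> steps x \<union> steps y" unfolding z x(1) y(1) using 1 by auto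
    moreover have "level (x + y) = level y" by (subst z, subst y(1)) simp
    ultimately show ?thesis by simp
  next
    case (2 xs)
    have z: "x + y = PPair (rooted jx vx px) (rooted iy uy (qy @ xs))" using 2 xy by (auto simp: prefix_def)
    have "awalk vy (py @ xs) wx" using x(6) 2 by simp
    then have "awalk wy xs wx" using y(7) by (metis awalk_append_iff awlast_if_cas awalkE)
    then have "awalk uy (qy @ xs) wx" using y(6) by (auto simp: awalk_append_iff dest!: awlast_if_cas awalkE)
    then have "x + y \<in> pairs" unfolding z
      using x y 2 by (intro pairs.intros[of _ _ _ _ _ wx]) auto
    moreover have "steps (x + y) \<subseteq> steps x \<union> steps y" unfolding z x(1) y(1) using 2 by auto
    moreover have "level (x + y) = level x" by (subst z, subst x(1)) (use x(8) y(8) 2 in simp)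
    ultimately show ?thesis by simp
  qed (use xy in auto)
  have m: "pathmon uy qy vy py * pathmon vy qx vx px \<asymp>
    (if prefix py qx then pathmon uy (qy @ drop (length py) qx) vx px
     else if prefix qx py then pathmon uy qy vx (px @ drop (length qx) py) else 0)" if "ux = vy"
    by (rule pathmon_mult[OF y(6,7) _ x(7)]) (use x(6) that in simp)
  have m0: "pathmon uy qy vy py * pathmon ux qx vx px \<asymp> 0" if "ux \<noteq> vy"
    by (rule pathmon_mult_distinct[OF y(6,7) x(6,7)]) (use that in simp)
  from cases have "entry i l (x + y) \<asymp>
      (if i = iy \<and> l = jx \<and> jy = ix then pathmon uy qy vy py * pathmon ux qx vx px else 0)"
  proof cases
    case (1 xs)
    have z: "x + y = PPair (rooted jx vx (px @ xs)) (rooted iy uy qy)" using 1 xy by simp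
    have "pathmon uy qy vy py * pathmon ux qx vx px \<asymp> pathmon uy qy vx (px @ xs)"
      using m 1 by (cases "xs = []") (auto simp: prefix_def)
    then show ?thesis unfolding z entry_rooted using 1 by (auto intro: cong_sym)
  next
    case (2 xs)
    have z: "x + y = PPair (rooted jx vx px) (rooted iy uy (qy @ xs))" using 2 xy by (auto simp: prefix_def)
    have "pathmon uy qy vy py * pathmon ux qx vx px \<asymp> pathmon uy (qy @ xs) vx px"
      using m 2 by auto
    then show ?thesis unfolding z entry_rooted using 2 by (auto intro: cong_sym)
  next
    case 3
    then show ?thesis using xy by auto
  next
    case 4
    then show ?thesis using xy cong_sym[OF m0] by auto
  next
    case 5
    then show ?thesis using xy m cong_sym by auto
  qed
  then show "entry i l (x + y) \<asymp> (\<Sum>j<k. entry i j y * entry j l x)" using sum by simp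
qed

lemma bounded_pairs_plus:
  "\<lbrakk>x \<in> bounded_pairs T N; y \<in> bounded_pairs T N\<rbrakk> \<Longrightarrow> x + y \<in> bounded_pairs T N"
  using pairs_plus(1)[of x y] unfolding bounded_pairs_def by fastforce

lemma finite_bounded_pairs:
  assumes "finite T"
  shows "finite (bounded_pairs T N)"
proof -
  \<comment> \<open>The level bounds a path up to the shift of its position, and the sum of all
    \<open>\<bar>dg i\<bar>\<close> is a uniform allowance for that shift.\<close>
  define B where "B = nat (N + (\<Sum>i<k. \<bar>dg i\<bar>))"
  define Ls where "Ls = {es. set es \<subseteq> T \<and> length es \<le> B}"
  define Ps where "Ps = (\<lambda>(i, v, es). rooted i v es) ` ({..<k} \<times> W \<times> Ls)"
  have "finite Ls" unfolding Ls_def by (rule finite_lists_length_le[OF assms])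
  then have fin: "finite Ps" unfolding Ps_def using finite_W by simp
  have dg: "\<bar>dg i\<bar> \<le> (\<Sum>i<k. \<bar>dg i\<bar>)" if "i < k" for i
    using that by (intro member_le_sum) auto
  have "x \<in> insert PZero ((\<lambda>(p, q). PPair p q) ` (Ps \<times> Ps))" if "x \<in> bounded_pairs T N" for x
  proof (cases "x = PZero")
    case False
    then have "x \<in> pairs" and xT: "steps x \<subseteq> T" "level x \<le> N" using that by (auto simp: bounded_pairs_def)
    then obtain i j u v qs w ps where x: "x = PPair (rooted j v ps) (rooted i u qs)"
      "i < k" "j < k" "u \<in> W" "v \<in> W" "int (length qs) - dg i = int (length ps) - dg j"
      by (cases rule: pairs.cases) blast
    have "int (length qs) \<le> N + dg i" "int (length ps) \<le> N + dg j" using x xT(2) by auto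
    then have "length qs \<le> B" "length ps \<le> B" unfolding B_def using dg[OF x(2)] dg[OF x(3)] by linarith+
    moreover have "set qs \<subseteq> T" "set ps \<subseteq> T" using xT(1) x(1) by auto
    ultimately have "(j, v, ps) \<in> {..<k} \<times> W \<times> Ls" "(i, u, qs) \<in> {..<k} \<times> W \<times> Ls"
      using x by (simp_all add: Ls_def)
    then have "rooted j v ps \<in> Ps" "rooted i u qs \<in> Ps"
      using imageI[of "(j, v, ps)" "{..<k} \<times> W \<times> Ls" "\<lambda>(i, v, es). rooted i v es"]
        imageI[of "(i, u, qs)" "{..<k} \<times> W \<times> Ls" "\<lambda>(i, v, es). rooted i v es"]
      by (simp_all only: Ps_def prod.case)
    then show ?thesis using x(1) by blast
  qed simp
  then have "bounded_pairs T N \<subseteq> insert PZero ((\<lambda>(p, q). PPair p q) ` (Ps \<times> Ps))" by (rule subsetI)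
  then show ?thesis using fin by (auto intro: finite_subset)
qed

lemma units_pairs: "units \<subseteq> pairs"
proof
  fix x assume "x \<in> units"
  then obtain i v where iv: "x = PPair (rooted i v []) (rooted i v [])" "i < k" "v \<in> W" by (auto simp: units_def)
  show "x \<in> pairs"
    unfolding iv(1) by (rule pairs.intros[of i i v v "[]" v "[]"]) (use iv W_verts in \<open>auto simp: awalk_Nil\<close>)
qed

text \<open>A unit at position \<open>i\<close> has level \<open>- dg i\<close>, so the sum of the
  absolute shifts dominates the levels of all units.\<close>

lemma units_bounded:
  assumes "(\<Sum>i<k. \<bar>dg i\<bar>) \<le> N"
  shows "units \<subseteq> bounded_pairs T N"
proof
  fix x assume x: "x \<in> units"
  then obtain i v where iv: "x = PPair (rooted i v []) (rooted i v [])" "i < k" by (auto simp: units_def)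
  have "\<bar>dg i\<bar> \<le> (\<Sum>i<k. \<bar>dg i\<bar>)" using iv(2) by (intro member_le_sum) auto
  then show "x \<in> bounded_pairs T N"
    using x units_pairs iv assms by (auto simp: bounded_pairs_def)
qed

text \<open>The root letter of each half singles out its unit: a one-letter word with another root
  is incomparable with that half, and the product is \<open>PZero\<close>.\<close>

lemma polycyclic_system_bounded_pairs:
  assumes "finite T" "(\<Sum>i<k. \<bar>dg i\<bar>) \<le> N"
  shows "polycyclic_system (bounded_pairs T N) units"
proof
  show "finite (bounded_pairs T N)" by (rule finite_bounded_pairs[OF assms(1)])
  show "units \<subseteq> bounded_pairs T N" by (rule units_bounded[OF assms(2)])
  show "PZero \<in> bounded_pairs T N" by (simp add: bounded_pairs_def)
next
  fix x assume "x \<in> bounded_pairs T N" "x \<noteq> PZero"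
  then have "x \<in> pairs" by (auto simp: bounded_pairs_def)
  then obtain i j u v qs w ps where x: "x = PPair (rooted j v ps) (rooted i u qs)"
      "i < k" "j < k" "u \<in> W" "v \<in> W" by (cases rule: pairs.cases) blast
  have "PPair (rooted j v []) (rooted j v []) \<in> units" "PPair (rooted i u []) (rooted i u []) \<in> units"
    using x by (auto simp: units_def)
  moreover have "PPair (rooted j v []) (rooted j v []) + x = x" by (simp add: x(1))
  moreover have "y + x = PZero" if "y \<in> units - {PPair (rooted j v []) (rooted j v [])}" for y
    using that by (auto simp: units_def x(1) split: if_splits)
  ultimately show "\<exists>u\<in>units. u + x = x \<and> (\<forall>v\<in>units - {u}. v + x = PZero)" by blast
  have "x + PPair (rooted i u []) (rooted i u []) = x" by (cases qs) (simp_all add: x(1))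
  moreover have "x + y = PZero" if "y \<in> units - {PPair (rooted i u []) (rooted i u [])}" for y
    using that by (auto simp: units_def x(1) split: if_splits)
  ultimately show "\<exists>u\<in>units. x + u = x \<and> (\<forall>v\<in>units - {u}. x + v = PZero)"
    using \<open>PPair (rooted i u []) (rooted i u []) \<in> units\<close> by blast
qed (rule bounded_pairs_plus)

section \<open>From the monoid algebra to matrices over the Leavitt path algebra\<close>

lemma entry_R: "x \<in> pairs \<Longrightarrow> entry i j x \<in> R"
  by (cases rule: pairs.cases) (auto simp: pathmon_R)

lemma homog_entry:
  assumes "x \<in> pairs"
  shows "homog (dg i - dg j) (entry i j x)"
  using assms
proof (cases rule: pairs.cases)
  case (1 i' j' u v qs w ps)
  then have "int (length qs) - int (length ps) = dg i' - dg j'" by simp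
  then have "homog (dg i' - dg j') (pathmon u qs v ps)" using homog_pathmon[of qs ps u v] by simp
  then show ?thesis using 1 by simp
qed

lemma entry_unit:
  assumes "x \<in> pairs"
  shows "entry i j x * unit W \<asymp> entry i j x"
  using assms
proof (cases rule: pairs.cases)
  case (1 i' j' u v qs w ps)
  then show ?thesis using pathmon_unit[OF 1(6,7) finite_W W_verts] by simp
qed

text \<open>All entries of \<open>PZero\<close> are zero, so the passage to matrices is also what
  identifies this basis vector with zero.\<close>

definition ent :: "nat \<Rightarrow> nat \<Rightarrow> (('v, 'e) letter polycyclic \<Rightarrow>\<^sub>0 'k) \<Rightarrow> ('v, 'e, 'k) lpa_free" where
  "ent i j b = lin (entry i j) b"

abbreviation "pairs0 \<equiv> insert PZero pairs"

lemma entry_R0: "x \<in> pairs0 \<Longrightarrow> entry i j x \<in> R"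
  using entry_R by auto

lemma ent_R: "Poly_Mapping.keys b \<subseteq> pairs0 \<Longrightarrow> ent i j b \<in> R"
  unfolding ent_def lin_def by (intro R_sum R_mult R_scalar entry_R0) auto

lemma homog_ent: "Poly_Mapping.keys b \<subseteq> pairs0 \<Longrightarrow> homog (dg i - dg j) (ent i j b)"
proof -
  assume b: "Poly_Mapping.keys b \<subseteq> pairs0"
  have "homog 0 (Poly_Mapping.single 0 c)" for c :: 'k
    by (simp add: homog_def word_degree_def zero_fmon_def)
  from homog_mult[OF this] show ?thesis
    unfolding ent_def lin_def using b homog_entry by (intro homog_sum) fastforce
qed

lemma ent_unit: "Poly_Mapping.keys b \<subseteq> pairs0 \<Longrightarrow> ent i j b * unit W \<asymp> ent i j b"
  unfolding ent_def lin_def sum_distrib_right mult.assoc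
  by (intro cong_sum cong_left R_scalar) (auto intro: entry_unit)

lemma ent_mult:
  assumes a: "Poly_Mapping.keys a \<subseteq> pairs0" and b: "Poly_Mapping.keys b \<subseteq> pairs0"
  shows "ent i l (a * b) \<asymp> (\<Sum>j<k. ent i j b * ent j l a)"
proof -
  let ?C = "\<lambda>c. Poly_Mapping.single 0 c :: ('v, 'e, 'k) lpa_free"
  let ?a = "Poly_Mapping.lookup a" and ?b = "Poly_Mapping.lookup b"
  have "ent i l (a * b) = (\<Sum>x\<in>Poly_Mapping.keys a. \<Sum>y\<in>Poly_Mapping.keys b. ?C (?a x * ?b y) * entry i l (x + y))"
    unfolding ent_def by (subst poly_mapping_mult_sum) (simp add: lin_sum lin_single)
  also have "\<dots> \<asymp> (\<Sum>x\<in>Poly_Mapping.keys a. \<Sum>y\<in>Poly_Mapping.keys b. ?C (?a x * ?b y) * (\<Sum>j<k. entry i j y * entry j l x))"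
  proof (intro cong_sum cong_left R_scalar)
    fix x y assume "x \<in> Poly_Mapping.keys a" "y \<in> Poly_Mapping.keys b"
    then show "entry i l (x + y) \<asymp> (\<Sum>j<k. entry i j y * entry j l x)"
      using a b pairs_plus(2)[of x y i l] by (cases "x = PZero \<or> y = PZero") auto
  qed
  also have "\<dots> = (\<Sum>x\<in>Poly_Mapping.keys a. \<Sum>y\<in>Poly_Mapping.keys b. \<Sum>j<k. ?C (?b y) * entry i j y * (?C (?a x) * entry j l x))"
  proof (intro sum.cong refl)
    fix x y
    have "?C (?a x * ?b y) * (p * q) = ?C (?b y) * p * (?C (?a x) * q)" for p q
    proof -
      have "?C (?b y) * p * (?C (?a x) * q) = ?C (?b y) * (p * ?C (?a x)) * q" by (simp add: mult.assoc)
      also have "\<dots> = ?C (?b y) * ?C (?a x) * (p * q)" by (simp only: single_0_central[of p] mult.assoc)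
      also have "?C (?b y) * ?C (?a x) = ?C (?a x * ?b y)" by (simp add: mult_single mult.commute)
      finally show ?thesis by (rule sym)
    qed
    then show "?C (?a x * ?b y) * (\<Sum>j<k. entry i j y * entry j l x) =
        (\<Sum>j<k. ?C (?b y) * entry i j y * (?C (?a x) * entry j l x))"
      by (simp add: sum_distrib_left)
  qed
  also have "\<dots> = (\<Sum>x\<in>Poly_Mapping.keys a. \<Sum>j<k. \<Sum>y\<in>Poly_Mapping.keys b. ?C (?b y) * entry i j y * (?C (?a x) * entry j l x))"
    by (intro sum.cong refl sum.swap)
  also have "\<dots> = (\<Sum>j<k. \<Sum>x\<in>Poly_Mapping.keys a. \<Sum>y\<in>Poly_Mapping.keys b. ?C (?b y) * entry i j y * (?C (?a x) * entry j l x))"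
    by (rule sum.swap)
  also have "\<dots> = (\<Sum>j<k. ent i j b * ent j l a)"
    unfolding ent_def lin_def sum_product by (intro sum.cong refl sum.swap)
  finally show ?thesis .
qed

lemma ent_orth_sum: "ent i j (orth_sum units) \<asymp> (if i = j \<and> i < k then unit W else 0)"
proof -
  have "ent i j (orth_sum units) = (\<Sum>u\<in>units. entry i j u)"
    unfolding ent_def orth_sum_def by (simp add: lin_diff lin_sum lin_single)
  also have "\<dots> = (\<Sum>(i', v)\<in>{..<k} \<times> W. entry i j (PPair (rooted i' v []) (rooted i' v [])))"
    unfolding units_def by (subst sum.reindex) (auto simp: inj_on_def intro!: sum.cong)
  also have "\<dots> = (\<Sum>i'<k. \<Sum>v\<in>W. entry i j (PPair (rooted i' v []) (rooted i' v [])))"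
    by (rule sum.cartesian_product[symmetric])
  also have "\<dots> = (\<Sum>i'<k. if i' = i then (if i = j then (\<Sum>v\<in>W. pathmon v [] v []) else 0) else 0)"
    by (intro sum.cong refl) auto
  also have "\<dots> = (if i = j \<and> i < k then (\<Sum>v\<in>W. pathmon v [] v []) else 0)"
    by (simp add: sum.delta)
  also have "\<dots> \<asymp> (if i = j \<and> i < k then unit W else 0)"
  proof -
    have "(\<Sum>v\<in>W. pathmon v [] v []) \<asymp> (\<Sum>v\<in>W. V v)"
      by (intro cong_sum) (use V_idem W_verts in \<open>auto simp: pathmon_def\<close>)
    then show ?thesis by (simp add: unit_def)
  qed
  finally show ?thesis .
qed

section \<open>The action of the monoid algebra on row vectors\<close>

definition act :: "(('v, 'e) letter polycyclic \<Rightarrow>\<^sub>0 'k) \<Rightarrow> (nat \<Rightarrow> ('v, 'e, 'k) lpa_free set) \<Rightarrow>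
    nat \<Rightarrow> ('v, 'e, 'k) lpa_free set" where
  "act b f j = (if j < k then cls (\<Sum>i<k. rep (f i) * ent i j b) else \<zero>\<^bsub>A\<^esub>)"

lemma F_rep:
  assumes "f \<in> carrier F"
  shows "rep (f i) \<in> Aug" "rep (f i) \<in> R" "cls (rep (f i)) = f i" "rep (f i) * unit W \<asymp> rep (f i)"
proof -
  have f: "f i \<in> carrier A" "f i \<otimes>\<^bsub>A\<^esub> e = f i" using assms by (auto simp: F_simps)
  show *: "rep (f i) \<in> Aug" "rep (f i) \<in> R" "cls (rep (f i)) = f i"
    using f rep_Aug rep_R cls_rep by auto
  have "cls (rep (f i) * unit W) = cls (rep (f i))"
    using f(2) * unit_W by (metis e_def mult_A)
  then show "rep (f i) * unit W \<asymp> rep (f i)" by (simp add: cls_eq_iff)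
qed

lemma act_Aug:
  assumes "Poly_Mapping.keys b \<subseteq> pairs0" "f \<in> carrier F"
  shows "(\<Sum>i<k. rep (f i) * ent i j b) \<in> Aug"
  using F_rep[OF assms(2)] ent_R[OF assms(1)] by (intro Aug_sum Aug_mult_right) auto

text \<open>Congruence is compatible with right multiplication by entries, so any convenient
  representatives may stand in for those chosen by \<open>rep\<close>.\<close>

lemma act_cong:
  assumes b: "Poly_Mapping.keys b \<subseteq> pairs0" and r: "\<And>i. i < k \<Longrightarrow> f i = cls (r i)" "\<And>i. i < k \<Longrightarrow> r i \<in> Aug" and "j < k"
  shows "act b f j = cls (\<Sum>i<k. r i * ent i j b)"
proof -
  have "(\<Sum>i<k. rep (f i) * ent i j b) \<asymp> (\<Sum>i<k. r i * ent i j b)"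
    using r rep_cls ent_R[OF b] by (intro cong_sum cong_right) auto
  then show ?thesis using \<open>j < k\<close> by (simp add: act_def cls_eq_iff)
qed

lemma act_F:
  assumes b: "Poly_Mapping.keys b \<subseteq> pairs0" and f: "f \<in> carrier F"
  shows "act b f \<in> carrier F"
proof -
  have "act b f j \<in> carrier A \<and> act b f j \<otimes>\<^bsub>A\<^esub> e = act b f j" if "j < k" for j
  proof
    let ?s = "\<Sum>i<k. rep (f i) * ent i j b"
    have s: "?s \<in> Aug" by (rule act_Aug[OF b f])
    then show "act b f j \<in> carrier A" using that by (simp add: act_def cls_Aug)
    have "?s * unit W \<asymp> ?s"
      unfolding sum_distrib_right mult.assoc
      using F_rep[OF f] ent_unit[OF b] by (intro cong_sum cong_left) auto
    then show "act b f j \<otimes>\<^bsub>A\<^esub> e = act b f j"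
      using s that unit_W by (simp add: act_def e_def mult_A Aug_R cls_eq_iff)
  qed
  then show ?thesis using e_A mult_A_zero by (auto simp: F_simps act_def)
qed

lemma act_hom:
  assumes b: "Poly_Mapping.keys b \<subseteq> pairs0"
  shows "act b \<in> gmod_hom A F F"
proof (rule gmod_homI)
  fix f g assume fg: "f \<in> carrier F" "g \<in> carrier F"
  show "act b (f \<oplus>\<^bsub>F\<^esub> g) = act b f \<oplus>\<^bsub>F\<^esub> act b g"
  proof
    fix j
    show "act b (f \<oplus>\<^bsub>F\<^esub> g) j = (act b f \<oplus>\<^bsub>F\<^esub> act b g) j"
    proof (cases "j < k")
      case True
      have "act b (f \<oplus>\<^bsub>F\<^esub> g) j = cls (\<Sum>i<k. (rep (f i) + rep (g i)) * ent i j b)"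
      proof (rule act_cong[OF b _ _ True])
        fix i
        show "(f \<oplus>\<^bsub>F\<^esub> g) i = cls (rep (f i) + rep (g i))"
          using add_A[OF F_rep(2)[OF fg(1), of i] F_rep(2)[OF fg(2), of i]]
            F_rep(3)[OF fg(1), of i] F_rep(3)[OF fg(2), of i] by (simp only: F_simps)
      qed (use F_rep[OF fg(1)] F_rep[OF fg(2)] in \<open>auto intro: Aug_add\<close>)
      also have "\<dots> = act b f j \<oplus>\<^bsub>A\<^esub> act b g j"
        using True act_Aug[OF b fg(1)] act_Aug[OF b fg(2)]
        by (simp add: act_def add_A Aug_R distrib_right sum.distrib)
      finally show ?thesis by (simp add: F_simps)
    qed (simp add: act_def F_simps)
  qed
next
  fix a f assume a: "a \<in> carrier A" and f: "f \<in> carrier F"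
  show "act b (a \<odot>\<^bsub>F\<^esub> f) = a \<odot>\<^bsub>F\<^esub> act b f"
  proof
    fix j
    show "act b (a \<odot>\<^bsub>F\<^esub> f) j = (a \<odot>\<^bsub>F\<^esub> act b f) j"
    proof (cases "j < k")
      case True
      have ra: "rep a \<in> Aug" "rep a \<in> R" "cls (rep a) = a" using a rep_Aug rep_R cls_rep by auto
      have "act b (a \<odot>\<^bsub>F\<^esub> f) j = cls (\<Sum>i<k. rep a * rep (f i) * ent i j b)"
      proof (rule act_cong[OF b _ _ True])
        fix i
        show "(a \<odot>\<^bsub>F\<^esub> f) i = cls (rep a * rep (f i))"
          using mult_A[OF ra(2) F_rep(2)[OF f, of i]] ra(3) F_rep(3)[OF f, of i] by (simp only: F_simps)
      qed (use F_rep[OF f] ra in \<open>auto intro: Aug_mult_left\<close>)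
      also have "\<dots> = cls (rep a * (\<Sum>i<k. rep (f i) * ent i j b))"
        by (simp add: sum_distrib_left mult.assoc)
      also have "\<dots> = cls (rep a) \<otimes>\<^bsub>A\<^esub> cls (\<Sum>i<k. rep (f i) * ent i j b)"
        by (rule mult_A[symmetric, OF ra(2) Aug_R[OF act_Aug[OF b f]]])
      also have "\<dots> = (a \<odot>\<^bsub>F\<^esub> act b f) j" using True ra(3) by (simp add: F_simps act_def)
      finally show ?thesis .
    qed (use a mult_A_zero in \<open>simp add: act_def F_simps\<close>)
  qed
next
  fix n f assume f: "f \<in> grade F n"
  then have fF: "f \<in> carrier F" by (rule grade_F_carrier)
  have "\<exists>r. \<forall>i. r i \<in> Aug \<and> homog (n - dg i) (r i) \<and> f i = cls (r i)"
    using f by (intro choice) (auto simp: F_simps rgrade_A)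
  then obtain r where r: "\<And>i. r i \<in> Aug" "\<And>i. homog (n - dg i) (r i)" "\<And>i. f i = cls (r i)" by blast
  have "act b f j \<in> rgrade A (n - dg j)" if j: "j < k" for j
  proof -
    have "homog (n - dg j) (\<Sum>i<k. r i * ent i j b)"
    proof (rule homog_sum)
      fix i
      have "n - dg i + (dg i - dg j) = n - dg j" by simp
      then show "homog (n - dg j) (r i * ent i j b)"
        using homog_mult[OF r(2)[of i] homog_ent[OF b, of i j]] by (simp only:)
    qed
    moreover have "(\<Sum>i<k. r i * ent i j b) \<in> Aug"
      using r(1) ent_R[OF b] by (intro Aug_sum Aug_mult_right) (auto simp: Aug_R)
    ultimately show ?thesis using act_cong[OF b r(3) r(1) j] by (simp add: rgrade_A)
  qed
  then have "act b f j \<in> rgrade A (n - dg j)" for j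
    by (cases "j < k") (auto simp: act_def)
  then show "act b f \<in> grade F n"
    using act_F[OF b fF] by (simp add: F_simps)
qed (rule act_F[OF b])

lemma act_mult:
  assumes a: "Poly_Mapping.keys a \<subseteq> pairs0" and b: "Poly_Mapping.keys b \<subseteq> pairs0" and f: "f \<in> carrier F"
  shows "act (a * b) f = act a (act b f)"
proof
  fix l
  show "act (a * b) f l = act a (act b f) l"
  proof (cases "l < k")
    case True
    have "act a (act b f) l = cls (\<Sum>j<k. (\<Sum>i<k. rep (f i) * ent i j b) * ent j l a)"
      by (rule act_cong[OF a _ act_Aug[OF b f] True]) (simp add: act_def)
    also have "(\<Sum>j<k. (\<Sum>i<k. rep (f i) * ent i j b) * ent j l a) = (\<Sum>i<k. rep (f i) * (\<Sum>j<k. ent i j b * ent j l a))"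
      unfolding sum_distrib_right sum_distrib_left mult.assoc by (rule sum.swap)
    also have "cls \<dots> = cls (\<Sum>i<k. rep (f i) * ent i l (a * b))"
      unfolding cls_eq_iff using F_rep[OF f] ent_mult[OF a b] by (intro cong_sum cong_left) (auto intro: cong_sym)
    finally show ?thesis using True by (simp add: act_def)
  qed (simp add: act_def)
qed

lemma act_add:
  assumes a: "Poly_Mapping.keys a \<subseteq> pairs0" and b: "Poly_Mapping.keys b \<subseteq> pairs0" and f: "f \<in> carrier F"
  shows "act (a + b) f = act a f \<oplus>\<^bsub>F\<^esub> act b f"
  using act_Aug[OF a f] act_Aug[OF b f]
  by (auto simp: act_def F_simps fun_eq_iff add_A Aug_R ent_def lin_add distrib_left sum.distrib)

lemma act_orth_sum:
  assumes f: "f \<in> carrier F"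
  shows "act (orth_sum units) f = f"
proof
  fix j
  show "act (orth_sum units) f j = f j"
  proof (cases "j < k")
    case True
    have "(\<Sum>i<k. rep (f i) * ent i j (orth_sum units)) \<asymp> (\<Sum>i<k. rep (f i) * (if i = j \<and> i < k then unit W else 0))"
      using F_rep[OF f] by (intro cong_sum cong_left ent_orth_sum)
    also have "\<dots> = (\<Sum>i<k. if i = j then rep (f j) * unit W else 0)" by (intro sum.cong refl) auto
    also have "\<dots> = rep (f j) * unit W" using True by (simp add: sum.delta)
    also have "\<dots> \<asymp> rep (f j)" using F_rep[OF f] by blast
    finally have "cls (\<Sum>i<k. rep (f i) * ent i j (orth_sum units)) = f j"
      using F_rep[OF f] by (simp add: cls_eq_iff[symmetric])
    then show ?thesis using True by (simp add: act_def)
  qed (use f in \<open>simp add: act_def F_simps\<close>)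
qed

text \<open>Each word in a representative of \<open>a\<close> is congruent to zero or to a monomial
  of the required degree, and multiplying by \<open>unit W\<close> on both sides discards the
  monomials with an outer vertex outside \<open>W\<close>. Since \<open>b\<close> vanishes at all
  other positions, a whole matrix can later be assembled by addition.\<close>

lemma entry_span:
  assumes ij: "i < k" "j < k" and a: "a \<in> rgrade A (dg i - dg j)" "e \<otimes>\<^bsub>A\<^esub> a = a" "a \<otimes>\<^bsub>A\<^esub> e = a"
  obtains b where "Poly_Mapping.keys b \<subseteq> pairs0" "cls (ent i j b) = a"
    "\<And>i' j'. (i', j') \<noteq> (i, j) \<Longrightarrow> ent i' j' b = 0"
proof -
  obtain p where p: "p \<in> Aug" "homog (dg i - dg j) p" "a = cls p" using a(1) by (auto simp: rgrade_A)
  define s where "s w = (Poly_Mapping.single w 1 :: ('v, 'e, 'k) lpa_free)" for w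
  have "\<exists>b. Poly_Mapping.keys b \<subseteq> pairs0 \<and> ent i j b \<asymp> unit W * s w * unit W \<and>
      (\<forall>i' j'. (i', j') \<noteq> (i, j) \<longrightarrow> ent i' j' b = 0)" if w: "w \<in> Poly_Mapping.keys p" for w
  proof -
    have "w \<in> words" "w \<noteq> 0" and deg: "deg w = dg i - dg j"
      using w p by (auto simp: Aug_iff R_iff in_keys_iff homog_def)
    then obtain xs where xs: "w = Word xs" "set xs \<subseteq> lpa_gens E" "xs \<noteq> []"
      by (cases w) (auto simp: words_def zero_fmon_def)
    have zero: ?thesis if "s w \<asymp> 0 \<or> unit W * s w * unit W \<asymp> 0"
    proof -
      have "unit W * s w * unit W \<asymp> 0"
        using that cong_right[OF cong_left[of "s w" 0 "unit W"], of "unit W"] unit_W by auto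
      then show ?thesis by (intro exI[of _ 0]) (auto simp: ent_def intro: cong_sym)
    qed
    from word_pathmon[OF xs(2,3)] consider "s w \<asymp> 0"
      | v es u fs x where "awalk v es x" "awalk u fs x" "s w \<asymp> pathmon v es u fs"
        "int (length es) - int (length fs) = deg (Word xs)"
      unfolding s_def xs(1) by blast
    then show ?thesis
    proof cases
      case 1
      then show ?thesis using zero by blast
    next
      case 2
      have "unit W * s w * unit W \<asymp> unit W * pathmon v es u fs * unit W"
        using 2(3) unit_W by (intro cong_left cong_right) auto
      also have "\<dots> \<asymp> (if v \<in> W then pathmon v es u fs else 0) * unit W"
        using unit_pathmon[OF 2(1,2) finite_W W_verts] unit_W by (intro cong_right)
      also have "\<dots> \<asymp> (if v \<in> W \<and> u \<in> W then pathmon v es u fs else 0)"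
        using pathmon_unit[OF 2(1,2) finite_W W_verts] by auto
      finally have *: "unit W * s w * unit W \<asymp> (if v \<in> W \<and> u \<in> W then pathmon v es u fs else 0)" .
      show ?thesis
      proof (cases "v \<in> W \<and> u \<in> W")
        case True
        let ?x = "PPair (rooted j u fs) (rooted i v es)"
        have "?x \<in> pairs"
          using ij True 2 deg xs(1) by (intro pairs.intros[of i j v u es x fs]) auto
        moreover have "ent i' j' (Poly_Mapping.single ?x 1) = entry i' j' ?x" for i' j'
          by (simp add: ent_def lin_single)
        ultimately show ?thesis
          using * True by (intro exI[of _ "Poly_Mapping.single ?x 1"]) (auto intro: cong_sym)
      next
        case False
        then show ?thesis using * zero by auto
      qed
    qed
  qed
  then obtain B where B: "\<And>w. w \<in> Poly_Mapping.keys p \<Longrightarrow> Poly_Mapping.keys (B w) \<subseteq> pairs0"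
    "\<And>w. w \<in> Poly_Mapping.keys p \<Longrightarrow> ent i j (B w) \<asymp> unit W * s w * unit W"
    "\<And>w i' j'. w \<in> Poly_Mapping.keys p \<Longrightarrow> (i', j') \<noteq> (i, j) \<Longrightarrow> ent i' j' (B w) = 0" by metis
  let ?c = "Poly_Mapping.lookup p"
  define b where "b = (\<Sum>w\<in>Poly_Mapping.keys p. Poly_Mapping.single 0 (?c w) * B w)"
  have ent_b: "ent i' j' b = (\<Sum>w\<in>Poly_Mapping.keys p. Poly_Mapping.single 0 (?c w) * ent i' j' (B w))" for i' j'
    unfolding b_def ent_def by (simp add: lin_sum lin_scale)
  have "Poly_Mapping.keys (Poly_Mapping.single 0 (?c w) * B w) \<subseteq> pairs0" if "w \<in> Poly_Mapping.keys p" for w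
    by (rule keys_mult_closed[of _ "{0}" _ pairs0]) (use B(1)[OF that] in auto)
  then have keys: "Poly_Mapping.keys b \<subseteq> pairs0" unfolding b_def by (rule keys_sum_subset)
  have "ent i j b \<asymp> (\<Sum>w\<in>Poly_Mapping.keys p. Poly_Mapping.single 0 (?c w) * (unit W * s w * unit W))"
    unfolding ent_b by (intro cong_sum cong_left B(2) R_scalar)
  also have "\<dots> = unit W * (\<Sum>w\<in>Poly_Mapping.keys p. Poly_Mapping.single 0 (?c w) * s w) * unit W"
  proof -
    have "Poly_Mapping.single 0 c * (unit W * s w * unit W) = unit W * (Poly_Mapping.single 0 c * s w) * unit W" for c w
    proof -
      have "unit W * (Poly_Mapping.single 0 c * s w) * unit W = unit W * Poly_Mapping.single 0 c * (s w * unit W)"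
        by (simp only: mult.assoc)
      also have "\<dots> = Poly_Mapping.single 0 c * unit W * (s w * unit W)" by (simp only: single_0_central)
      finally show ?thesis by (simp only: mult.assoc)
    qed
    then show ?thesis by (simp only: sum_distrib_left sum_distrib_right)
  qed
  also have "(\<Sum>w\<in>Poly_Mapping.keys p. Poly_Mapping.single 0 (?c w) * s w) = p"
    using poly_mapping_sum_single[of p] by (simp add: s_def mult_single)
  also have "unit W * p * unit W \<asymp> p"
  proof -
    have "cls (unit W * p * unit W) = e \<otimes>\<^bsub>A\<^esub> a \<otimes>\<^bsub>A\<^esub> e"
      using p unit_W by (simp add: e_def mult_A Aug_R R_mult)
    then show ?thesis using a p(3) by (simp add: cls_eq_iff[symmetric])
  qed
  finally have "cls (ent i j b) = a" using p(3) by (simp add: cls_eq_iff)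
  moreover have "ent i' j' b = 0" if "(i', j') \<noteq> (i, j)" for i' j'
    unfolding ent_b using B(3)[OF _ that] by simp
  ultimately show ?thesis using that keys by blast
qed

section \<open>Coordinates, surjectivity of the action, and stable range one for
  \<open>F\<close>\<close>

definition basis :: "nat \<Rightarrow> nat \<Rightarrow> ('v, 'e, 'k) lpa_free set" where
  "basis i = (\<lambda>j. if j = i then e else \<zero>\<^bsub>A\<^esub>)"

lemma basis_grade: "i < k \<Longrightarrow> basis i \<in> grade F (dg i)"
  using e_grade e_idem mult_A_zero(2)[OF e_A] by (auto simp: basis_def F_simps)

lemma basis_F: "i < k \<Longrightarrow> basis i \<in> carrier F"
  using basis_grade grade_F_carrier by blast

sublocale FG: unital_graded_module A F
  by (rule unital_graded_module_F)

lemma basis_expansion: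
  assumes f: "f \<in> carrier F"
  shows "f = finsum F (\<lambda>i. f i \<odot>\<^bsub>F\<^esub> basis i) {..<k}"
proof
  fix j
  have fA: "f i \<in> carrier A" "f i \<otimes>\<^bsub>A\<^esub> e = f i" for i using f by (auto simp: F_simps)
  have "finsum F (\<lambda>i. f i \<odot>\<^bsub>F\<^esub> basis i) {..<k} j = finsum A (\<lambda>i. (f i \<odot>\<^bsub>F\<^esub> basis i) j) {..<k}"
    using fA basis_F by (intro finsum_F FG.smult_closed) auto
  also have "\<dots> = finsum A (\<lambda>i. if j = i then f j else \<zero>\<^bsub>A\<^esub>) {..<k}"
    using fA mult_A_zero by (intro A.finsum_cong') (auto simp: F_simps basis_def)
  also have "\<dots> = f j"
  proof (cases "j < k")
    case True
    then show ?thesis using A.finsum_singleton[of j "{..<k}" "\<lambda>_. f j"] fA by simp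
  next
    case False
    then have "finsum A (\<lambda>i. if j = i then f j else \<zero>\<^bsub>A\<^esub>) {..<k} = finsum A (\<lambda>_. \<zero>\<^bsub>A\<^esub>) {..<k}"
      by (intro A.finsum_cong') auto
    then show ?thesis using f False by (simp add: F_simps)
  qed
  finally show "f j = finsum F (\<lambda>i. f i \<odot>\<^bsub>F\<^esub> basis i) {..<k} j" by simp
qed

lemma hom_F_eq:
  assumes M: "graded_module A M" and h: "h \<in> gmod_hom A F M" "h' \<in> gmod_hom A F M"
    and eq: "\<And>i. i < k \<Longrightarrow> h (basis i) = h' (basis i)" and f: "f \<in> carrier F"
  shows "h f = h' f"
proof -
  interpret M: graded_module A M by fact
  interpret gmod_pair A F M ..
  have fA: "f i \<in> carrier A" for i using f by (auto simp: F_simps)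
  have "g f = finsum M (\<lambda>i. f i \<odot>\<^bsub>M\<^esub> g (basis i)) {..<k}" if g: "g \<in> gmod_hom A F M" for g
  proof -
    have "g f = finsum M (\<lambda>i. g (f i \<odot>\<^bsub>F\<^esub> basis i)) {..<k}"
      by (subst basis_expansion[OF f], rule hom_finsum[OF g]) (use fA basis_F FG.smult_closed in auto)
    also have "\<dots> = finsum M (\<lambda>i. f i \<odot>\<^bsub>M\<^esub> g (basis i)) {..<k}"
      using fA basis_F by (intro M.finsum_cong') (auto simp: gmod_hom_smult[OF g] M.smult_closed gmod_hom_closed[OF g])
    finally show ?thesis .
  qed
  note expand = this
  show ?thesis
    unfolding expand[OF h(1)] expand[OF h(2)] using fA eq basis_F
    by (intro M.finsum_cong') (auto simp: M.smult_closed gmod_hom_closed[OF h(2)])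
qed

text \<open>The \<open>i\<close>-th row of the matrix of \<open>D\<close> is
  \<open>D (basis i)\<close>. As \<open>basis i\<close> has degree \<open>dg i\<close> and is fixed
  by \<open>e\<close>, the entries of this row have the right degrees and lie in the corner of
  \<open>e\<close>, so each is the entry of some element of the monoid algebra.\<close>

lemma act_surj:
  assumes D: "D \<in> gmod_hom A F F"
  obtains b where "Poly_Mapping.keys b \<subseteq> pairs0" "\<And>f. f \<in> carrier F \<Longrightarrow> act b f = D f"
proof -
  define m where "m i j = D (basis i) j" for i j
  have DF: "D (basis i) \<in> carrier F" "D (basis i) \<in> grade F (dg i)" if "i < k" for i
    using that basis_grade basis_F gmod_hom_grade[OF D] gmod_hom_closed[OF D] by auto
  have eb: "e \<odot>\<^bsub>F\<^esub> basis i = basis i" for i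
    by (rule ext) (simp add: F_simps basis_def e_idem mult_A_zero e_A)
  have "\<exists>b. Poly_Mapping.keys b \<subseteq> pairs0 \<and> cls (ent i j b) = m i j \<and>
      (\<forall>i' j'. (i', j') \<noteq> (i, j) \<longrightarrow> ent i' j' b = 0)" if ij: "i < k" "j < k" for i j
  proof -
    have "m i j \<in> rgrade A (dg i - dg j)" "m i j \<otimes>\<^bsub>A\<^esub> e = m i j"
      using DF[OF ij(1)] by (auto simp: m_def F_simps)
    moreover have "e \<odot>\<^bsub>F\<^esub> D (basis i) = D (basis i)"
      using gmod_hom_smult[OF D e_A basis_F[OF ij(1)]] eb by simp
    then have "e \<otimes>\<^bsub>A\<^esub> m i j = m i j" by (auto simp: F_simps m_def dest: fun_cong[of _ _ j])
    ultimately show ?thesis using entry_span[OF ij, of "m i j"] by metis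
  qed
  then obtain B where B: "\<And>i j. i < k \<Longrightarrow> j < k \<Longrightarrow> Poly_Mapping.keys (B i j) \<subseteq> pairs0"
    "\<And>i j. i < k \<Longrightarrow> j < k \<Longrightarrow> cls (ent i j (B i j)) = m i j"
    "\<And>i j i' j'. i < k \<Longrightarrow> j < k \<Longrightarrow> (i', j') \<noteq> (i, j) \<Longrightarrow> ent i' j' (B i j) = 0" by metis
  define b where "b = (\<Sum>(i, j)\<in>{..<k} \<times> {..<k}. B i j)"
  have keys: "Poly_Mapping.keys b \<subseteq> pairs0" unfolding b_def using B(1) by (intro keys_sum_subset) auto
  have ent_b: "ent i j b = ent i j (B i j)" if "i < k" "j < k" for i j
  proof -
    have "ent i j b = (\<Sum>x\<in>{..<k} \<times> {..<k}. ent i j (B (fst x) (snd x)))"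
      unfolding b_def ent_def by (simp add: lin_sum case_prod_beta)
    also have "\<dots> = (\<Sum>x\<in>{..<k} \<times> {..<k}. if x = (i, j) then ent i j (B i j) else 0)"
      using B(3) by (intro sum.cong refl) (auto, metis+)
    finally show ?thesis using that by (simp add: sum.delta)
  qed
  have "act b (basis i) = D (basis i)" if i: "i < k" for i
  proof
    fix j
    show "act b (basis i) j = D (basis i) j"
    proof (cases "j < k")
      case True
      have "act b (basis i) j = cls (\<Sum>i'<k. (if i' = i then unit W else 0) * ent i' j b)"
        by (rule act_cong[OF keys _ _ True]) (use unit_W in \<open>auto simp: basis_def e_def zero_A\<close>)
      also have "(\<Sum>i'<k. (if i' = i then unit W else 0) * ent i' j b) = (\<Sum>i'<k. if i' = i then unit W * ent i j b else 0)"
        by (intro sum.cong refl) auto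
      also have "\<dots> = unit W * ent i j b" using i by (simp add: sum.delta)
      also have "cls (unit W * ent i j b) = e \<otimes>\<^bsub>A\<^esub> m i j"
        using mult_A[OF unit_W(2) ent_R[OF keys, of i j]] B(2)[OF i True] by (simp only: e_def ent_b[OF i True])
      also have "\<dots> = (e \<odot>\<^bsub>F\<^esub> D (basis i)) j" by (simp add: F_simps m_def)
      also have "e \<odot>\<^bsub>F\<^esub> D (basis i) = D (basis i)"
        using gmod_hom_smult[OF D e_A basis_F[OF i]] eb by simp
      finally show ?thesis .
    qed (use DF(1)[OF i] in \<open>simp add: act_def F_simps\<close>)
  qed
  then have "act b f = D f" if "f \<in> carrier F" for f
    by (intro hom_F_eq[OF FG.graded_module_axioms act_hom[OF keys] D _ that])
  then show ?thesis using that keys by blast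
qed

text \<open>Stable range one passes to images: \<open>D\<close> and \<open>D'\<close> are lifted
  along \<open>act\<close>, the problem is solved in a finite-dimensional algebra that contains both
  lifts, and the solution is mapped back.\<close>

theorem sr1_F: "sr1 A F"
  unfolding sr1_def
proof (intro ballI)
  interpret FF: gmod_pair A F F ..
  fix D D' assume D: "D \<in> gmod_hom A F F" and D': "D' \<in> gmod_hom A F F"
  obtain d where d: "Poly_Mapping.keys d \<subseteq> pairs0" "\<And>f. f \<in> carrier F \<Longrightarrow> act d f = D f"
    using act_surj[OF D] by blast
  obtain d' where d': "Poly_Mapping.keys d' \<subseteq> pairs0" "\<And>f. f \<in> carrier F \<Longrightarrow> act d' f = D' f"
    using act_surj[OF D'] by blast
  let ?Q = "Poly_Mapping.keys d \<union> Poly_Mapping.keys d'"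
  define T where "T = (\<Union>x\<in>?Q. steps x)"
  \<comment> \<open>The inserted sum makes room for \<open>units\<close>; the other values are the
    levels that occur in the two lifts.\<close>
  define N where "N = Max (insert (\<Sum>i<k. \<bar>dg i\<bar>) (level ` ?Q))"
  have T: "finite T" unfolding T_def using finite_steps by auto
  have N: "(\<Sum>i<k. \<bar>dg i\<bar>) \<le> N" "\<And>x. x \<in> ?Q \<Longrightarrow> level x \<le> N" unfolding N_def by auto
  interpret S: polycyclic_system "bounded_pairs T N" units
    by (rule polycyclic_system_bounded_pairs[OF T N(1)])
  have sub: "?Q \<subseteq> bounded_pairs T N"
    using d(1) d'(1) N(2) by (auto simp: bounded_pairs_def T_def)
  have sub0: "bounded_pairs T N \<subseteq> pairs0" by (auto simp: bounded_pairs_def)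
  let ?e = "orth_sum units :: ('v, 'e) letter polycyclic \<Rightarrow>\<^sub>0 'k"
  obtain y u where yu: "Poly_Mapping.keys y \<subseteq> bounded_pairs T N" "Poly_Mapping.keys u \<subseteq> bounded_pairs T N"
    "(d + (?e - d * d') * y) * u = ?e" "u * (d + (?e - d * d') * y) = ?e"
    using S.stable_range_one[of d d'] sub by blast
  have y: "Poly_Mapping.keys y \<subseteq> pairs0" and u: "Poly_Mapping.keys u \<subseteq> pairs0" using yu sub0 by blast+
  have closed: "Poly_Mapping.keys (a * b) \<subseteq> pairs0" if "Poly_Mapping.keys a \<subseteq> pairs0" "Poly_Mapping.keys b \<subseteq> pairs0"
    for a b :: "('v, 'e) letter polycyclic \<Rightarrow>\<^sub>0 'k"
  proof (rule keys_mult_closed[OF that])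
    fix x z assume "x \<in> pairs0" "z \<in> pairs0"
    then show "x + z \<in> pairs0" using pairs_plus(1)[of x z] by auto
  qed
  have e: "Poly_Mapping.keys ?e \<subseteq> pairs0" using S.orth_sum_keys sub0 by blast
  have ey: "?e * y = y" by (rule S.orth_sum_mult[OF yu(1)])
  \<comment> \<open>As \<open>?e * y = y\<close>, this is the defect times \<open>y\<close>, in the
    form that \<open>act\<close> turns into the difference required by \<open>sr1\<close>.\<close>
  define c where "c = y - d * (d' * y)"
  have c: "Poly_Mapping.keys c \<subseteq> pairs0"
    unfolding c_def by (intro keys_minus_subset closed y d(1) d'(1))
  have eq: "d + (?e - d * d') * y = d + c" by (simp add: c_def left_diff_distrib ey mult.assoc)
  have dc: "Poly_Mapping.keys (d + c) \<subseteq> pairs0"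
    using Poly_Mapping.keys_add[of d c] d(1) c by blast
  have act_c: "act c f = act y f \<ominus>\<^bsub>F\<^esub> D (D' (act y f))" if f: "f \<in> carrier F" for f
  proof -
    have yf: "act y f \<in> carrier F" by (rule act_F[OF y f])
    have D'y: "D' (act y f) \<in> carrier F" by (rule gmod_hom_closed[OF D' yf])
    have "act (d * (d' * y)) f = D (D' (act y f))"
      using act_mult[OF d(1) closed[OF d'(1) y] f] act_mult[OF d'(1) y f] d(2)[OF D'y] d'(2)[OF yf] by simp
    moreover have "act y f = act (d * (d' * y)) f \<oplus>\<^bsub>F\<^esub> act c f"
      using act_add[OF closed[OF d(1) closed[OF d'(1) y]] c f] by (simp add: c_def)
    ultimately show ?thesis
      using FM.add_diff_cancel[of "D (D' (act y f))" "act c f"] act_F[OF c f] gmod_hom_closed[OF D D'y] by simp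
  qed
  have act_dc: "act (d + c) f = D f \<oplus>\<^bsub>F\<^esub> (act y f \<ominus>\<^bsub>F\<^esub> D (D' (act y f)))" if f: "f \<in> carrier F" for f
    using act_add[OF d(1) c f] act_c[OF f] d(2)[OF f] by simp
  show "\<exists>y\<in>gmod_hom A F F. \<exists>u\<in>gmod_hom A F F. \<forall>x\<in>carrier F.
      D (u x) \<oplus>\<^bsub>F\<^esub> (y (u x) \<ominus>\<^bsub>F\<^esub> D (D' (y (u x)))) = x \<and> u (D x \<oplus>\<^bsub>F\<^esub> (y x \<ominus>\<^bsub>F\<^esub> D (D' (y x)))) = x"
  proof (rule bexI[OF _ act_hom[OF y]], rule bexI[OF _ act_hom[OF u]], intro ballI conjI)
    fix x assume x: "x \<in> carrier F"
    have ux: "act u x \<in> carrier F" by (rule act_F[OF u x])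
    show "D (act u x) \<oplus>\<^bsub>F\<^esub> (act y (act u x) \<ominus>\<^bsub>F\<^esub> D (D' (act y (act u x)))) = x"
      using act_dc[OF ux] act_mult[OF dc u x] yu(3) act_orth_sum[OF x] by (simp add: eq)
    show "act u (D x \<oplus>\<^bsub>F\<^esub> (act y x \<ominus>\<^bsub>F\<^esub> D (D' (act y x)))) = x"
      using act_dc[OF x] act_mult[OF u dc x] yu(4) act_orth_sum[OF x] by (simp add: eq)
  qed
qed

text \<open>The universal property of \<open>F\<close>: homogeneous elements of degrees
  \<open>dg i\<close> that are fixed by \<open>e\<close> are possible images of the basis
  vectors.\<close>

lemma eval_hom:
  assumes M: "unital_graded_module A M" and s: "\<And>i. i < k \<Longrightarrow> s i \<in> grade M (dg i)"
    and es: "\<And>i. i < k \<Longrightarrow> e \<odot>\<^bsub>M\<^esub> s i = s i"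
  shows "(\<lambda>f. finsum M (\<lambda>i. f i \<odot>\<^bsub>M\<^esub> s i) {..<k}) \<in> gmod_hom A F M"
    and "i < k \<Longrightarrow> finsum M (\<lambda>l. basis i l \<odot>\<^bsub>M\<^esub> s l) {..<k} = s i"
proof -
  interpret M: unital_graded_module A M by fact
  have sM: "s i \<in> carrier M" if "i < k" for i using s[OF that] M.grade_closed by blast
  have fA: "f i \<in> carrier A" if "f \<in> carrier F" for f i using that by (auto simp: F_simps)
  have zero: "\<zero>\<^bsub>A\<^esub> \<odot>\<^bsub>M\<^esub> x = \<zero>\<^bsub>M\<^esub>" if "x \<in> carrier M" for x
    using M.smult_l_distr[of "\<zero>\<^bsub>A\<^esub>" "\<zero>\<^bsub>A\<^esub>" x] that M.smult_closed[of "\<zero>\<^bsub>A\<^esub>" x]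
    by (metis A.r_zero A.zero_closed M.add.r_cancel_one')
  show "(\<lambda>f. finsum M (\<lambda>i. f i \<odot>\<^bsub>M\<^esub> s i) {..<k}) \<in> gmod_hom A F M"
  proof (rule gmod_homI)
    fix f assume "f \<in> carrier F"
    then show "finsum M (\<lambda>i. f i \<odot>\<^bsub>M\<^esub> s i) {..<k} \<in> carrier M"
      using fA sM by (intro M.finsum_closed) (auto intro: M.smult_closed)
  next
    fix f g assume fg: "f \<in> carrier F" "g \<in> carrier F"
    have "finsum M (\<lambda>i. (f \<oplus>\<^bsub>F\<^esub> g) i \<odot>\<^bsub>M\<^esub> s i) {..<k} = finsum M (\<lambda>i. f i \<odot>\<^bsub>M\<^esub> s i \<oplus>\<^bsub>M\<^esub> g i \<odot>\<^bsub>M\<^esub> s i) {..<k}"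
      using fA[OF fg(1)] fA[OF fg(2)] sM
      by (intro M.finsum_cong') (auto simp: F_simps M.smult_l_distr M.smult_closed)
    also have "\<dots> = finsum M (\<lambda>i. f i \<odot>\<^bsub>M\<^esub> s i) {..<k} \<oplus>\<^bsub>M\<^esub> finsum M (\<lambda>i. g i \<odot>\<^bsub>M\<^esub> s i) {..<k}"
      using fA[OF fg(1)] fA[OF fg(2)] sM by (intro M.finsum_addf) (auto simp: M.smult_closed)
    finally show "finsum M (\<lambda>i. (f \<oplus>\<^bsub>F\<^esub> g) i \<odot>\<^bsub>M\<^esub> s i) {..<k} =
        finsum M (\<lambda>i. f i \<odot>\<^bsub>M\<^esub> s i) {..<k} \<oplus>\<^bsub>M\<^esub> finsum M (\<lambda>i. g i \<odot>\<^bsub>M\<^esub> s i) {..<k}" .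
  next
    fix a f assume a: "a \<in> carrier A" and f: "f \<in> carrier F"
    have "finsum M (\<lambda>i. (a \<odot>\<^bsub>F\<^esub> f) i \<odot>\<^bsub>M\<^esub> s i) {..<k} = finsum M (\<lambda>i. a \<odot>\<^bsub>M\<^esub> (f i \<odot>\<^bsub>M\<^esub> s i)) {..<k}"
      using a fA[OF f] sM by (intro M.finsum_cong') (auto simp: F_simps M.smult_assoc M.smult_closed)
    also have "\<dots> = a \<odot>\<^bsub>M\<^esub> finsum M (\<lambda>i. f i \<odot>\<^bsub>M\<^esub> s i) {..<k}"
      using a fA[OF f] sM by (intro M.smult_finsum[symmetric]) (auto simp: M.smult_closed)
    finally show "finsum M (\<lambda>i. (a \<odot>\<^bsub>F\<^esub> f) i \<odot>\<^bsub>M\<^esub> s i) {..<k} = a \<odot>\<^bsub>M\<^esub> finsum M (\<lambda>i. f i \<odot>\<^bsub>M\<^esub> s i) {..<k}" .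
  next
    fix n f assume f: "f \<in> grade F n"
    have "f i \<odot>\<^bsub>M\<^esub> s i \<in> grade M n" if "i < k" for i
      using f M.smult_grade[OF _ s[OF that], of "f i" "n - dg i"] by (auto simp: F_simps)
    then show "finsum M (\<lambda>i. f i \<odot>\<^bsub>M\<^esub> s i) {..<k} \<in> grade M n" by (intro M.grade_finsum) auto
  qed
  show "finsum M (\<lambda>l. basis i l \<odot>\<^bsub>M\<^esub> s l) {..<k} = s i" if i: "i < k"
  proof -
    have "finsum M (\<lambda>l. basis i l \<odot>\<^bsub>M\<^esub> s l) {..<k} = finsum M (\<lambda>l. if i = l then s l else \<zero>\<^bsub>M\<^esub>) {..<k}"
      using sM es zero by (intro M.finsum_cong') (auto simp: basis_def)
    then show ?thesis using M.finsum_singleton[of i "{..<k}" s] i sM by auto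
  qed
qed

end

section \<open>Finitely generated projective modules as retracts of shifted free ones\<close>

context lpa
begin

text \<open>A submodule that contains the homogeneous components of the generators contains the
  generators. Degrees are stored along with the components because a component may be zero, which
  lies in every degree.\<close>

lemma homogeneous_generators:
  assumes "unital_graded_module A Z" "fin_gen_gmod A Z"
  obtains S where "finite S" "\<And>d x. (d, x) \<in> S \<Longrightarrow> x \<in> grade Z d"
    "\<And>H. \<lbrakk>submodule H A Z; snd ` S \<subseteq> H\<rbrakk> \<Longrightarrow> H = carrier Z"
proof -
  interpret Z: unital_graded_module A Z by fact
  obtain S where S: "finite S" "S \<subseteq> carrier Z" "\<And>H. submodule H A Z \<and> S \<subseteq> H \<Longrightarrow> H = carrier Z"
    using assms(2) unfolding fin_gen_gmod_def by blast
  have "\<exists>c T. finite T \<and> (\<forall>n. c n \<in> grade Z n) \<and> x = finsum Z c T" if x: "x \<in> S" for x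
  proof -
    have "x \<in> carrier Z" using x S(2) by blast
    then show ?thesis
    proof (rule Z.decompose)
      fix c T assume "finite T" "\<And>n. c n \<in> grade Z n" "x = finsum Z c T"
      then show ?thesis by blast
    qed
  qed
  then obtain c T where c: "\<And>x. x \<in> S \<Longrightarrow> finite (T x)" "\<And>x n. x \<in> S \<Longrightarrow> c x n \<in> grade Z n"
    "\<And>x. x \<in> S \<Longrightarrow> x = finsum Z (c x) (T x)" by metis
  let ?S = "\<Union>x\<in>S. (\<lambda>n. (n, c x n)) ` T x"
  show ?thesis
  proof (rule that[of ?S])
    show "finite ?S" using S(1) c(1) by auto
    show "x \<in> grade Z d" if "(d, x) \<in> ?S" for d x using that c(2) by auto
    fix H assume H: "submodule H A Z" "snd ` ?S \<subseteq> H"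
    interpret H: submodule H A Z by fact
    have fin: "finsum Z f T' \<in> H" if "\<And>n. n \<in> T' \<Longrightarrow> f n \<in> H" for f and T' :: "int set"
      using that
    proof (induction T' rule: infinite_finite_induct)
      case (insert n T')
      then have "f \<in> T' \<rightarrow> carrier Z" "f n \<in> carrier Z" using H.subset by auto
      then show ?case using insert H.m_closed by simp
    qed (use H.one_closed in auto)
    have "x \<in> H" if x: "x \<in> S" for x
    proof -
      have "c x n \<in> H" if "n \<in> T x" for n using that x H(2) by force
      then have "finsum Z (c x) (T x) \<in> H" by (rule fin)
      then show ?thesis using c(3)[OF x] by simp
    qed
    then show "H = carrier Z" using H(1) S(3) by blast
  qed
qed

text \<open>Finitely many homogeneous generators define a graded surjection from a suitable
  \<open>F\<close> onto \<open>Z\<close>. As \<open>F\<close> lives on the same type as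
  \<open>Z\<close>, it is an admissible test module, and projectivity splits the surjection.\<close>

theorem sr1_fg_proj:
  assumes Z: "Z \<in> fg_proj_gmods A"
  shows "sr1 A Z"
proof -
  note Z' = fg_proj_gmodsD[OF Z]
  interpret Z: unital_graded_module A Z by (rule Z'(1))
  obtain S where S: "finite S" "\<And>d x. (d, x) \<in> S \<Longrightarrow> x \<in> grade Z d"
    "\<And>H. \<lbrakk>submodule H A Z; snd ` S \<subseteq> H\<rbrakk> \<Longrightarrow> H = carrier Z"
    using homogeneous_generators[OF Z'(1,3)] by blast
  obtain xs where xs: "set xs = S" using S(1) finite_list by blast
  have "\<exists>W. finite W \<and> W \<subseteq> verts E \<and>
      (\<forall>W'. finite W' \<and> W \<subseteq> W' \<and> W' \<subseteq> verts E \<longrightarrow> cls (unit W') \<odot>\<^bsub>Z\<^esub> snd p = snd p)" if "p \<in> S" for p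
    using that S(2)[of "fst p" "snd p"] by (intro local_unit_module Z'(1)) (auto intro: Z.grade_closed)
  then obtain U where U: "\<And>p. p \<in> S \<Longrightarrow> finite (U p)" "\<And>p. p \<in> S \<Longrightarrow> U p \<subseteq> verts E"
    "\<And>p W'. \<lbrakk>p \<in> S; finite W'; U p \<subseteq> W'; W' \<subseteq> verts E\<rbrakk> \<Longrightarrow> cls (unit W') \<odot>\<^bsub>Z\<^esub> snd p = snd p"
    by metis
  \<comment> \<open>Large enough for one idempotent \<open>e\<close> to fix all generators at
    once.\<close>
  define W where "W = (\<Union>p\<in>S. U p)"
  define dg where "dg i = fst (xs ! i)" for i
  define s where "s i = snd (xs ! i)" for i
  interpret L: lpa_fm E K "length xs" dg W
  proof unfold_locales
    show "finite W" using S(1) U(1) unfolding W_def by blast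
    show "W \<subseteq> verts E" using U(2) unfolding W_def by blast
  qed
  have si: "s i \<in> grade Z (dg i)" "L.e \<odot>\<^bsub>Z\<^esub> s i = s i" if "i < length xs" for i
  proof -
    have p: "xs ! i \<in> S" using that xs by auto
    then show "s i \<in> grade Z (dg i)" using S(2)[of "fst (xs ! i)" "snd (xs ! i)"] by (simp add: s_def dg_def)
    show "L.e \<odot>\<^bsub>Z\<^esub> s i = s i"
      unfolding L.e_def s_def using p L.finite_W L.W_verts by (intro U(3)) (auto simp: W_def)
  qed
  define g where "g f = finsum Z (\<lambda>i. f i \<odot>\<^bsub>Z\<^esub> s i) {..<length xs}" for f
  have g: "g \<in> gmod_hom A L.F Z" unfolding g_def by (rule L.eval_hom[OF Z'(1) si])
  have gb: "g (L.basis i) = s i" if "i < length xs" for i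
    unfolding g_def by (rule L.eval_hom(2)[OF Z'(1) si that])
  interpret P: gmod_pair A L.F Z ..
  have "submodule (g ` carrier L.F) A Z"
  proof (intro submodule.intro subgroup.intro submodule_axioms.intro)
    show "g ` carrier L.F \<subseteq> carrier (add_monoid Z)" using gmod_hom_closed[OF g] by auto
    show "\<one>\<^bsub>add_monoid Z\<^esub> \<in> g ` carrier L.F"
      using imageI[OF L.FM.zero_closed, of g] P.hom_zero[OF g] by simp
  next
    fix x y assume "x \<in> g ` carrier L.F" "y \<in> g ` carrier L.F"
    then obtain f f' where "f \<in> carrier L.F" "x = g f" "f' \<in> carrier L.F" "y = g f'" by blast
    then show "x \<otimes>\<^bsub>add_monoid Z\<^esub> y \<in> g ` carrier L.F"
      using gmod_hom_add[OF g] imageI[of "f \<oplus>\<^bsub>L.F\<^esub> f'" "carrier L.F" g] by simp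
  next
    fix x assume "x \<in> g ` carrier L.F"
    then obtain f where f: "f \<in> carrier L.F" "x = g f" by blast
    have "\<ominus>\<^bsub>Z\<^esub> x \<in> g ` carrier L.F"
      using f P.hom_uminus[OF g f(1)] imageI[of "\<ominus>\<^bsub>L.F\<^esub> f" "carrier L.F" g] by simp
    then show "inv\<^bsub>add_monoid Z\<^esub> x \<in> g ` carrier L.F" by (simp add: a_inv_def)
  next
    fix a x assume a: "a \<in> carrier A" and "x \<in> g ` carrier L.F"
    then obtain f where f: "f \<in> carrier L.F" "x = g f" by blast
    then show "a \<odot>\<^bsub>Z\<^esub> x \<in> g ` carrier L.F"
      using gmod_hom_smult[OF g a f(1)] imageI[OF L.FG.smult_closed[OF a f(1)], of g] by simp
  qed
  moreover have "snd ` S \<subseteq> g ` carrier L.F"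
  proof
    fix x assume "x \<in> snd ` S"
    then obtain i where i: "i < length xs" "x = s i" unfolding xs[symmetric] s_def by (auto simp: in_set_conv_nth)
    then show "x \<in> g ` carrier L.F" using gb[OF i(1)] L.basis_F[OF i(1)] by (metis imageI)
  qed
  ultimately have surj: "g ` carrier L.F = carrier Z" by (rule S(3))
  obtain h where h: "h \<in> gmod_hom A Z L.F" "\<And>x. x \<in> carrier Z \<Longrightarrow> g (h x) = x"
    using Z'(4) L.unital_graded_module_F Z'(1) g surj gmod_hom_id unfolding projective_gmod_def by blast
  show ?thesis
    by (rule sr1_retract[OF L.FG.graded_module_axioms Z'(2) g h L.sr1_F])
qed

end

theorem corollary5p8:
  fixes E :: "('v, 'e) pre_digraph"
  defines "V \<equiv> gr_V (leavitt_path_algebra TYPE('k::field) E (\<lambda>_. 1))"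
  assumes "wf_digraph E"
    and "x \<in> carrier V" and "y \<in> carrier V" and "z \<in> carrier V"
    and "x \<otimes>\<^bsub>V\<^esub> z = y \<otimes>\<^bsub>V\<^esub> z"
  shows "x = y"
proof -
  interpret wf_digraph E by fact
  interpret lpa E "TYPE('k)" ..
  show ?thesis
    using gr_V_cancel[OF sr1_fg_proj] assms unfolding A_def V_def by blast
qed

end
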